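(* Let $k>-\frac12$, let $1<\alpha<p<\infty$ and $0<\beta<\frac{2k+2}{\alpha}$. Put $$\frac{1}{\alpha^{*}}=\frac1\alpha-\frac{\beta}{2k+2},\qquad \frac1{\bar p}=\frac1p\Bigl(1-\frac{\alpha\beta}{2k+2}\Bigr),\qquad \frac1{\bar q}=1-\frac{\alpha\beta}{2k+2}.$$ Then there is a constant $C\ge0$, not depending on $f$, such that $$\|M_\beta f\|_{(L^{\bar q,\infty},L^{\bar p})^{\alpha^*}(\mu)}\le C\,\|f\|_{1,p,\alpha}\qquad\text{for all } f\in(L^1,L^p)^\alpha(\mu),$$ where $$\|g\|_{(L^{\bar q,\infty},L^{\bar p})^{\alpha^*}(\mu)}=\sup_{r>0}\mu(B_r)^{\frac1{\alpha^*}-\frac1{\bar q}-\frac1{\bar p}}\Bigl\|\,y\mapsto\bigl\|g\,(\tau_{-y}\chi_{B_r})^{1/\bar q}\bigr\|_{L^{\bar q,\infty}(\mu)}\Bigr\|_{\bar p}.$$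
   Context: Fix $k>-\frac12$ and let $d\mu(x)=(2^{k+1}\Gamma(k+1))^{-1}|x|^{2k+1}dx$ on $\mathbb R$. $L^p(\mu)$ is the Lebesgue space with norm $\|\cdot\|_p$; $L^0(\mu)$ is the space of ($\mu$-a.e. classes of) complex-valued $\mu$-measurable functions on $\mathbb R$. $\chi_A$ is the characteristic function of $A$. For $r>0$, $B_r=B(0,r)=(-r,r)$, and for $x\ne0$, $B(x,r)=\{y\in\mathbb R:\max\{0,|x|-r\}<|y|<|x|+r\}$. Dunkl translation. Let $j_k(z)=\Gamma(k+1)\sum_{n\ge0}\frac{(-1)^nz^{2n}}{n!\,2^{2n}\Gamma(n+k+1)}$ and let $E_k(\lambda x)=j_k(i\lambda x)+\frac{\lambda x}{2(k+1)}j_{k+1}(i\lambda x)$ be the Dunkl kernel. The Dunkl transform is $\mathcal F_kf(\lambda)=\int_{\mathbb R}E_k(-i\lambda x)f(x)\,d\mu(x)$ for $f\in L^1(\mu)$, extended uniquely to an isometric isomorphism of $L^2(\mu)$. For $y\in\mathbb R$ the translation $\tau_y$ is defined on $L^2(\mu)$ by $\mathcal F_k(\tau_yf)(x)=E_k(ixy)\mathcal F_k(f)(x)$, and it extends to a bounded operator on every $L^p(\mu)$, $1\le p\le\infty$. One has $\int(\tau_yf)\,g\,d\mu=\int f\,(\tau_{-y}g)\,d\mu$ on $L^2(\mu)$, and $\tau_{-y}\chi_{B_r}$ is nonnegative and supported in the closure of $B(y,r)$. Integrals of translates of general functions are understood through this duality: $\int_{\mathbb R}(\tau_y|f|^q)\chi_{B_r}\,d\mu:=\int_{\mathbb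 R}|f|^q\,\tau_{-y}\chi_{B_r}\,d\mu$. Norms. For $1\le q<\infty$, $1\le p\le\infty$, $r>0$, $f\in L^0(\mu)$, ${}_r\|f\|_{q,p}$ is the $L^p(\mu)$-norm in the variable $y$ of $\bigl[\int_{\mathbb R}(\tau_y|f|^q)(x)\chi_{B_r}(x)\,d\mu(x)\bigr]^{1/q}$. For $1\le q\le\alpha\le p\le\infty$, $q<\infty$, $$\|f\|_{q,p,\alpha}=\sup_{r>0}\mu(B_r)^{\frac1\alpha-\frac1q-\frac1p}\;{}_r\|f\|_{q,p},\qquad (L^q,L^p)^\alpha(\mu)=\{f\in L^0(\mu):\|f\|_{q,p,\alpha}<\infty\}.$$ Weak Lebesgue space. With $d_f(t)=\mu(\{x:|f(x)|>t\})$ and $f^*(s)=\inf\{t>0:d_f(t)\le s\}$, $\|f\|_{L^{p,\infty}(\mu)}=\sup_{s>0}s^{1/p}f^*(s)$. Fractional maximal operator. For $0<\beta<2k+2$, $$M_\beta f(x)=\sup_{r>0}\mu(B_r)^{\frac{\beta}{2k+2}-1}\int_{B_r}\tau_x|f|(y)\,d\mu(y).$$ *)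

theory Defs
  imports "HOL-Analysis.Analysis"
begin

definition dunkl_measure :: "real \<Rightarrow> real measure" where
  "dunkl_measure k =
     density lborel (\<lambda>x. ennreal (\<bar>x\<bar> powr (2 * k + 1) / (2 powr (k + 1) * Gamma (k + 1))))"

abbreviation centred_ball :: "real \<Rightarrow> real set" where
  "centred_ball r \<equiv> {-r<..<r}"

definition dunkl_L2 :: "real \<Rightarrow> (real \<Rightarrow> complex) set" where
  "dunkl_L2 k = {f \<in> borel_measurable (dunkl_measure k).
                   integrable (dunkl_measure k) (\<lambda>x. (cmod (f x))\<^sup>2)}"

definition normalized_bessel :: "real \<Rightarrow> complex \<Rightarrow> complex" where
  "normalized_bessel k z =
     of_real (Gamma (k + 1)) *
     (\<Sum>n. (-1) ^ n * z ^ (2 * n) / (fact n * 2 ^ (2 * n) * of_real (Gamma (real n + k + 1))))"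

text \<open>
  The kernel depends on the spectral parameter and the point only through their product,
  which is the argument \<open>w\<close> here.
\<close>

definition dunkl_kernel :: "real \<Rightarrow> complex \<Rightarrow> complex" where
  "dunkl_kernel k w =
     normalized_bessel k (\<i> * w) + w / of_real (2 * (k + 1)) * normalized_bessel (k + 1) (\<i> * w)"

definition dunkl_transform_L1 :: "real \<Rightarrow> (real \<Rightarrow> complex) \<Rightarrow> real \<Rightarrow> complex" where
  "dunkl_transform_L1 k f l =
     (LINT x|dunkl_measure k. dunkl_kernel k (- \<i> * of_real (l * x)) * f x)"

text \<open>
  The continuous extension of the transform from \<open>L\<^sup>1 \<inter> L\<^sup>2\<close> to \<open>L\<^sup>2\<close>: the value at \<open>f\<close> is the
  \<open>L\<^sup>2\<close>-limit of the transforms of any functions in \<open>L\<^sup>1 \<inter> L\<^sup>2\<close> approximating \<open>f\<close> in \<open>L\<^sup>2\<close>. Functions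
  stand for their almost-everywhere classes, so \<open>SOME\<close> only picks a representative. The squared
  distances are nonnegative integrals, hence infinite (not \<open>0\<close>) off \<open>L\<^sup>2\<close>.
\<close>

definition dunkl_transform_L2 :: "real \<Rightarrow> (real \<Rightarrow> complex) \<Rightarrow> real \<Rightarrow> complex" where
  "dunkl_transform_L2 k f =
     (SOME g. g \<in> dunkl_L2 k \<and>
        (\<exists>h. (\<forall>n::nat. h n \<in> dunkl_L2 k \<and> integrable (dunkl_measure k) (h n)) \<and>
             (\<lambda>n. \<integral>\<^sup>+x. ennreal ((cmod (h n x - f x))\<^sup>2) \<partial>dunkl_measure k) \<longlonglongrightarrow> 0 \<and>
             (\<lambda>n. \<integral>\<^sup>+l. ennreal ((cmod (dunkl_transform_L1 k (h n) l - g l))\<^sup>2)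
                    \<partial>dunkl_measure k) \<longlonglongrightarrow> 0))"

definition dunkl_translate :: "real \<Rightarrow> real \<Rightarrow> (real \<Rightarrow> complex) \<Rightarrow> real \<Rightarrow> complex" where
  "dunkl_translate k y f =
     (SOME g. g \<in> dunkl_L2 k \<and>
        (AE x in dunkl_measure k.
           dunkl_transform_L2 k g x =
           dunkl_kernel k (\<i> * of_real (x * y)) * dunkl_transform_L2 k f x))"

text \<open>
  \<open>\<tau>\<^sub>-\<^sub>y \<chi>\<^bsub>B(0,r)\<^esub>\<close>, read as a real function: it is real and nonnegative almost everywhere, so \<open>Re\<close>
  only changes the representative.
\<close>

definition translated_ball :: "real \<Rightarrow> real \<Rightarrow> real \<Rightarrow> real \<Rightarrow> real" where
  "translated_ball k r y x = Re (dunkl_translate k (-y) (indicator (centred_ball r)) x)"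

text \<open>
  \<open>\<integral> (\<tau>\<^sub>y h) \<chi>\<^bsub>B(0,r)\<^esub> d\<mu>\<close> for a nonnegative function \<open>h\<close>, understood through duality.
\<close>

definition ball_integral_translate ::
    "real \<Rightarrow> real \<Rightarrow> (real \<Rightarrow> real) \<Rightarrow> real \<Rightarrow> ennreal" where
  "ball_integral_translate k r h y =
     (\<integral>\<^sup>+x. ennreal (h x * translated_ball k r y x) \<partial>dunkl_measure k)"

text \<open>Real powers on \<open>[0,\<infinity>]\<close>; only meant for exponents \<open>a > 0\<close>.\<close>

definition ennreal_rpow :: "ennreal \<Rightarrow> real \<Rightarrow> ennreal" where
  "ennreal_rpow x a = (if x = \<infinity> then \<infinity> else ennreal (enn2real x powr a))"

definition Lp_norm :: "real \<Rightarrow> real \<Rightarrow> (real \<Rightarrow> ennreal) \<Rightarrow> ennreal" where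
  "Lp_norm k p F = ennreal_rpow (\<integral>\<^sup>+y. ennreal_rpow (F y) p \<partial>dunkl_measure k) (1 / p)"

definition local_amalgam_norm ::
    "real \<Rightarrow> real \<Rightarrow> real \<Rightarrow> real \<Rightarrow> (real \<Rightarrow> complex) \<Rightarrow> ennreal" where
  "local_amalgam_norm k r q p f =
     Lp_norm k p
       (\<lambda>y. ennreal_rpow (ball_integral_translate k r (\<lambda>x. cmod (f x) powr q) y) (1 / q))"

definition amalgam_norm ::
    "real \<Rightarrow> real \<Rightarrow> real \<Rightarrow> real \<Rightarrow> (real \<Rightarrow> complex) \<Rightarrow> ennreal" where
  "amalgam_norm k q p \<alpha> f =
     (SUP r\<in>{0<..}.
        ennreal (measure (dunkl_measure k) (centred_ball r) powr (1 / \<alpha> - 1 / q - 1 / p)) *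
        local_amalgam_norm k r q p f)"

definition amalgam_space ::
    "real \<Rightarrow> real \<Rightarrow> real \<Rightarrow> real \<Rightarrow> (real \<Rightarrow> complex) set" where
  "amalgam_space k q p \<alpha> =
     {f \<in> borel_measurable (dunkl_measure k). amalgam_norm k q p \<alpha> f < \<infinity>}"

definition distribution_fun :: "real \<Rightarrow> (real \<Rightarrow> ennreal) \<Rightarrow> real \<Rightarrow> ennreal" where
  "distribution_fun k g t = emeasure (dunkl_measure k) {x. ennreal t < g x}"

definition decreasing_rearrangement :: "real \<Rightarrow> (real \<Rightarrow> ennreal) \<Rightarrow> real \<Rightarrow> ennreal" where
  "decreasing_rearrangement k g s =
     (INF t\<in>{t. 0 < t \<and> distribution_fun k g t \<le> ennreal s}. ennreal t)"

definition weak_Lp_norm :: "real \<Rightarrow> real \<Rightarrow> (real \<Rightarrow> ennreal) \<Rightarrow> ennreal" where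
  "weak_Lp_norm k p g =
     (SUP s\<in>{0<..}. ennreal (s powr (1 / p)) * decreasing_rearrangement k g s)"

definition weak_amalgam_norm ::
    "real \<Rightarrow> real \<Rightarrow> real \<Rightarrow> real \<Rightarrow> (real \<Rightarrow> ennreal) \<Rightarrow> ennreal" where
  "weak_amalgam_norm k q p \<alpha> g =
     (SUP r\<in>{0<..}.
        ennreal (measure (dunkl_measure k) (centred_ball r) powr (1 / \<alpha> - 1 / q - 1 / p)) *
        Lp_norm k p
          (\<lambda>y. weak_Lp_norm k q (\<lambda>x. g x * ennreal (translated_ball k r y x powr (1 / q)))))"

definition fractional_maximal ::
    "real \<Rightarrow> real \<Rightarrow> (real \<Rightarrow> complex) \<Rightarrow> real \<Rightarrow> ennreal" where
  "fractional_maximal k \<beta> f x =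
     (SUP r\<in>{0<..}.
        ennreal (measure (dunkl_measure k) (centred_ball r) powr (\<beta> / (2 * k + 2) - 1)) *
        ball_integral_translate k r (\<lambda>z. cmod (f z)) x)"

end

theory Submission
  imports Defs "HOL-Probability.Probability"
begin

text \<open>
  Write \<open>d = 2k + 2\<close> and \<open>a = \<alpha>\<beta>/d\<close>, so that \<open>0 < a < 1\<close>, \<open>1/qbar = 1 - a\<close> and \<open>pbar = p qbar\<close>. The estimate is
  the boundedness of the maximal operator \<open>M\<close> (the case of no fractional exponent) from the amalgam space to its
  weak variant, transported to \<open>M\<^sub>\<beta>\<close> by interpolation with a Morrey bound. If \<open>A\<^sub>s(x)\<close> is the integral of \<open>|f|\<close>
  against the translate \<open>\<tau>\<^sub>-\<^sub>x \<chi>\<close> of the indicator of \<open>B\<^sub>s\<close>, then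
  \<open>\<mu>(B\<^sub>s)^(\<beta>/d - 1) A\<^sub>s = (\<mu>(B\<^sub>s)^(-1) A\<^sub>s)^(1-a) (\<mu>(B\<^sub>s)^(1/\<alpha> - 1) A\<^sub>s)^a\<close>, and the second factor is at most
  \<open>C \<parallel>f\<parallel>^a\<close> because averaging the \<open>p\<close>-th powers over a neighbourhood bounds \<open>A\<^sub>s\<close> pointwise by its \<open>L\<^sup>p\<close>
  norm (\<open>annulus_avg_pointwise\<close>). Hence \<open>M\<^sub>\<beta> f \<le> C \<parallel>f\<parallel>^a (M f)^(1-a)\<close>, and the exponents are such that the
  powers of the radius in the norms match.

  For \<open>M f\<close> on the annulus \<open>B(y,r)\<close> the function is split at distance \<open>2r\<close>. The near part is controlled by the weak
  type estimate that follows from Vitali's covering lemma (\<open>annular_weak_type\<close>); the far part is dominated by the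
  averages around \<open>y\<close> at the radii \<open>2^j r\<close> (\<open>annular_cover\<close>), whose \<open>L\<^sup>p\<close> norms decay geometrically as
  \<open>1/\<alpha> > 1/p\<close> (\<open>dyadic_majorant\<close>).

  All this rests on two-sided bounds for \<open>\<tau>\<^sub>-\<^sub>y \<chi>\<close>, the indicator being that of \<open>B\<^sub>r\<close>: up to constants it is at most
  \<open>\<mu>(B\<^sub>r)/\<mu>(B(y,r))\<close>, supported in \<open>B(y,r)\<close>, and at least this large near \<open>y\<close> (\<open>ball_translate_le\<close>,
  \<open>ball_translate_ge\<close>). They are read off from the formula that expresses the translate as the mass of
  \<open>{t. x\<^sup>2 + y\<^sup>2 - 2xyt < r\<^sup>2}\<close> under a Beta-like measure on \<open>[-1,1]\<close>.

  The translate is defined through the extended Dunkl transform, so this formula (\<open>translated_ball_AE\<close>) needs some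
  of the \<open>L\<^sup>2\<close> theory. Weber's integral of two kernels against a Gaussian (\<open>gaussian_kernel_kernel\<close>), obtained from power series and the
  Chu-Vandermonde identity, is the central computation. It shows that the heat kernel is positive
  with mass one, which gives the Bessel inequality (\<open>dunkl_bessel_inequality\<close>) and with it the
  existence of the extension. It gives the transforms of Gaussians, which by duality and the uniqueness
  of Laplace transforms yield injectivity (\<open>dunkl_transform_L2_inject\<close>). And it verifies the formula for the translates with
  Gaussians in place of the indicator, from which the indicator is reached by the same uniqueness
  theorem (\<open>moment_uniqueness\<close>, \<open>dunkl_transform_ball_translate\<close>).
\<close>

section \<open>The measure and its Gaussian moments\<close>

lemma space_dunkl_measure [simp]: "space (dunkl_measure k) = UNIV"
  by (simp add: dunkl_measure_def)

lemma sets_dunkl_measure [simp, measurable_cong]: "sets (dunkl_measure k) = sets borel"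
  by (simp add: dunkl_measure_def)

definition dunkl_density :: "real \<Rightarrow> real \<Rightarrow> real" where
  "dunkl_density k x = \<bar>x\<bar> powr (2 * k + 1) / (2 powr (k + 1) * Gamma (k + 1))"

lemma dunkl_density_measurable [measurable]: "dunkl_density k \<in> borel_measurable borel"
  unfolding dunkl_density_def by measurable

lemma dunkl_density_nonneg: "k > -1 \<Longrightarrow> 0 \<le> dunkl_density k x"
  by (auto simp: dunkl_density_def intro!: divide_nonneg_nonneg mult_nonneg_nonneg Gamma_real_nonneg)

lemma dunkl_measure_eq: "dunkl_measure k = density lborel (\<lambda>x. ennreal (dunkl_density k x))"
  by (simp add: dunkl_measure_def dunkl_density_def)

lemma sigma_finite_dunkl: "sigma_finite_measure (dunkl_measure k)"
  unfolding dunkl_measure_eq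
  by (subst sigma_finite_measure.sigma_finite_iff_density_finite[OF sigma_finite_lborel]) auto

lemma has_bochner_integral_dunkl_iff:
  fixes f :: "real \<Rightarrow> 'a::{banach, second_countable_topology}"
  assumes "k > -1" and [measurable]: "f \<in> borel_measurable borel"
  shows "has_bochner_integral (dunkl_measure k) f I \<longleftrightarrow>
         has_bochner_integral lborel (\<lambda>x. dunkl_density k x *\<^sub>R f x) I"
  using assms dunkl_density_nonneg[OF assms(1)]
  by (simp add: has_bochner_integral_iff dunkl_measure_eq integrable_density integral_density)

lemma nn_integral_dunkl:
  assumes "k > -1" and [measurable]: "f \<in> borel_measurable borel"
  shows "(\<integral>\<^sup>+x. f x \<partial>dunkl_measure k) = (\<integral>\<^sup>+x. ennreal (dunkl_density k x) * f x \<partial>lborel)"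
  by (simp add: dunkl_measure_eq nn_integral_density)

lemma has_bochner_integral_even:
  fixes h :: "real \<Rightarrow> real"
  assumes "has_bochner_integral lborel (\<lambda>x. indicator {0<..} x * h x) I"
    and "\<And>x. h (- x) = h x"
    and [measurable]: "h \<in> borel_measurable borel"
  shows "has_bochner_integral lborel h (2 * I)"
proof -
  have "has_bochner_integral lborel (\<lambda>x. indicator {0<..} (0 + (-1) * x) * h (0 + (-1) * x)) I"
    using lborel_has_bochner_integral_real_affine_iff
       [of "-1" "\<lambda>x. indicator {0<..} x * h x" I 0] assms(1) by simp
  hence "has_bochner_integral lborel (\<lambda>x. indicator {0<..} (-x) * h x) I"
    using assms(2) by simp
  from has_bochner_integral_add[OF assms(1) this]
  have 1: "has_bochner_integral lborel
     (\<lambda>x. indicator {0<..} x * h x + indicator {0<..} (-x) * h x) (2 * I)" by simp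
  have "AE x in lborel. x \<noteq> (0::real)" by (rule AE_lborel_singleton)
  hence "AE x in lborel. h x = indicator {0<..} x * h x + indicator {0<..} (-x) * h x"
    by eventually_elim (auto simp: indicator_def)
  with 1 show ?thesis
    by (subst has_bochner_integral_cong_AE[of h]) auto
qed

text \<open>
  Substituting \<open>u = s x\<^sup>2\<close> on the half-line turns the integral into Euler's integral for \<open>\<Gamma>\<close>.
\<close>
lemma gaussian_moment:
  fixes \<nu> s :: real
  assumes "\<nu> > -1" and s: "s > 0"
  shows "has_bochner_integral (dunkl_measure \<nu>) (\<lambda>x. x ^ (2 * m) * exp (- s * x\<^sup>2))
           (Gamma (real m + \<nu> + 1) / Gamma (\<nu> + 1) / s ^ m / (2 * s) powr (\<nu> + 1))"
proof -
  define z where "z = real m + \<nu> + 1"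
  have z: "z > 0" using assms by (simp add: z_def)
  let ?f = "\<lambda>t::real. t powr (z - 1) / exp t"
  have "(?f has_integral Gamma z) {0..}" by (rule Gamma_integral_real[OF z])
  moreover have "negligible {x \<in> {0<..} - {0..}. ?f x \<noteq> 0}" "negligible {x \<in> {0..} - {0<..}. ?f x \<noteq> 0}"
    by (rule negligible_subset[of "{0}"]; force)+
  ultimately have "(?f has_integral Gamma z) {0<..}"
    using has_integral_spike_set_eq[of "{0<..}" "{0..}" ?f] by blast
  hence 1: "?f absolutely_integrable_on {0<..} \<and> integral {0<..} ?f = Gamma z"
    by (auto intro!: nonnegative_absolutely_integrable_1 simp: has_integral_iff)
  let ?g = "\<lambda>x::real. s * x\<^sup>2"
  have im: "?g ` {0<..} = {0<..}"
  proof -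
    have "y \<in> ?g ` {0<..}" if "y > 0" for y
      using that s by (intro image_eqI[of _ _ "sqrt (y / s)"]) auto
    thus ?thesis using s by auto
  qed
  have inj: "inj_on ?g {0<..}"
    using s by (auto simp: inj_on_def power2_eq_iff)
  have der: "(?g has_field_derivative 2 * s * x) (at x within {0<..})" for x
    by (auto intro!: derivative_eq_intros)
  have "(\<lambda>x. \<bar>2 * s * x\<bar> * ?f (?g x)) absolutely_integrable_on {0<..} \<and>
      integral {0<..} (\<lambda>x. \<bar>2 * s * x\<bar> * ?f (?g x)) = Gamma z"
    using has_absolute_integral_change_of_variables_1'[of "{0<..}" ?g "\<lambda>x. 2 * s * x" ?f "Gamma z", OF _ der inj] 1
    unfolding im by simp
  hence 2: "set_integrable lebesgue {0<..} (\<lambda>x. \<bar>2 * s * x\<bar> * ?f (?g x))"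
    "(LINT x:{0<..}|lebesgue. \<bar>2 * s * x\<bar> * ?f (?g x)) = Gamma z"
    using set_lebesgue_integral_eq_integral(2)[of "{0<..}" "\<lambda>x. \<bar>2 * s * x\<bar> * ?f (?g x)"] by simp_all
  hence 3: "has_bochner_integral lborel (\<lambda>x. indicator {0<..} x * (\<bar>2 * s * x\<bar> * ?f (?g x))) (Gamma z)"
    unfolding set_integrable_def set_lebesgue_integral_def has_bochner_integral_iff
    by (subst (asm) integrable_completion, simp, subst (asm) integral_completion) auto
  have Gpos: "Gamma (\<nu> + 1) > 0" using assms by (intro Gamma_real_pos) simp
  let ?c = "(2 * s powr z * 2 powr (\<nu> + 1) * Gamma (\<nu> + 1))"
  have pt: "indicator {0<..} x * (dunkl_density \<nu> x * (x ^ (2 * m) * exp (- s * x\<^sup>2))) =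
      1 / ?c * (indicator {0<..} x * (\<bar>2 * s * x\<bar> * ?f (?g x)))" for x
  proof (cases "x > 0")
    case x: True
    have "x powr (2 * (z - 1)) * x = x powr (2 * (z - 1)) * x powr 1"
      using x by simp
    also have "\<dots> = x powr (real (2 * m) + (2 * \<nu> + 1))"
      unfolding powr_add[symmetric] by (rule arg_cong[of _ _ "\<lambda>e. x powr e"]) (simp add: z_def)
    also have "\<dots> = x ^ (2 * m) * x powr (2 * \<nu> + 1)"
      using x by (simp only: powr_add powr_realpow)
    finally have e1: "x powr (2 * (z - 1)) * x = x ^ (2 * m) * x powr (2 * \<nu> + 1)" .
    have e2: "s powr z = s powr (z - 1) * s" using s by (simp add: powr_diff)
    have "(s * x\<^sup>2) powr (z - 1) = s powr (z-1) * x powr (2 * (z - 1))"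
      using x s by (simp add: powr_mult powr_powr flip: powr_numeral)
    hence "\<bar>2 * s * x\<bar> * ?f (?g x) = 2 * (s powr (z - 1) * s) * (x powr (2 * (z - 1)) * x) / exp (s * x\<^sup>2)"
      using x s by simp
    also have "\<dots> = 2 * s powr z * (x ^ (2 * m) * x powr (2 * \<nu> + 1)) * exp (- s * x\<^sup>2)"
      unfolding e1 e2 by (simp add: exp_minus divide_inverse)
    also have "\<dots> = ?c * (dunkl_density \<nu> x * (x ^ (2 * m) * exp (- s * x\<^sup>2)))"
      using x Gpos by (simp add: dunkl_density_def)
    finally show ?thesis using x s Gpos by simp
  qed simp
  have "has_bochner_integral lborel (\<lambda>x. indicator {0<..} x *
       (dunkl_density \<nu> x * (x ^ (2 * m) * exp (- s * x\<^sup>2)))) (1 / ?c * Gamma z)"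
    unfolding pt by (rule has_bochner_integral_mult_right[OF 3])
  hence "has_bochner_integral lborel (\<lambda>x. dunkl_density \<nu> x * (x ^ (2 * m) * exp (- s * x\<^sup>2))) (2 * (1 / ?c * Gamma z))"
    by (rule has_bochner_integral_even) (auto simp: dunkl_density_def)
  moreover have "2 * (1 / ?c * Gamma z) = Gamma (real m + \<nu> + 1) / Gamma (\<nu> + 1) / s ^ m / (2 * s) powr (\<nu> + 1)"
  proof -
    have "s powr z = s ^ m * s powr (\<nu> + 1)"
      using s by (simp add: z_def powr_add powr_realpow add.assoc)
    thus ?thesis using s by (simp add: powr_mult field_simps z_def)
  qed
  ultimately show ?thesis using assms
    by (subst has_bochner_integral_dunkl_iff) (simp_all)
qed

section \<open>Bessel series\<close>

text \<open>
  The Taylor coefficients of the normalised Bessel function, with \<open>\<Gamma>(n + \<nu> + 1)/\<Gamma>(\<nu> + 1)\<close> written as a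
  Pochhammer symbol; the powers of \<open>4\<close> are moved into the argument.
\<close>
definition bessel_coeff :: "real \<Rightarrow> nat \<Rightarrow> real" where
  "bessel_coeff \<nu> n = 1 / (fact n * pochhammer (\<nu> + 1) n)"

lemma pochhammer_shift_pos: "\<nu> > -1 \<Longrightarrow> pochhammer (\<nu> + 1) n > (0::real)"
  by (rule pochhammer_pos) simp

text \<open>
  The Chu-Vandermonde identity \<open>\<Sum>j (-m)_j (-n)_j / (j! (\<nu>+1)_j) = (\<nu>+1+m)_n / (\<nu>+1)_n\<close> with the
  factorials cleared. It is the coefficient identity behind the Gaussian integral of a product of two
  Bessel functions.
\<close>
lemma vandermonde_bessel:
  fixes \<nu> :: real
  assumes "\<nu> > -1"
  shows "(\<Sum>j\<le>min m n. bessel_coeff \<nu> j / (fact (m - j) * fact (n - j))) =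
         pochhammer (\<nu> + 1) (m + n) * bessel_coeff \<nu> m * bessel_coeff \<nu> n"
proof -
  let ?c = "\<nu> + 1"
  have p: "pochhammer (- real m) j = (-1) ^ j * (fact m / fact (m - j))" if "j \<le> m" for m j
  proof -
    have "(-1) ^ j * pochhammer (- real m) j = real (m choose j) * fact j"
      by (simp add: binomial_gbinomial gbinomial_pochhammer)
    hence "(-1) ^ j * ((-1) ^ j * pochhammer (- real m) j) = (-1) ^ j * (real (m choose j) * fact j)"
      by simp
    thus ?thesis using that by (simp add: binomial_fact flip: power_mult_distrib mult.assoc)
  qed
  have p0: "pochhammer (- real m) j = 0" if "j > m" for m j
    using that by (simp add: pochhammer_of_nat_eq_0_iff)
  have "(\<Sum>j\<in>{0..n}. pochhammer (- real m) j * pochhammer (- real n) j / (fact j * pochhammer ?c j))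
      = pochhammer (?c + real m) n / pochhammer ?c n"
    using Vandermonde_pochhammer[of n ?c "- real m"] assms by auto
  also have "(\<Sum>j\<in>{0..n}. pochhammer (- real m) j * pochhammer (- real n) j / (fact j * pochhammer ?c j))
     = (\<Sum>j\<le>min m n. pochhammer (- real m) j * pochhammer (- real n) j / (fact j * pochhammer ?c j))"
    by (rule sum.mono_neutral_right) (auto simp: p0)
  also have "\<dots> = (\<Sum>j\<le>min m n. fact m * fact n * (bessel_coeff \<nu> j / (fact (m - j) * fact (n - j))))"
    by (rule sum.cong)
       (auto simp: p bessel_coeff_def field_simps simp flip: power_add mult_2)
  finally have "fact m * fact n * (\<Sum>j\<le>min m n. bessel_coeff \<nu> j / (fact (m - j) * fact (n - j))) =
      pochhammer (?c + real m) n / pochhammer ?c n"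
    by (simp add: sum_distrib_left)
  moreover have "pochhammer ?c (m + n) = pochhammer ?c m * pochhammer (?c + real m) n"
    by (rule pochhammer_product')
  ultimately show ?thesis
    using pochhammer_shift_pos[OF assms, of m] pochhammer_shift_pos[OF assms, of n]
    by (simp add: bessel_coeff_def field_simps)
qed

lemma bessel_coeff_pos: "\<nu> > -1 \<Longrightarrow> bessel_coeff \<nu> n > 0"
  by (simp add: bessel_coeff_def pochhammer_shift_pos)

text \<open>
  Both sides are the part of degree \<open>N\<close> in \<open>U, V\<close> (with \<open>U V\<close> of degree two) of one double series, and
  the coefficients of \<open>U^m V^(N-m)\<close> agree by the preceding identity. Listing the terms by degree makes
  the left side a Cauchy product, so no double series has to be rearranged later.
\<close>
lemma homogeneous_bessel_product:
  fixes \<nu> :: real and U V :: complex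
  assumes "\<nu> > -1"
  shows "(\<Sum>n\<le>N. (if even n then of_real (bessel_coeff \<nu> (n div 2)) * (U * V) ^ (n div 2) else 0) *
            ((U + V) ^ (N - n) / fact (N - n))) =
         of_real (pochhammer (\<nu> + 1) N) *
           (\<Sum>m\<le>N. of_real (bessel_coeff \<nu> m * bessel_coeff \<nu> (N - m)) * U ^ m * V ^ (N - m))"
proof -
  let ?g = "\<lambda>j. complex_of_real (bessel_coeff \<nu> j)"
  have "(\<Sum>n\<le>N. (if even n then ?g (n div 2) * (U * V) ^ (n div 2) else 0) *
            ((U + V) ^ (N - n) / fact (N - n))) =
        (\<Sum>n\<in>{n. n \<le> N \<and> even n}. ?g (n div 2) * (U * V) ^ (n div 2) * ((U + V) ^ (N - n) / fact (N - n)))"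
    by (rule sum.mono_neutral_cong_right) auto
  also have "\<dots> = (\<Sum>j\<in>{j. 2 * j \<le> N}. ?g j * (U * V) ^ j * ((U + V) ^ (N - 2 * j) / fact (N - 2 * j)))"
    by (rule sum.reindex_bij_witness[of _ "\<lambda>j. 2 * j" "\<lambda>n. n div 2"]) auto
  also have "\<dots> = (\<Sum>j\<in>{j. 2 * j \<le> N}. \<Sum>i\<le>N - 2 * j. 
       ?g j / (fact i * fact (N - 2 * j - i)) * U ^ (i + j) * V ^ (N - j - i))"
  proof (rule sum.cong[OF refl])
    fix j assume "j \<in> {j. 2 * j \<le> N}" hence j: "2 * j \<le> N" by simp
    have "(U + V) ^ (N - 2 * j) / fact (N - 2 * j) =
      (\<Sum>i\<le>N - 2 * j. U ^ i * V ^ (N - 2 * j - i) / (fact i * fact (N - 2 * j - i)))"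
      unfolding binomial_ring sum_divide_distrib
      by (rule sum.cong) (auto simp: binomial_fact field_simps)
    hence "?g j * (U * V) ^ j * ((U + V) ^ (N - 2 * j) / fact (N - 2 * j)) =
      (\<Sum>i\<le>N - 2 * j. ?g j * (U * V) ^ j * (U ^ i * V ^ (N - 2 * j - i) / (fact i * fact (N - 2 * j - i))))"
      by (simp only: sum_distrib_left)
    also have "\<dots> = (\<Sum>i\<le>N - 2 * j. ?g j / (fact i * fact (N - 2 * j - i)) * U ^ (i + j) * V ^ (N - j - i))"
    proof (rule sum.cong[OF refl])
      fix i assume "i \<in> {..N - 2 * j}"
      hence "N - j - i = (N - 2 * j - i) + j" using j by auto
      thus "?g j * (U * V) ^ j * (U ^ i * V ^ (N - 2 * j - i) / (fact i * fact (N - 2 * j - i))) =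
        ?g j / (fact i * fact (N - 2 * j - i)) * U ^ (i + j) * V ^ (N - j - i)"
        by (simp add: power_add power_mult_distrib)
    qed
    finally show "?g j * (U * V) ^ j * ((U + V) ^ (N - 2 * j) / fact (N - 2 * j)) = 
      (\<Sum>i\<le>N - 2 * j. ?g j / (fact i * fact (N - 2 * j - i)) * U ^ (i + j) * V ^ (N - j - i))" .
  qed
  also have "\<dots> = (\<Sum>(j, i)\<in>Sigma {j. 2 * j \<le> N} (\<lambda>j. {..N - 2 * j}).
       ?g j / (fact i * fact (N - 2 * j - i)) * U ^ (i + j) * V ^ (N - j - i))"
  proof (rule sum.Sigma)
    show "finite {j. 2 * j \<le> N}" by (rule finite_subset[of _ "{..N}"]) auto
  qed auto
  also have "\<dots> = (\<Sum>(m, j)\<in>Sigma {..N} (\<lambda>m. {..min m (N - m)}).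
       ?g j / (fact (m - j) * fact (N - m - j)) * U ^ m * V ^ (N - m))"
  proof (rule sum.reindex_bij_witness[of _ "\<lambda>(m, j). (j, m - j)" "\<lambda>(j, i). (i + j, j)"], goal_cases)
    case (5 x)
    obtain j i where x: "x = (j, i)" by (cases x)
    have "N - (i + j) - j = N - 2 * j - i" "N - (i + j) = N - j - i" by auto
    thus ?case by (simp only: x prod.case diff_add_inverse2)
  qed auto
  also have "\<dots> = (\<Sum>m\<le>N. \<Sum>j\<le>min m (N - m).
       ?g j / (fact (m - j) * fact (N - m - j)) * U ^ m * V ^ (N - m))"
    by (rule sum.Sigma[symmetric]) auto
  also have "\<dots> = (\<Sum>m\<le>N. of_real (\<Sum>j\<le>min m (N - m). bessel_coeff \<nu> j / (fact (m - j) * fact (N - m - j)))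
       * U ^ m * V ^ (N - m))"
    by (simp add: sum_distrib_right)
  also have "\<dots> = of_real (pochhammer (\<nu> + 1) N) *
           (\<Sum>m\<le>N. of_real (bessel_coeff \<nu> m * bessel_coeff \<nu> (N - m)) * U ^ m * V ^ (N - m))"
    unfolding sum_distrib_left
    by (rule sum.cong[OF refl], subst vandermonde_bessel[OF assms]) (auto simp: mult_ac)
  finally show ?thesis .
qed

text \<open>
  This is \<open>j\<^sub>\<nu>(i w)\<close>, the modified (non-oscillating) form, which is the even part of the Dunkl kernel
  as a function of its argument \<open>w\<close>.
\<close>
definition bessel_even :: "real \<Rightarrow> complex \<Rightarrow> complex" where
  "bessel_even \<nu> w = (\<Sum>n. of_real (bessel_coeff \<nu> n) * (w / 2) ^ (2 * n))"

lemma bessel_coeff_summable: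
  assumes "\<nu> > -1"
  shows "summable (\<lambda>n. norm (of_real (bessel_coeff \<nu> n) * z ^ n :: complex))"
proof (rule summable_ratio_test)
  define n0 where "n0 = nat \<lceil>2 * norm z / (\<nu> + 1)\<rceil>"
  let ?f = "\<lambda>n. norm (of_real (bessel_coeff \<nu> n) * z ^ n :: complex)"
  show "(1 / 2 :: real) < 1" by simp
  fix n :: nat assume n: "n \<ge> n0"
  have "2 * norm z / (\<nu> + 1) \<le> real n" using n unfolding n0_def by linarith
  hence "2 * norm z \<le> real n * (\<nu> + 1)" using assms by (simp add: field_simps)
  also have "\<dots> \<le> real (Suc n) * (\<nu> + 1 + real n)" using assms by (intro mult_mono) auto
  finally have "norm z \<le> 1 / 2 * (real (Suc n) * (\<nu> + 1 + real n))" by simp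
  moreover have "?f n \<ge> 0" by simp
  ultimately have "norm z * ?f n \<le> 1 / 2 * (real (Suc n) * (\<nu> + 1 + real n)) * ?f n"
    by (intro mult_right_mono)
  moreover have "?f (Suc n) * (real (Suc n) * (\<nu> + 1 + real n)) = norm z * ?f n"
  proof -
    have "bessel_coeff \<nu> (Suc n) * (real (Suc n) * (\<nu> + 1 + real n)) = bessel_coeff \<nu> n"
      using pochhammer_shift_pos[OF assms, of n] assms
      by (simp add: bessel_coeff_def pochhammer_Suc divide_simps)
    hence "bessel_coeff \<nu> (Suc n) * norm z ^ Suc n * (real (Suc n) * (\<nu> + 1 + real n)) =
        norm z * (bessel_coeff \<nu> n * norm z ^ n)"
      by (simp only: power_Suc) (metis mult.assoc mult.commute)
    moreover have "?f n = bessel_coeff \<nu> n * norm z ^ n" for n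
      using bessel_coeff_pos[OF assms, of n] by (simp add: norm_mult norm_power)
    ultimately show ?thesis by (simp only:)
  qed
  ultimately have "?f (Suc n) * (real (Suc n) * (\<nu> + 1 + real n)) \<le> (1 / 2 * ?f n) * (real (Suc n) * (\<nu> + 1 + real n))"
    by (simp add: mult_ac)
  moreover have "real (Suc n) * (\<nu> + 1 + real n) > 0" using assms by (intro mult_pos_pos) auto
  ultimately have "?f (Suc n) \<le> 1 / 2 * ?f n" by (rule mult_right_le_imp_le)
  thus "norm (?f (Suc n)) \<le> 1 / 2 * norm (?f n)" by simp
qed

lemma bessel_even_summable:
  "\<nu> > -1 \<Longrightarrow> summable (\<lambda>n. norm (of_real (bessel_coeff \<nu> n) * (w / 2) ^ (2 * n) :: complex))"
  using bessel_coeff_summable[of \<nu> "(w / 2) ^ 2"] by (simp add: power_mult)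

lemma bessel_even_sums:
  "\<nu> > -1 \<Longrightarrow> (\<lambda>n. of_real (bessel_coeff \<nu> n) * (w / 2) ^ (2 * n)) sums bessel_even \<nu> w"
  unfolding bessel_even_def by (rule summable_sums, rule summable_norm_cancel, rule bessel_even_summable)

lemma summable_norm_Cauchy_product:
  fixes a b :: "nat \<Rightarrow> 'a::{real_normed_div_algebra,banach}"
  assumes "summable (\<lambda>k. norm (a k))" and "summable (\<lambda>k. norm (b k))"
  shows "summable (\<lambda>k. norm (\<Sum>i\<le>k. a i * b (k - i)))"
proof (rule summable_comparison_test')
  show "summable (\<lambda>k. \<Sum>i\<le>k. norm (a i) * norm (b (k - i)))"
    by (rule summable_Cauchy_product) (use assms in auto)
  show "norm (norm (\<Sum>i\<le>k. a i * b (k - i))) \<le> (\<Sum>i\<le>k. norm (a i) * norm (b (k - i)))" for k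
    by (simp add: sum_norm_le norm_mult)
qed

text \<open>
  The generating series of the homogeneous parts is the Cauchy product of an exponential series and of
  the Bessel series, the latter padded with zeros at odd degrees.
\<close>
lemma bessel_exp_product:
  fixes \<nu> :: real and u v :: complex
  assumes nu: "\<nu> > -1"
  defines "c \<equiv> \<lambda>N. of_real (pochhammer (\<nu> + 1) N) *
           (\<Sum>m\<le>N. of_real (bessel_coeff \<nu> m * bessel_coeff \<nu> (N - m)) * (u ^ 2) ^ m * (v ^ 2) ^ (N - m))"
  shows "c sums (exp (u ^ 2 + v ^ 2) * bessel_even \<nu> (2 * u * v))"
    and "summable (\<lambda>N. norm (c N))"
proof -
  let ?q = "\<lambda>n. (if even n then of_real (bessel_coeff \<nu> (n div 2)) * (u ^ 2 * v ^ 2) ^ (n div 2) else 0)"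
  let ?e = "\<lambda>n. (u ^ 2 + v ^ 2) ^ n / fact n :: complex"
  have mono: "strict_mono (\<lambda>n::nat. 2 * n)" by (auto simp: strict_mono_def)
  have odd: "odd n" if "n \<notin> range (\<lambda>n::nat. 2 * n)" for n using that by (auto elim!: evenE)
  have q2: "?q (2 * n) = of_real (bessel_coeff \<nu> n) * (2 * u * v / 2) ^ (2 * n)" for n
    by (simp add: power_mult power_mult_distrib)
  have "(\<lambda>n. ?q (2 * n)) sums bessel_even \<nu> (2 * u * v)"
    unfolding q2 by (rule bessel_even_sums[OF nu])
  hence q: "?q sums bessel_even \<nu> (2 * u * v)"
    using sums_mono_reindex[OF mono, of ?q] odd by simp
  have "summable (\<lambda>n. norm (?q (2 * n)))"
    unfolding q2 by (rule bessel_even_summable[OF nu])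
  hence qn: "summable (\<lambda>n. norm (?q n))"
    using summable_mono_reindex[OF mono, of "\<lambda>n. norm (?q n)"] odd by simp
  have eq0: "?e n = (u ^ 2 + v ^ 2) ^ n /\<^sub>R fact n" for n
    by (simp add: scaleR_conv_of_real divide_inverse mult.commute)
  have en: "summable (\<lambda>n. norm (?e n))"
    unfolding eq0 by (rule summable_norm_exp)
  have es: "(\<Sum>n. ?e n) = exp (u ^ 2 + v ^ 2)"
    unfolding eq0 exp_def ..
  have eq: "c N = (\<Sum>n\<le>N. ?q n * ?e (N - n))" for N
    unfolding c_def by (rule homogeneous_bessel_product[OF nu, symmetric])
  have "(\<lambda>N. \<Sum>n\<le>N. ?q n * ?e (N - n)) sums (bessel_even \<nu> (2 * u * v) * exp (u ^ 2 + v ^ 2))"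
    using Cauchy_product_sums[OF qn en] unfolding es sums_unique[OF q, symmetric] .
  thus "c sums (exp (u ^ 2 + v ^ 2) * bessel_even \<nu> (2 * u * v))"
    unfolding eq by (simp only: mult.commute)
  show "summable (\<lambda>N. norm (c N))"
    unfolding eq by (rule summable_norm_Cauchy_product[OF qn en])
qed


text \<open>
  Weber's second exponential integral. The product of the two Bessel series is integrated term by term
  against the Gaussian; the resulting series is the one summed in the preceding lemma, after the
  variables are scaled by \<open>r\<close> with \<open>r\<^sup>2 = 1/(4s)\<close>.
\<close>
lemma gaussian_bessel_bessel:
  fixes \<nu> s :: real and a b :: complex
  assumes nu: "\<nu> > -1" and s: "s > 0"
  shows "has_bochner_integral (dunkl_measure \<nu>)
     (\<lambda>x. bessel_even \<nu> (a * of_real x) * bessel_even \<nu> (b * of_real x) * of_real (exp (- s * x\<^sup>2)))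
     (of_real (1 / (2 * s) powr (\<nu> + 1)) * exp ((a\<^sup>2 + b\<^sup>2) / of_real (4 * s)) *
        bessel_even \<nu> (a * b / of_real (2 * s)))"
proof -
  let ?d = "\<lambda>(a::complex) (b::complex) N. \<Sum>m\<le>N. of_real (bessel_coeff \<nu> m * bessel_coeff \<nu> (N - m)) * ((a / 2)\<^sup>2) ^ m * ((b / 2)\<^sup>2) ^ (N - m)"
  let ?c = "?d a b"
  let ?f = "\<lambda>N x. ?c N * of_real (x ^ (2 * N) * exp (- s * x\<^sup>2))"
  define A where "A = 1 / (2 * s) powr (\<nu> + 1)"
  define M where "M N = A * pochhammer (\<nu> + 1) N / s ^ N" for N
  \<comment> \<open>Scaling both variables by \<open>r\<close> absorbs the factor \<open>s^(-N)\<close> of the Gaussian moments.\<close>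
  define r where "r = complex_of_real (1 / (2 * sqrt s))"
  have A: "A > 0" using s by (simp add: A_def)
  have M: "M N > 0" for N
    using A s pochhammer_shift_pos[OF nu, of N] by (simp add: M_def)
  have mom: "has_bochner_integral (dunkl_measure \<nu>) (\<lambda>x. x ^ (2 * N) * exp (- s * x\<^sup>2)) (M N)" for N
  proof -
    have "\<nu> + 1 \<notin> \<int>\<^sub>\<le>\<^sub>0" using nu by (auto elim!: nonpos_Ints_cases)
    hence "Gamma (real N + \<nu> + 1) / Gamma (\<nu> + 1) = pochhammer (\<nu> + 1) N"
      by (simp add: pochhammer_Gamma ac_simps)
    thus ?thesis using gaussian_moment[OF nu s, of N] by (simp add: M_def A_def mult.commute)
  qed
  have coef: "(\<Sum>m\<le>N. (of_real (bessel_coeff \<nu> m) * (a * of_real x / 2) ^ (2 * m)) *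
        (of_real (bessel_coeff \<nu> (N - m)) * (b * of_real x / 2) ^ (2 * (N - m)))) =
        ?c N * of_real (x ^ (2 * N))" for N x
  proof -
    have "(of_real (bessel_coeff \<nu> m) * (a * of_real x / 2) ^ (2 * m)) *
      (of_real (bessel_coeff \<nu> (N - m)) * (b * of_real x / 2) ^ (2 * (N - m))) =
      of_real (bessel_coeff \<nu> m * bessel_coeff \<nu> (N - m)) * ((a / 2)\<^sup>2) ^ m * ((b / 2)\<^sup>2) ^ (N - m) * of_real (x ^ (2 * N))"
      if "m \<le> N" for m
    proof -
      have "(of_real x :: complex) ^ (2 * N) = of_real x ^ (2 * m) * of_real x ^ (2 * (N - m))"
        unfolding power_add[symmetric] by (rule arg_cong[of _ _ "\<lambda>e. of_real x ^ e"]) (use that in simp)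
      moreover have "(2::complex) ^ (2 * j) = 4 ^ j" for j by (simp add: power_mult)
      ultimately show ?thesis by (simp add: power_mult_distrib power_divide flip: power_mult)
    qed
    thus ?thesis unfolding sum_distrib_right by (intro sum.cong) auto
  qed
  have ser: "(\<lambda>N. ?f N x) sums (bessel_even \<nu> (a * of_real x) * bessel_even \<nu> (b * of_real x) * of_real (exp (- s * x\<^sup>2)))" for x
  proof -
    have "(\<lambda>N. (\<Sum>m\<le>N. (of_real (bessel_coeff \<nu> m) * (a * of_real x / 2) ^ (2 * m)) *
        (of_real (bessel_coeff \<nu> (N - m)) * (b * of_real x / 2) ^ (2 * (N - m))))) sums
        (bessel_even \<nu> (a * of_real x) * bessel_even \<nu> (b * of_real x))"
      unfolding bessel_even_def
      by (rule Cauchy_product_sums[OF bessel_even_summable[OF nu] bessel_even_summable[OF nu]])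
    hence "(\<lambda>N. ?c N * of_real (x ^ (2 * N)) * of_real (exp (- s * x\<^sup>2))) sums
       (bessel_even \<nu> (a * of_real x) * bessel_even \<nu> (b * of_real x) * of_real (exp (- s * x\<^sup>2)))"
      unfolding coef by (rule sums_mult2)
    thus ?thesis by (simp add: mult.assoc)
  qed
  have sc: "?d a b N * of_real (M N) =
      of_real A * (of_real (pochhammer (\<nu> + 1) N) *
         (\<Sum>m\<le>N. of_real (bessel_coeff \<nu> m * bessel_coeff \<nu> (N - m)) * ((a * r) ^ 2) ^ m * ((b * r) ^ 2) ^ (N - m)))"
    for N and a b :: complex
  proof -
    have r2: "(a * r)\<^sup>2 = (a / 2)\<^sup>2 / of_real s" for a
      using s by (simp add: r_def power_mult_distrib power_divide flip: of_real_power)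
    have "?d a b N = of_real (s ^ N) * (\<Sum>m\<le>N. of_real (bessel_coeff \<nu> m * bessel_coeff \<nu> (N - m)) * ((a * r) ^ 2) ^ m * ((b * r) ^ 2) ^ (N - m))"
      unfolding sum_distrib_left
    proof (rule sum.cong[OF refl])
      fix m assume "m \<in> {..N}"
      hence "(of_real (s ^ N) :: complex) = of_real s ^ m * of_real s ^ (N - m)" by (simp flip: power_add)
      thus "of_real (bessel_coeff \<nu> m * bessel_coeff \<nu> (N - m)) * ((a / 2)\<^sup>2) ^ m * ((b / 2)\<^sup>2) ^ (N - m) =
         of_real (s ^ N) * (of_real (bessel_coeff \<nu> m * bessel_coeff \<nu> (N - m)) * ((a * r) ^ 2) ^ m * ((b * r) ^ 2) ^ (N - m))"
        using s unfolding r2 by (simp add: power_divide)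
    qed
    thus ?thesis using s by (simp add: M_def)
  qed
  have fsum: "(\<lambda>N. ?c N * of_real (M N)) sums (of_real A * (exp ((a * r)\<^sup>2 + (b * r)\<^sup>2) * bessel_even \<nu> (2 * (a * r) * (b * r))))"
    unfolding sc by (intro sums_mult bessel_exp_product nu)
  have nsum: "summable (\<lambda>N. norm (?c N * of_real (M N)))"
    unfolding sc norm_mult[of "of_real A"] by (intro summable_mult bessel_exp_product nu)
  have int: "has_bochner_integral (dunkl_measure \<nu>) (?f N) (?c N * of_real (M N))" for N
    by (intro has_bochner_integral_mult_right has_bochner_integral_of_real mom)
  have nint: "(\<integral>x. norm (?f N x) \<partial>dunkl_measure \<nu>) = norm (?c N * of_real (M N))" for N
  proof -
    have "(\<integral>x. norm (?f N x) \<partial>dunkl_measure \<nu>) = (\<integral>x. norm (?c N) * (x ^ (2 * N) * exp (- s * x\<^sup>2)) \<partial>dunkl_measure \<nu>)"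
      by (rule Bochner_Integration.integral_cong) (auto simp: norm_mult norm_power abs_mult power_even_abs)
    also have "\<dots> = norm (?c N) * M N"
      using mom[of N] by (subst integral_mult_right_zero) (simp add: has_bochner_integral_iff)
    finally show ?thesis using M[of N] by (simp add: norm_mult)
  qed
  have pn: "summable (\<lambda>N. norm (?f N x))" for x
  proof -
    have "summable (\<lambda>N. norm (\<Sum>m\<le>N. (of_real (bessel_coeff \<nu> m) * (a * of_real x / 2) ^ (2 * m)) *
        (of_real (bessel_coeff \<nu> (N - m)) * (b * of_real x / 2) ^ (2 * (N - m))) :: complex))"
      by (rule summable_norm_Cauchy_product[OF bessel_even_summable[OF nu] bessel_even_summable[OF nu]])
    hence "summable (\<lambda>N. norm (?c N * of_real (x ^ (2 * N))))"
      unfolding coef .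
    hence "summable (\<lambda>N. norm (?c N * of_real (x ^ (2 * N))) * exp (- s * x\<^sup>2))"
      by (rule summable_mult2)
    thus ?thesis by (simp add: norm_mult mult.assoc)
  qed
  have fs: "(\<Sum>N. ?f N x) = bessel_even \<nu> (a * of_real x) * bessel_even \<nu> (b * of_real x) * of_real (exp (- s * x\<^sup>2))" for x
    by (rule sums_unique[OF ser, symmetric])
  have i: "integrable (dunkl_measure \<nu>) (?f N)" for N
    using int has_bochner_integral_iff by blast
  have s: "summable (\<lambda>N. \<integral>x. norm (?f N x) \<partial>dunkl_measure \<nu>)"
    unfolding nint by (rule nsum)
  have ints: "integral\<^sup>L (dunkl_measure \<nu>) (?f N) = ?c N * of_real (M N)" for N
    using int has_bochner_integral_iff by blast
  have fin: "integrable (dunkl_measure \<nu>) (\<lambda>x. \<Sum>N. ?f N x)"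
     "(\<lambda>N. integral\<^sup>L (dunkl_measure \<nu>) (?f N)) sums (\<integral>x. (\<Sum>N. ?f N x) \<partial>dunkl_measure \<nu>)"
    using integrable_suminf[OF i _ s] sums_integral[OF i _ s] pn by auto
  have r: "r\<^sup>2 = 1 / of_real (4 * s)"
    using \<open>s > 0\<close> by (simp add: r_def power_divide power_mult_distrib flip: of_real_power)
  have "(\<integral>x. (\<Sum>N. ?f N x) \<partial>dunkl_measure \<nu>) = of_real A * (exp ((a * r)\<^sup>2 + (b * r)\<^sup>2) * bessel_even \<nu> (2 * (a * r) * (b * r)))"
    using sums_unique2[OF fin(2)[unfolded ints] fsum] .
  also have "(a * r)\<^sup>2 + (b * r)\<^sup>2 = (a\<^sup>2 + b\<^sup>2) / of_real (4 * s)"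
    by (simp add: power_mult_distrib r add_divide_distrib)
  also have "2 * (a * r) * (b * r) = 2 * (a * b) * r\<^sup>2"
    by (simp add: power2_eq_square)
  also have "\<dots> = a * b / of_real (2 * s)" unfolding r by simp
  finally show ?thesis
    using fin(1) unfolding fs has_bochner_integral_iff A_def by (simp add: mult.assoc)
qed

section \<open>The Dunkl kernel as a Laplace integral\<close>

text \<open>
  The density of the cosine of the angle in the formula for translates of even functions. It is an affine
  image of a Beta distribution on \<open>[0,1]\<close>, which fixes the normalisation.
\<close>
definition angle_density :: "real \<Rightarrow> real \<Rightarrow> real" where
  "angle_density k t = indicator {-1<..<1} t * ((1 + t) powr (k + 1/2) * (1 - t) powr (k - 1/2)) /
     (2 powr (2 * k + 1) * Beta (k + 3/2) (k + 1/2))"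

definition angle_measure :: "real \<Rightarrow> real measure" where
  "angle_measure k = density lborel (\<lambda>t. ennreal (angle_density k t))"

lemma space_angle_measure [simp]: "space (angle_measure k) = UNIV"
  and sets_angle_measure [simp, measurable_cong]: "sets (angle_measure k) = sets borel"
  by (simp_all add: angle_measure_def)

lemma angle_density_measurable [measurable]: "angle_density k \<in> borel_measurable borel"
  unfolding angle_density_def by measurable

lemma Beta_pos: "a > 0 \<Longrightarrow> b > 0 \<Longrightarrow> Beta a b > (0::real)"
  by (simp add: Beta_def Gamma_real_pos)

context
  fixes k :: real
  assumes k: "k > - 1 / 2"
begin

lemma angle_density_nonneg: "angle_density k t \<ge> 0"
  using Beta_pos[of "k + 3/2" "k + 1/2"] k unfolding angle_density_def by auto

lemma angle_density_integral: "has_bochner_integral lborel (angle_density k) 1"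
proof -
  let ?B = "Beta (k + 3/2) (k + 1/2)"
  let ?f = "\<lambda>b. indicator {0..1} b *\<^sub>R (b powr ((k + 3/2) - 1) * (1 - b) powr ((k + 1/2) - 1))"
  have pos: "?B > 0" by (rule Beta_pos) (use k in auto)
  have si: "set_integrable lborel {0..1} (\<lambda>b. b powr ((k + 3/2) - 1) * (1 - b) powr ((k + 1/2) - 1))"
    by (rule integrable_Beta) (use k in auto)
  hence "(LINT b:{0..1}|lborel. b powr ((k + 3/2) - 1) * (1 - b) powr ((k + 1/2) - 1)) = ?B"
    using has_integral_Beta_real[of "k + 3/2" "k + 1/2"] k
      set_borel_integral_eq_integral(2)[OF si]  by (simp add: has_integral_iff)
  with si have "has_bochner_integral lborel ?f ?B"
    by (simp add: has_bochner_integral_iff set_integrable_def set_lebesgue_integral_def)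
  hence "has_bochner_integral lborel (\<lambda>t. ?f (1/2 + (1/2) * t)) (2 * ?B)"
    using lborel_has_bochner_integral_real_affine_iff[of "1/2" ?f ?B "1/2"] by simp
  hence "has_bochner_integral lborel (\<lambda>t. 1 / (2 * ?B) * ?f (1/2 + (1/2) * t)) (1 / (2 * ?B) * (2 * ?B))"
    by (rule has_bochner_integral_mult_right)
  moreover have "1 / (2 * ?B) * (2 * ?B) = 1" using pos by simp
  moreover have "AE t in lborel. angle_density k t = 1 / (2 * ?B) * ?f (1/2 + (1/2) * t)"
  proof -
    have "AE t in lborel. t \<noteq> (1::real)" "AE t in lborel. t \<noteq> (-1::real)" by (rule AE_lborel_singleton)+
    thus ?thesis
    proof eventually_elim
      case (elim t)
      show ?case
      proof (cases "-1 < t \<and> t < 1")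
        case True
        have "((1 + t) / 2) powr (k + 1/2) * ((1 - t) / 2) powr (k - 1/2) =
          (1 + t) powr (k + 1/2) * (1 - t) powr (k - 1/2) / 2 powr ((k + 1/2) + (k - 1/2))"
          using True by (simp only: powr_divide powr_add) simp
        also have "2 powr ((k + 1/2) + (k - 1/2)) = 2 powr (2 * k + 1) / (2::real)"
          by (simp add: powr_add)
        finally have "((1 + t) / 2) powr (k + 1/2) * ((1 - t) / 2) powr (k - 1/2) =
          (1 + t) powr (k + 1/2) * (1 - t) powr (k - 1/2) / 2 powr (2 * k + 1) * 2" by simp
        moreover have "1/2 + (1/2) * t = (1 + t) / 2" "1 - (1 + t) / 2 = (1 - t) / 2" by (simp_all add: field_simps)
        ultimately show ?thesis using True pos
          by (simp add: angle_density_def field_simps)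
      next
        case False
        thus ?thesis using elim by (auto simp: angle_density_def indicator_def)
      qed
    qed
  qed
  ultimately show ?thesis
    by (subst has_bochner_integral_cong_AE[of "angle_density k"]) auto
qed

lemma prob_space_angle: "prob_space (angle_measure k)"
proof
  have "(\<integral>\<^sup>+t. ennreal (angle_density k t) \<partial>lborel) = 1"
    using angle_density_integral angle_density_nonneg
    by (subst nn_integral_eq_integral) (auto simp: has_bochner_integral_iff)
  thus "emeasure (angle_measure k) (space (angle_measure k)) = 1"
    by (simp add: angle_measure_def emeasure_density)
qed

lemma AE_angle: "AE t in angle_measure k. -1 < t \<and> t < 1"
  unfolding angle_measure_def by (subst AE_density) (auto simp: angle_density_def indicator_def)

lemma integrable_angle_bounded:
  fixes f :: "real \<Rightarrow> 'a::{banach, second_countable_topology}"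
  assumes [measurable]: "f \<in> borel_measurable borel" and "\<And>t. \<bar>t\<bar> \<le> 1 \<Longrightarrow> norm (f t) \<le> C"
  shows "integrable (angle_measure k) f"
proof -
  interpret prob_space "angle_measure k" by (rule prob_space_angle)
  show ?thesis
    by (rule integrable_const_bound[where B = C], rule eventually_mono[OF AE_angle]) (auto intro: assms)
qed

text \<open>
  The function \<open>t^n (1 - t)^(k+1/2) (1 + t)^(k+3/2)\<close> vanishes at both ends of \<open>[-1,1]\<close>, and its
  derivative is the density times a polynomial. The integral of this derivative is zero, which is the recurrence.
\<close>
lemma angle_moment_rec:
  "real n * (\<integral>t. t ^ (n - 1) \<partial>angle_measure k) + (\<integral>t. t ^ n \<partial>angle_measure k) =
   (real n + 2 * k + 2) * (\<integral>t. t ^ (n + 1) \<partial>angle_measure k)"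
proof -
  have intm: "integrable (angle_measure k) (\<lambda>t. t ^ j)" for j
    by (rule integrable_angle_bounded[of _ 1]) (auto simp: power_abs power_le_one)
  let ?Z = "2 powr (2 * k + 1) * Beta (k + 3/2) (k + 1/2)"
  have Z: "?Z > 0" using Beta_pos[of "k + 3/2" "k + 1/2"] k by simp
  let ?q = "\<lambda>t. real n * t ^ (n - 1) + t ^ n - (real n + 2 * k + 2) * t ^ (n + 1)"
  let ?F = "\<lambda>t::real. t ^ n * (1 - t) powr (k + 1/2) * (1 + t) powr (k + 3/2)"
  have "continuous_on {-1..1} ?F"
    using k by (intro continuous_on_mult continuous_on_powr' continuous_on_power continuous_on_diff continuous_on_add continuous_on_const continuous_on_id) auto
  moreover have "(?F has_vector_derivative ?Z * (angle_density k t * ?q t)) (at t)" if t: "t \<in> {-1<..<1}" for t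
  proof -
    have fac: "X * (a * (1 - t)) * (b * (1 + t)) - Y * ((k + 1/2) * a) * (b * (1 + t)) + Y * (a * (1 - t)) * ((k + 3/2) * b)
       = (b * a) * (X * (1 - t * t) - (k + 1/2) * Y * (1 + t) + (k + 3/2) * Y * (1 - t))" for X Y a b
      by (simp add: field_simps)
    have "(?F has_field_derivative
       (real n * t ^ (n - 1) * (1 - t) powr (k + 1/2) * (1 + t) powr (k + 3/2)
       - t ^ n * ((k + 1/2) * (1 - t) powr (k + 1/2 - 1)) * (1 + t) powr (k + 3/2)
       + t ^ n * (1 - t) powr (k + 1/2) * ((k + 3/2) * (1 + t) powr (k + 3/2 - 1)))) (at t)"
      using t by (auto intro!: derivative_eq_intros simp: field_simps)
    also have "k + 1/2 - 1 = k - 1/2" by simp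
    also have "k + 3/2 - 1 = k + 1/2" by simp
    also have "(1 - t) powr (k + 1/2) = (1 - t) powr (k - 1/2) * (1 - t)"
      using t powr_add[of "1 - t" "k - 1/2" 1] by (simp add: add.commute)
    also have "(1 + t) powr (k + 3/2) = (1 + t) powr (k + 1/2) * (1 + t)"
      using t powr_add[of "1 + t" "k + 1/2" 1] by (simp add: add.commute)
    also have "real n * t ^ (n - 1) * ((1 - t) powr (k - 1/2) * (1 - t)) * ((1 + t) powr (k + 1/2) * (1 + t))
       - t ^ n * ((k + 1/2) * (1 - t) powr (k - 1/2)) * ((1 + t) powr (k + 1/2) * (1 + t))
       + t ^ n * ((1 - t) powr (k - 1/2) * (1 - t)) * ((k + 3/2) * (1 + t) powr (k + 1/2))
       = ((1 + t) powr (k + 1/2) * (1 - t) powr (k - 1/2)) * 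
         (real n * t ^ (n - 1) * (1 - t * t) - (k + 1/2) * t ^ n * (1 + t) + (k + 3/2) * t ^ n * (1 - t))"
      by (rule fac)
    also have "real n * t ^ (n - 1) * (1 - t * t) - (k + 1/2) * t ^ n * (1 + t) + (k + 3/2) * t ^ n * (1 - t) = ?q t"
    proof -
      have 1: "real n * t ^ (n - 1) * t = real n * t ^ n" by (cases n) auto
      have "real n * t ^ (n - 1) * (1 - t * t) = real n * t ^ (n - 1) - real n * t ^ (n - 1) * t * t"
        by (simp add: algebra_simps)
      also have "\<dots> = real n * t ^ (n - 1) - real n * t ^ (n + 1)"
        unfolding 1 by simp
      finally have 2: "real n * t ^ (n - 1) * (1 - t * t) = real n * t ^ (n - 1) - real n * t ^ (n + 1)" .
      have 3: "z - (k + 1/2) * y * (1 + t) + (k + 3/2) * y * (1 - t) = z + y - (2 * k + 2) * (t * y)" for y z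
        by (simp add: field_simps)
      show ?thesis unfolding 2 3 by (simp add: algebra_simps)
    qed
    also have "((1 + t) powr (k + 1/2) * (1 - t) powr (k - 1/2)) = ?Z * angle_density k t"
      using t Z by (auto simp: angle_density_def)
    finally show ?thesis by (simp add: has_real_derivative_iff_has_vector_derivative mult.assoc)
  qed
  ultimately have "((\<lambda>t. ?Z * (angle_density k t * ?q t)) has_integral (?F 1 - ?F (-1))) {-1..1}"
    by (intro fundamental_theorem_of_calculus_interior) auto
  hence "((\<lambda>t. ?Z * (angle_density k t * ?q t)) has_integral 0) {-1..1}"
    by simp
  hence "((\<lambda>t. ?Z * (angle_density k t * ?q t)) has_integral 0) UNIV"
    by (rule has_integral_on_superset) (auto simp: angle_density_def)
  moreover have I: "integrable lborel (\<lambda>t. angle_density k t *\<^sub>R ?q t)"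
  proof (subst integrable_density[symmetric])
    show "integrable (density lborel (\<lambda>t. ennreal (angle_density k t))) ?q"
      unfolding angle_measure_def[symmetric]
      by (intro Bochner_Integration.integrable_diff Bochner_Integration.integrable_add integrable_mult_right intm)
  qed (use angle_density_nonneg in auto)
  hence "integrable lborel (\<lambda>t. ?Z * (angle_density k t * ?q t))" by simp
  ultimately have "(\<integral>t. ?Z * (angle_density k t * ?q t) \<partial>lborel) = 0"
    using has_integral_integral_lborel has_integral_unique by blast
  hence "(\<integral>t. angle_density k t *\<^sub>R ?q t \<partial>lborel) = 0"
    using Z by (simp only: integral_mult_right_zero real_scaleR_def mult_eq_0_iff less_irrefl) auto
  also have "(\<integral>t. angle_density k t *\<^sub>R ?q t \<partial>lborel) = (\<integral>t. ?q t \<partial>angle_measure k)"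
    using angle_density_nonneg unfolding angle_measure_def by (subst integral_density) auto
  also have "\<dots> = real n * (\<integral>t. t ^ (n - 1) \<partial>angle_measure k) + (\<integral>t. t ^ n \<partial>angle_measure k) -
   (real n + 2 * k + 2) * (\<integral>t. t ^ (n + 1) \<partial>angle_measure k)"
    using intm[of "n - 1"] intm[of n] intm[of "n + 1"] by simp
  finally show ?thesis by simp
qed

text \<open>
  In the recurrence the moments of order \<open>2n - 1\<close> and \<open>2n\<close> coincide, so it can be solved in steps of two.
\<close>
lemma angle_moments:
  "(\<integral>t. t ^ (2 * n) \<partial>angle_measure k) = pochhammer (1/2) n / pochhammer (k + 1) n"
  "(\<integral>t. t ^ (2 * n + 1) \<partial>angle_measure k) = pochhammer (1/2) (Suc n) / pochhammer (k + 1) (Suc n)"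
proof (induction n)
  interpret prob_space "angle_measure k" by (rule prob_space_angle)
  case 0
  show "(\<integral>t. t ^ (2 * 0) \<partial>angle_measure k) = pochhammer (1/2) 0 / pochhammer (k + 1) 0"
    using prob_space by simp
  thus "(\<integral>t. t ^ (2 * 0 + 1) \<partial>angle_measure k) = pochhammer (1/2) (Suc 0) / pochhammer (k + 1) (Suc 0)"
    using angle_moment_rec[of 0] k prob_space by (simp add: field_simps)
next
  case (Suc n)
  let ?m = "\<lambda>n. \<integral>t. t ^ n \<partial>angle_measure k"
  have pos: "pochhammer (k + 1) n > 0" "pochhammer (k + 1) (Suc n) > 0"
     using pochhammer_shift_pos[of k] k by auto
  have 1: "pochhammer (1/2) (Suc n) / pochhammer (k + 1) (Suc n) =
        pochhammer (1/2) n / pochhammer (k + 1) n * ((1/2 + real n) / (k + 1 + real n))" for n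
    by (simp add: pochhammer_Suc)
  have "real (2 * n + 1) * ?m (2 * n) + ?m (2 * n + 1) = (real (2 * n + 1) + 2 * k + 2) * ?m (2 * Suc n)"
    using angle_moment_rec[of "2 * n + 1"] by simp
  moreover have "?m (2 * n) = ?m (2 * n + 1) * ((k + 1 + real n) / (1/2 + real n))"
    unfolding Suc 1 using k by simp
  moreover have "real (2 * n + 1) * (y * ((k + 1 + real n) / (1/2 + real n))) + y = (real (2 * n + 1) + 2 * k + 2) * y" for y
    by (simp add: field_simps)
  ultimately have "(real (2 * n + 1) + 2 * k + 2) * ?m (2 * n + 1) = (real (2 * n + 1) + 2 * k + 2) * ?m (2 * Suc n)"
    by (simp only:)
  hence e: "?m (2 * Suc n) = ?m (2 * n + 1)" using k by simp
  thus A: "?m (2 * Suc n) = pochhammer (1/2) (Suc n) / pochhammer (k + 1) (Suc n)"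
    using Suc by simp
  have "real (2 * Suc n) * ?m (2 * n + 1) + ?m (2 * Suc n) = (real (2 * Suc n) + 2 * k + 2) * ?m (2 * Suc n + 1)"
    using angle_moment_rec[of "2 * Suc n"] by simp
  hence "(real (2 * Suc n) + 1) * ?m (2 * Suc n) = (real (2 * Suc n) + 2 * k + 2) * ?m (2 * Suc n + 1)"
    unfolding e by (simp add: algebra_simps)
  hence "?m (2 * Suc n + 1) = ?m (2 * Suc n) * ((1/2 + real (Suc n)) / (k + 1 + real (Suc n)))"
    using k by (simp add: field_simps)
  thus "?m (2 * Suc n + 1) = pochhammer (1/2) (Suc (Suc n)) / pochhammer (k + 1) (Suc (Suc n))"
    unfolding A using 1[of "Suc n"] by simp
qed

lemma dunkl_kernel_bessel:
  "dunkl_kernel k w = bessel_even k w + w / of_real (2 * (k + 1)) * bessel_even (k + 1) w"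
proof -
  have "normalized_bessel \<nu> (\<i> * w) = bessel_even \<nu> w" if nu: "\<nu> > -1" for \<nu>
  proof -
    have G: "Gamma (\<nu> + 1) > 0" using nu by (intro Gamma_real_pos) simp
    have np: "\<nu> + 1 \<notin> \<int>\<^sub>\<le>\<^sub>0" using nu by (auto elim!: nonpos_Ints_cases)
    have "(-1) ^ n * (\<i> * w) ^ (2 * n) / (fact n * 2 ^ (2 * n) * of_real (Gamma (real n + \<nu> + 1))) =
       of_real (1 / Gamma (\<nu> + 1)) * (of_real (bessel_coeff \<nu> n) * (w / 2) ^ (2 * n))" for n
    proof -
      have "Gamma (real n + \<nu> + 1) = Gamma (\<nu> + 1) * pochhammer (\<nu> + 1) n"
        using G np by (simp add: pochhammer_Gamma ac_simps)
      moreover have "(-1) ^ n * (\<i> * w) ^ (2 * n) = w ^ (2 * n)"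
        by (simp add: power_mult power_mult_distrib flip: mult.assoc)
           (simp flip: power_mult_distrib)
      ultimately show ?thesis
        by (simp add: bessel_coeff_def power_divide)
    qed
    hence "normalized_bessel \<nu> (\<i> * w) = of_real (Gamma (\<nu> + 1)) * 
       (\<Sum>n. of_real (1 / Gamma (\<nu> + 1)) * (of_real (bessel_coeff \<nu> n) * (w / 2) ^ (2 * n)))"
      unfolding normalized_bessel_def by simp
    also have "(\<Sum>n. of_real (1 / Gamma (\<nu> + 1)) * (of_real (bessel_coeff \<nu> n) * (w / 2) ^ (2 * n))) =
       of_real (1 / Gamma (\<nu> + 1)) * bessel_even \<nu> w"
      using bessel_even_sums[OF nu] by (intro sums_unique[symmetric] sums_mult)
    finally show ?thesis using G by simp
  qed
  from this[of k] this[of "k + 1"] show ?thesis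
    unfolding dunkl_kernel_def using k by simp
qed

text \<open>
  Poisson's representation: the moments of the angle measure are \<open>n!\<close> times the Taylor coefficients of
  the kernel. Positivity on the real line and the bound \<open>1\<close> on the imaginary axis follow from it.
\<close>
lemma dunkl_kernel_laplace: "dunkl_kernel k w = (\<integral>t. exp (w * of_real t) \<partial>angle_measure k)"
proof -
  interpret prob_space "angle_measure k" by (rule prob_space_angle)
  let ?m = "\<lambda>n. \<integral>t. t ^ n \<partial>angle_measure k"
  have mono: "strict_mono (\<lambda>n::nat. 2 * n)" "strict_mono (\<lambda>n::nat. 2 * n + 1)" by (auto simp: strict_mono_def)
  define f where "f n = w ^ n / fact n * complex_of_real (?m n)" for n
  have "(\<lambda>n. if even n then f n else 0) sums bessel_even k w"
  proof (subst sums_mono_reindex[OF mono(1), symmetric])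
    have "f (2 * n) = of_real (bessel_coeff k n) * (w / 2) ^ (2 * n)" for n
    proof -
      have "pochhammer (1/2::real) n \<noteq> 0" using pochhammer_pos[of "1/2::real" n] by simp
      hence "?m (2 * n) / fact (2 * n) = bessel_coeff k n / 2 ^ (2 * n)"
        unfolding angle_moments fact_double by (simp add: bessel_coeff_def field_simps)
      hence "complex_of_real (?m (2 * n) / fact (2 * n)) = of_real (bessel_coeff k n / 2 ^ (2 * n))"
        by (simp only:)
      hence "complex_of_real (?m (2 * n)) / fact (2 * n) = of_real (bessel_coeff k n) / 2 ^ (2 * n)"
        by (simp only: of_real_divide of_real_fact of_real_numeral of_real_power)
      moreover have "f (2 * n) = w ^ (2 * n) * (complex_of_real (?m (2 * n)) / fact (2 * n))"
        unfolding f_def by simp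
      ultimately show ?thesis by (simp only:) (simp add: power_divide)
    qed
    thus "(\<lambda>n. if even (2 * n) then f (2 * n) else 0) sums bessel_even k w"
      using bessel_even_sums[of k w] k by simp
  qed auto
  moreover have "(\<lambda>n. if odd n then f n else 0) sums (w / of_real (2 * (k + 1)) * bessel_even (k + 1) w)"
  proof (subst sums_mono_reindex[OF mono(2), symmetric])
    have "f (2 * n + 1) = w / of_real (2 * (k + 1)) * (of_real (bessel_coeff (k + 1) n) * (w / 2) ^ (2 * n))" for n
    proof -
      have "pochhammer (1/2::real) (Suc n) \<noteq> 0" using pochhammer_pos[of "1/2::real" "Suc n"] by linarith
      moreover have "(fact (2 * n + 1) :: real) = 2 ^ (2 * n + 1) * fact n * pochhammer (1/2) (Suc n)"
      proof -
        have "real (2 * Suc n) * fact (2 * n + 1) = fact (2 * Suc n)" by simp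
        also have "\<dots> = real (2 * Suc n) * (2 ^ (2 * n + 1) * fact n * pochhammer (1/2) (Suc n))"
          unfolding fact_double by (simp add: algebra_simps)
        finally show ?thesis by (subst (asm) mult_cancel_left) auto
      qed
      moreover have "pochhammer (k + 1) (Suc n) = (k + 1) * pochhammer (k + 2) n"
        by (simp add: pochhammer_rec add.assoc)
      moreover have "P / ((k + 1) * Q) / (2 ^ (2 * n + 1) * F * P) = 1 / (F * Q) / 2 ^ (2 * n) / (2 * (k + 1))"
        if "P \<noteq> 0" for P Q F :: real
        using that by simp
      moreover have "k + 1 + 1 = k + 2" by simp
      ultimately have "?m (2 * n + 1) / fact (2 * n + 1) = bessel_coeff (k + 1) n / 2 ^ (2 * n) / (2 * (k + 1))"
        unfolding angle_moments bessel_coeff_def by (simp only:)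
      hence "complex_of_real (?m (2 * n + 1) / fact (2 * n + 1)) = of_real (bessel_coeff (k + 1) n / 2 ^ (2 * n) / (2 * (k + 1)))"
        by (simp only:)
      hence "complex_of_real (?m (2 * n + 1)) / fact (2 * n + 1) = of_real (bessel_coeff (k + 1) n) / 2 ^ (2 * n) / of_real (2 * (k + 1))"
        by (simp only: of_real_divide of_real_fact of_real_numeral of_real_power)
      moreover have "f (2 * n + 1) = w ^ (2 * n + 1) * (complex_of_real (?m (2 * n + 1)) / fact (2 * n + 1))"
        unfolding f_def by simp
      ultimately show ?thesis by (simp only:) (simp add: power_divide mult_ac)
    qed
    thus "(\<lambda>n. if odd (2 * n + 1) then f (2 * n + 1) else 0) sums (w / of_real (2 * (k + 1)) * bessel_even (k + 1) w)"
      using sums_mult[OF bessel_even_sums[of "k + 1" w], of "w / of_real (2 * (k + 1))"] k by simp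
  qed (auto elim!: oddE)
  ultimately have "(\<lambda>n. (if even n then f n else 0) + (if odd n then f n else 0)) sums dunkl_kernel k w"
    unfolding dunkl_kernel_bessel by (rule sums_add)
  also have "(\<lambda>n. (if even n then f n else 0) + (if odd n then f n else 0)) = f" by auto
  finally have f: "f sums dunkl_kernel k w" .
  let ?g = "\<lambda>n t. w ^ n / fact n * complex_of_real (t ^ n)"
  have gb: "norm (?g n t) \<le> norm w ^ n / fact n" if "\<bar>t\<bar> \<le> 1" for n t
  proof -
    have "norm (?g n t) = norm w ^ n / fact n * \<bar>t\<bar> ^ n"
      by (simp add: norm_mult norm_divide norm_power)
    also have "\<dots> \<le> norm w ^ n / fact n * 1"
      using that by (intro mult_left_mono power_le_one) auto
    finally show ?thesis by simp
  qed
  have gi: "integrable (angle_measure k) (?g n)" for n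
    by (rule integrable_angle_bounded[OF _ gb]) auto
  have ge: "(\<integral>t. ?g n t \<partial>angle_measure k) = f n" for n
    unfolding f_def by (simp only: integral_mult_right_zero integral_complex_of_real)
  have es: "summable (\<lambda>n. norm w ^ n / fact n)"
    using summable_norm_exp[of w] by (simp add: norm_power divide_inverse mult.commute)
  have "(\<lambda>n. \<integral>t. ?g n t \<partial>angle_measure k) sums (\<integral>t. (\<Sum>n. ?g n t) \<partial>angle_measure k)"
  proof (rule sums_integral[OF gi])
    show "AE t in angle_measure k. summable (\<lambda>n. norm (?g n t))"
    proof (rule eventually_mono[OF AE_angle])
      fix t :: real assume "-1 < t \<and> t < 1"
      thus "summable (\<lambda>n. norm (?g n t))"
        by (intro summable_comparison_test'[OF es]) (use gb in auto)
    qed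
    show "summable (\<lambda>n. \<integral>t. norm (?g n t) \<partial>angle_measure k)"
    proof (rule summable_comparison_test'[OF es])
      fix n
      have "(\<integral>t. norm (?g n t) \<partial>angle_measure k) \<le> (\<integral>t. norm w ^ n / fact n \<partial>angle_measure k)"
      proof (rule integral_mono_AE[OF integrable_norm[OF gi]])
        show "AE t in angle_measure k. norm (?g n t) \<le> norm w ^ n / fact n"
          by (rule eventually_mono[OF AE_angle], rule gb) auto
      qed simp
      thus "norm (\<integral>t. norm (?g n t) \<partial>angle_measure k) \<le> norm w ^ n / fact n"
        using prob_space by simp
    qed
  qed
  moreover have "(\<Sum>n. ?g n t) = exp (w * of_real t)" for t
    unfolding exp_def by (rule arg_cong[of _ _ suminf], rule ext) (simp add: power_mult_distrib scaleR_conv_of_real field_simps)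
  ultimately show ?thesis
    unfolding ge using sums_unique2[OF f] by simp
qed

lemma dunkl_kernel_measurable [measurable]: "dunkl_kernel k \<in> borel_measurable borel"
proof -
  interpret prob_space "angle_measure k" by (rule prob_space_angle)
  have "dunkl_kernel k = (\<lambda>w. \<integral>t. exp (w * of_real t) \<partial>angle_measure k)"
    by (rule ext) (rule dunkl_kernel_laplace)
  also have "\<dots> \<in> borel_measurable borel" by measurable
  finally show ?thesis .
qed

lemma norm_dunkl_kernel_le_1: "Re w = 0 \<Longrightarrow> norm (dunkl_kernel k w) \<le> 1"
proof -
  interpret prob_space "angle_measure k" by (rule prob_space_angle)
  assume "Re w = 0"
  hence "(\<integral>t. norm (exp (w * of_real t)) \<partial>angle_measure k) = 1"
    using prob_space by simp
  thus ?thesis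
    unfolding dunkl_kernel_laplace by (metis integral_norm_bound)
qed

lemma dunkl_kernel_of_real: "dunkl_kernel k (of_real x) = of_real (\<integral>t. exp (x * t) \<partial>angle_measure k)"
  unfolding dunkl_kernel_laplace
  by (subst integral_complex_of_real[symmetric])
     (simp flip: exp_of_real)

lemma cnj_dunkl_kernel: "cnj (dunkl_kernel k w) = dunkl_kernel k (cnj w)"
  unfolding dunkl_kernel_laplace
  by (subst Bochner_Integration.integral_cnj[symmetric]) (simp add: exp_cnj)

end

section \<open>Gaussian integrals of the kernel\<close>

lemma bessel_even_measurable:
  assumes k: "k > - 1 / 2"
  shows "bessel_even k \<in> borel_measurable borel"
proof -
  note [measurable] = dunkl_kernel_measurable[OF k]
  have "bessel_even k (-w) = bessel_even k w" for w by (simp add: bessel_even_def)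
  moreover have "bessel_even (k + 1) (-w) = bessel_even (k + 1) w" for w by (simp add: bessel_even_def)
  ultimately have "bessel_even k = (\<lambda>w. (dunkl_kernel k w + dunkl_kernel k (-w)) / 2)"
    by (auto simp: dunkl_kernel_bessel[OF k])
  also have "\<dots> \<in> borel_measurable borel" by measurable
  finally show ?thesis .
qed

context
  fixes k :: real
  assumes k: "k > - 1 / 2"
begin

lemma norm_dunkl_kernel_le_exp: "norm (dunkl_kernel k w) \<le> exp (norm w)"
proof -
  interpret prob_space "angle_measure k" by (rule prob_space_angle[OF k])
  have b: "norm (exp (w * of_real t)) \<le> exp (norm w)" if "\<bar>t\<bar> \<le> 1" for t
  proof -
    have "norm (exp (w * of_real t)) \<le> exp (norm (w * of_real t))" by (rule norm_exp)
    also have "norm (w * of_real t) \<le> norm w * 1" unfolding norm_mult using that by (intro mult_left_mono) auto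
    finally show ?thesis by simp
  qed
  have "norm (dunkl_kernel k w) \<le> (\<integral>t. norm (exp (w * of_real t)) \<partial>angle_measure k)"
    unfolding dunkl_kernel_laplace[OF k] by (rule integral_norm_bound)
  also have "\<dots> \<le> (\<integral>t. exp (norm w) \<partial>angle_measure k)"
  proof (rule integral_mono_AE[OF integrable_norm[OF integrable_angle_bounded[OF k _ b]]])
    show "AE t in angle_measure k. norm (exp (w * of_real t)) \<le> exp (norm w)"
      by (rule eventually_mono[OF AE_angle[OF k]], rule b) auto
  qed auto
  finally show ?thesis using prob_space by simp
qed

lemma has_bochner_integral_dunkl_reflect:
  fixes f :: "real \<Rightarrow> 'a::{banach, second_countable_topology}"
  assumes [measurable]: "f \<in> borel_measurable borel"
    and "has_bochner_integral (dunkl_measure k) f I"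
  shows "has_bochner_integral (dunkl_measure k) (\<lambda>x. f (-x)) I"
proof -
  have "has_bochner_integral lborel (\<lambda>x. dunkl_density k x *\<^sub>R f x) I"
    using assms k by (subst (asm) has_bochner_integral_dunkl_iff) auto
  hence "has_bochner_integral lborel (\<lambda>x. dunkl_density k (0 + (-1) * x) *\<^sub>R f (0 + (-1) * x)) I"
    using lborel_has_bochner_integral_real_affine_iff[of "-1" "\<lambda>x. dunkl_density k x *\<^sub>R f x" I 0] by simp
  hence "has_bochner_integral lborel (\<lambda>x. dunkl_density k x *\<^sub>R f (-x)) I"
    by (simp add: dunkl_density_def)
  thus ?thesis using k by (subst has_bochner_integral_dunkl_iff) auto
qed

text \<open>
  Since \<open>x\<^sup>2 d\<mu>\<^sub>k\<close> is a multiple of \<open>d\<mu>\<^sub>k\<^sub>+\<^sub>1\<close>, the odd part of the kernel, which involves the Bessel function of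
  index \<open>k + 1\<close>, is covered by the same Bessel integrals.
\<close>
lemma has_bochner_integral_dunkl_shift:
  fixes f :: "real \<Rightarrow> complex"
  assumes [measurable]: "f \<in> borel_measurable borel"
    and "has_bochner_integral (dunkl_measure (k + 1)) f I"
  shows "has_bochner_integral (dunkl_measure k) (\<lambda>x. of_real (x\<^sup>2) * f x) (of_real (2 * (k + 1)) * I)"
proof -
  have G: "Gamma (k + 1) > 0" using k by (intro Gamma_real_pos) simp
  have "Gamma (k + 1 + 1) = (k + 1) * Gamma (k + 1)"
    using k by (intro Gamma_plus1) (auto elim!: nonpos_Ints_cases)
  hence "dunkl_density k x * x\<^sup>2 = 2 * (k + 1) * dunkl_density (k + 1) x" for x
  proof (cases "x = 0")
    case False
    have e1: "\<bar>x\<bar> powr (2 * (k + 1) + 1) = \<bar>x\<bar> powr (2 * k + 1) * \<bar>x\<bar> powr 2"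
      unfolding powr_add[symmetric] by (simp add: algebra_simps)
    have e2: "\<bar>x\<bar> powr 2 = x\<^sup>2" using False by simp
    have e3: "(2::real) powr (k + 1 + 1) = 2 powr (k + 1) * 2" by (subst powr_add) simp
    assume "Gamma (k + 1 + 1) = (k + 1) * Gamma (k + 1)"
    hence g: "Gamma (k + 1 + 1) = (k + 1) * Gamma (k + 1)" .
    have "P / (B * H) * y = 2 * m * (P * y / (B * 2 * (m * H)))" if "m \<noteq> 0" for P B H y m :: real
      using that by simp
    from this[of "k + 1"] show ?thesis using k
      unfolding dunkl_density_def e1 e2 e3 g by simp
  qed (auto simp: dunkl_density_def)
  hence eq: "dunkl_density k x *\<^sub>R (of_real (x\<^sup>2) * f x) = of_real (2 * (k + 1)) * (dunkl_density (k + 1) x *\<^sub>R f x)" for x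
    by (metis (no_types, lifting) of_real_mult scaleR_conv_of_real mult.assoc)
  have "has_bochner_integral lborel (\<lambda>x. dunkl_density (k + 1) x *\<^sub>R f x) I"
    using assms k by (subst (asm) has_bochner_integral_dunkl_iff) auto
  hence "has_bochner_integral lborel (\<lambda>x. dunkl_density k x *\<^sub>R (of_real (x\<^sup>2) * f x)) (of_real (2 * (k + 1)) * I)"
    unfolding eq by (rule has_bochner_integral_mult_right)
  thus ?thesis using k by (subst has_bochner_integral_dunkl_iff) auto
qed

lemma bessel_even_0: "bessel_even \<nu> 0 = 1"
proof -
  have "(\<lambda>n. of_real (bessel_coeff \<nu> n) * (0 / 2 :: complex) ^ (2 * n)) sums (of_real (bessel_coeff \<nu> 0) * (0 / 2) ^ (2 * 0))"
    by (rule sums_finite[of "{0}", simplified]) auto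
  thus ?thesis by (simp add: bessel_even_def sums_iff bessel_coeff_def)
qed

lemma dunkl_kernel_0 [simp]: "dunkl_kernel k 0 = 1"
  by (simp add: dunkl_kernel_bessel[OF k] bessel_even_0)

lemma integrable_exp_gaussian:
  assumes s: "s > 0"
  shows "integrable (dunkl_measure k) (\<lambda>x. exp (c * \<bar>x\<bar> - s * x\<^sup>2))"
proof (rule Bochner_Integration.integrable_bound)
  show "integrable (dunkl_measure k) (\<lambda>x. exp (c\<^sup>2 / (2 * s)) * (x ^ (2 * 0) * exp (- (s/2) * x\<^sup>2)))"
    using gaussian_moment[of k "s/2" 0] s k by (intro integrable_mult_right) (auto simp: has_bochner_integral_iff)
  show "AE x in dunkl_measure k. norm (exp (c * \<bar>x\<bar> - s * x\<^sup>2)) \<le> norm (exp (c\<^sup>2 / (2 * s)) * (x ^ (2 * 0) * exp (- (s/2) * x\<^sup>2)))"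
  proof (rule AE_I2)
    fix x :: real
    have "0 \<le> (c - s * \<bar>x\<bar>)\<^sup>2 / (2 * s)" using s by simp
    also have "(c - s * \<bar>x\<bar>)\<^sup>2 / (2 * s) = c\<^sup>2 / (2 * s) - c * \<bar>x\<bar> + s * x\<^sup>2 / 2"
      using s by (simp add: power2_eq_square field_simps)
    finally have "c * \<bar>x\<bar> - s * x\<^sup>2 \<le> c\<^sup>2 / (2 * s) + - (s/2) * x\<^sup>2" by simp
    thus "norm (exp (c * \<bar>x\<bar> - s * x\<^sup>2)) \<le> norm (exp (c\<^sup>2 / (2 * s)) * (x ^ (2 * 0) * exp (- (s/2) * x\<^sup>2)))"
      by (simp flip: exp_add)
  qed
qed auto

lemma has_bochner_integral_even_part:
  fixes f :: "real \<Rightarrow> complex"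
  assumes [measurable]: "f \<in> borel_measurable borel"
    and "integrable (dunkl_measure k) f"
    and "has_bochner_integral (dunkl_measure k) (\<lambda>x. (f x + f (-x)) / 2) I"
  shows "has_bochner_integral (dunkl_measure k) f I"
proof -
  obtain J where J: "has_bochner_integral (dunkl_measure k) f J"
    using assms(2) by (auto simp: has_bochner_integral_iff)
  have "has_bochner_integral (dunkl_measure k) (\<lambda>x. (f x + f (-x)) / 2) ((J + J) / 2)"
    by (intro has_bochner_integral_divide has_bochner_integral_add J has_bochner_integral_dunkl_reflect) auto
  hence "J = I" using assms(3) has_bochner_integral_eq by fastforce
  with J show ?thesis by simp
qed

text \<open>
  Weber's integral for the Dunkl kernel. Only the even part of the integrand counts; it splits into a
  product of Bessel functions of index \<open>k\<close> and one of index \<open>k + 1\<close>, to which the Bessel version applies.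
\<close>
lemma gaussian_kernel_kernel:
  assumes s: "s > 0"
  shows "has_bochner_integral (dunkl_measure k)
     (\<lambda>x. dunkl_kernel k (a * of_real x) * dunkl_kernel k (b * of_real x) * of_real (exp (- s * x\<^sup>2)))
     (of_real (1 / (2 * s) powr (k + 1)) * exp ((a\<^sup>2 + b\<^sup>2) / of_real (4 * s)) *
        dunkl_kernel k (a * b / of_real (2 * s)))"
proof (rule has_bochner_integral_even_part)
  note [measurable] = dunkl_kernel_measurable[OF k]
  let ?f = "\<lambda>x. dunkl_kernel k (a * of_real x) * dunkl_kernel k (b * of_real x) * of_real (exp (- s * x\<^sup>2))"
  show "?f \<in> borel_measurable borel" by measurable
  show "integrable (dunkl_measure k) ?f"
  proof (rule Bochner_Integration.integrable_bound[OF integrable_exp_gaussian[OF s, of "norm a + norm b"]])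
    show "AE x in dunkl_measure k. norm (?f x) \<le> norm (exp ((norm a + norm b) * \<bar>x\<bar> - s * x\<^sup>2))"
    proof (rule AE_I2)
      fix x :: real
      have "norm (?f x) \<le> exp (norm (a * of_real x)) * exp (norm (b * of_real x)) * exp (- s * x\<^sup>2)"
        unfolding norm_mult[of "_ * _"] norm_mult[of "dunkl_kernel _ _"]
        by (intro mult_mono norm_dunkl_kernel_le_exp) auto
      also have "\<dots> = exp ((norm a + norm b) * \<bar>x\<bar> - s * x\<^sup>2)"
        by (simp add: norm_mult algebra_simps flip: exp_add)
      finally show "norm (?f x) \<le> norm (exp ((norm a + norm b) * \<bar>x\<bar> - s * x\<^sup>2))" by simp
    qed
  qed measurable
  let ?e = "\<lambda>\<nu> (x::real). bessel_even \<nu> (a * of_real x) * bessel_even \<nu> (b * of_real x) * of_real (exp (- s * x\<^sup>2)) :: complex"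
  let ?c = "complex_of_real (2 * (k + 1))"
  have c: "?c \<noteq> 0" using k unfolding of_real_eq_0_iff by simp
  have ev: "bessel_even \<nu> (- w) = bessel_even \<nu> w" for \<nu> w
    by (simp add: bessel_even_def)
  have alg: "((P + a * x / c * Q) * (R + b * x / c * S) * G + (P + - (a * x) / c * Q) * (R + - (b * x) / c * S) * G) / 2
       = P * R * G + a * b / (c * c) * (x * x * (Q * S * G))" for P Q R S G c x :: complex
  proof -
    have "(P + a * x / c * Q) * (R + b * x / c * S) * G + (P + - (a * x) / c * Q) * (R + - (b * x) / c * S) * G
       = 2 * (P * R * G + a * b / (c * c) * (x * x * (Q * S * G)))"
      by (simp add: divide_inverse algebra_simps)
    thus ?thesis by simp
  qed
  have eq: "(?f x + ?f (-x)) / 2 = ?e k x + a * b / ?c\<^sup>2 * (of_real (x\<^sup>2) * ?e (k + 1) x)" for x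
    using c unfolding dunkl_kernel_bessel[OF k] of_real_minus mult_minus_right ev power2_minus
    by (simp only: power2_eq_square of_real_mult alg)
  let ?I = "\<lambda>\<nu>. of_real (1 / (2 * s) powr (\<nu> + 1)) * exp ((a\<^sup>2 + b\<^sup>2) / of_real (4 * s)) *
        bessel_even \<nu> (a * b / of_real (2 * s))"
  have m: "?e (k + 1) \<in> borel_measurable borel"
  proof -
    have [measurable]: "bessel_even (k + 1) \<in> borel_measurable borel"
      using k by (intro bessel_even_measurable) simp
    show ?thesis by measurable
  qed
  have "has_bochner_integral (dunkl_measure k) (\<lambda>x. (?f x + ?f (-x)) / 2)
      (?I k + a * b / ?c\<^sup>2 * (?c * ?I (k + 1)))"
    unfolding eq using k s
    by (intro has_bochner_integral_add has_bochner_integral_mult_right has_bochner_integral_dunkl_shift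
      gaussian_bessel_bessel m) auto
  also have "?I k + a * b / ?c\<^sup>2 * (?c * ?I (k + 1)) = of_real (1 / (2 * s) powr (k + 1)) * exp ((a\<^sup>2 + b\<^sup>2) / of_real (4 * s)) *
        dunkl_kernel k (a * b / of_real (2 * s))"
  proof -
    have "(2 * s) powr (k + 1 + 1) = (2 * s) powr (k + 1) * (2 * s)"
      using s powr_add[of "2 * s" "k + 1" 1] by simp
    thus ?thesis unfolding dunkl_kernel_bessel[OF k]
      using c s by (simp add: power2_eq_square divide_simps) (simp add: algebra_simps)
  qed
  finally show "has_bochner_integral (dunkl_measure k) (\<lambda>x. (?f x + ?f (-x)) / 2) \<dots>" .
qed

lemma gaussian_kernel:
  assumes s: "s > 0"
  shows "has_bochner_integral (dunkl_measure k)
     (\<lambda>x. dunkl_kernel k (a * of_real x) * of_real (exp (- s * x\<^sup>2)))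
     (of_real (1 / (2 * s) powr (k + 1)) * exp (a\<^sup>2 / of_real (4 * s)))"
  using gaussian_kernel_kernel[OF s, of a 0] by simp

text \<open>
  The transform of \<open>x exp(-s x\<^sup>2)\<close>. Together with the Gaussian itself it tests both parities, which is
  enough for injectivity of the transform.
\<close>
lemma gaussian_kernel_first_moment:
  assumes s: "s > 0"
  shows "has_bochner_integral (dunkl_measure k)
     (\<lambda>x. dunkl_kernel k (a * of_real x) * of_real (x * exp (- s * x\<^sup>2)))
     (of_real (1 / (2 * s) powr (k + 2)) * a * exp (a\<^sup>2 / of_real (4 * s)))"
proof (rule has_bochner_integral_even_part)
  note [measurable] = dunkl_kernel_measurable[OF k]
  let ?f = "\<lambda>x. dunkl_kernel k (a * of_real x) * of_real (x * exp (- s * x\<^sup>2))"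
  show "?f \<in> borel_measurable borel" by measurable
  show "integrable (dunkl_measure k) ?f"
  proof (rule Bochner_Integration.integrable_bound[OF integrable_exp_gaussian[OF s, of "norm a + 1"]])
    show "AE x in dunkl_measure k. norm (?f x) \<le> norm (exp ((norm a + 1) * \<bar>x\<bar> - s * x\<^sup>2))"
    proof (rule AE_I2)
      fix x :: real
      have "\<bar>x\<bar> \<le> exp \<bar>x\<bar>" using exp_ge_add_one_self[of "\<bar>x\<bar>"] by linarith
      hence "norm (?f x) \<le> exp (norm (a * of_real x)) * (exp \<bar>x\<bar> * exp (- s * x\<^sup>2))"
        unfolding norm_mult[of "dunkl_kernel _ _"]
        by (intro mult_mono norm_dunkl_kernel_le_exp) (auto simp: abs_mult norm_mult)
      also have "\<dots> = exp ((norm a + 1) * \<bar>x\<bar> - s * x\<^sup>2)"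
        by (simp add: norm_mult algebra_simps flip: exp_add)
      finally show "norm (?f x) \<le> norm (exp ((norm a + 1) * \<bar>x\<bar> - s * x\<^sup>2))" by simp
    qed
  qed measurable
  let ?e = "\<lambda>(x::real). bessel_even (k + 1) (a * of_real x) * bessel_even (k + 1) (0 * of_real x) * of_real (exp (- s * x\<^sup>2)) :: complex"
  let ?c = "complex_of_real (2 * (k + 1))"
  have c: "?c \<noteq> 0" using k unfolding of_real_eq_0_iff by simp
  have ev: "bessel_even \<nu> (- w) = bessel_even \<nu> w" for \<nu> w
    by (simp add: bessel_even_def)
  have alg: "((P + a * x / c * Q) * (x * G) + (P + - (a * x) / c * Q) * (- x * G)) / 2 = a / c * (x * x * (Q * G))"
    for P Q G c x :: complex
  proof -
    have "(P + a * x / c * Q) * (x * G) + (P + - (a * x) / c * Q) * (- x * G) = 2 * (a / c * (x * x * (Q * G)))"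
      by (simp add: divide_inverse algebra_simps)
    thus ?thesis by simp
  qed
  have eq: "(?f x + ?f (-x)) / 2 = a / ?c * (of_real (x\<^sup>2) * ?e x)" for x
    using c unfolding dunkl_kernel_bessel[OF k] of_real_minus mult_minus_right ev power2_minus
    by (simp only: power2_eq_square of_real_mult of_real_minus mult_zero_left bessel_even_0 alg mult_1_right)
  have m: "?e \<in> borel_measurable borel"
  proof -
    have [measurable]: "bessel_even (k + 1) \<in> borel_measurable borel"
      using k by (intro bessel_even_measurable) simp
    show ?thesis by measurable
  qed
  have "has_bochner_integral (dunkl_measure k) (\<lambda>x. (?f x + ?f (-x)) / 2)
      (a / ?c * (?c * (of_real (1 / (2 * s) powr (k + 1 + 1)) * exp ((a\<^sup>2 + 0\<^sup>2) / of_real (4 * s)) *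
        bessel_even (k + 1) (a * 0 / of_real (2 * s)))))"
    unfolding eq using k s
    by (intro has_bochner_integral_mult_right has_bochner_integral_dunkl_shift gaussian_bessel_bessel m) auto
  also have "a / ?c * (?c * (of_real (1 / (2 * s) powr (k + 1 + 1)) * exp ((a\<^sup>2 + 0\<^sup>2) / of_real (4 * s)) *
        bessel_even (k + 1) (a * 0 / of_real (2 * s)))) = of_real (1 / (2 * s) powr (k + 2)) * a * exp (a\<^sup>2 / of_real (4 * s))"
    using c by (simp add: bessel_even_0 add.commute)
  finally show "has_bochner_integral (dunkl_measure k) (\<lambda>x. (?f x + ?f (-x)) / 2) \<dots>" .
qed

end

section \<open>The multiplication formula and the Bessel inequality\<close>

definition sq_norm :: "real \<Rightarrow> (real \<Rightarrow> complex) \<Rightarrow> ennreal" where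
  "sq_norm k f = (\<integral>\<^sup>+x. ennreal ((cmod (f x))\<^sup>2) \<partial>dunkl_measure k)"

lemma sq_norm_finite: "f \<in> dunkl_L2 k \<Longrightarrow> sq_norm k f < \<infinity>"
  unfolding dunkl_L2_def sq_norm_def by (auto simp: integrable_iff_bounded)

lemma dunkl_L2_iff: "f \<in> dunkl_L2 k \<longleftrightarrow> f \<in> borel_measurable borel \<and> sq_norm k f < \<infinity>"
  unfolding dunkl_L2_def sq_norm_def by (auto simp: integrable_iff_bounded)

lemma sq_norm_add_le:
  assumes [measurable]: "f \<in> borel_measurable borel" "g \<in> borel_measurable borel"
  shows "sq_norm k (\<lambda>x. f x + g x) \<le> 2 * sq_norm k f + 2 * sq_norm k g"
proof -
  have "(cmod (f x + g x))\<^sup>2 \<le> 2 * (cmod (f x))\<^sup>2 + 2 * (cmod (g x))\<^sup>2" for x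
  proof -
    have "(cmod (f x + g x))\<^sup>2 \<le> (cmod (f x) + cmod (g x))\<^sup>2" by (intro power_mono norm_triangle_ineq) auto
    also have "\<dots> \<le> 2 * (cmod (f x))\<^sup>2 + 2 * (cmod (g x))\<^sup>2"
      using sum_squares_bound[of "cmod (f x)" "cmod (g x)"] by (simp add: power2_sum)
    finally show ?thesis .
  qed
  hence "sq_norm k (\<lambda>x. f x + g x) \<le> (\<integral>\<^sup>+x. 2 * ennreal ((cmod (f x))\<^sup>2) + 2 * ennreal ((cmod (g x))\<^sup>2) \<partial>dunkl_measure k)"
    unfolding sq_norm_def
  proof (intro nn_integral_mono)
    fix x
    have "ennreal ((cmod (f x + g x))\<^sup>2) \<le> ennreal (2 * (cmod (f x))\<^sup>2 + 2 * (cmod (g x))\<^sup>2)"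
      by (rule ennreal_leI) fact
    also have "\<dots> = 2 * ennreal ((cmod (f x))\<^sup>2) + 2 * ennreal ((cmod (g x))\<^sup>2)"
      by (simp add: ennreal_mult)
    finally show "ennreal ((cmod (f x + g x))\<^sup>2) \<le> 2 * ennreal ((cmod (f x))\<^sup>2) + 2 * ennreal ((cmod (g x))\<^sup>2)" .
  qed
  also have "\<dots> = 2 * sq_norm k f + 2 * sq_norm k g"
    unfolding sq_norm_def by (simp add: nn_integral_add nn_integral_cmult)
  finally show ?thesis .
qed

lemma sq_norm_diff_le:
  assumes [measurable]: "f \<in> borel_measurable borel" "g \<in> borel_measurable borel"
  shows "sq_norm k (\<lambda>x. f x - g x) \<le> 2 * sq_norm k f + 2 * sq_norm k g"
  using sq_norm_add_le[of f "\<lambda>x. - g x" k] by (simp add: sq_norm_def)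

lemma sq_norm_minus_commute: "sq_norm k (\<lambda>x. f x - g x) = sq_norm k (\<lambda>x. g x - f x)"
  by (simp add: sq_norm_def norm_minus_commute)

lemma dunkl_L2_diff: "f \<in> dunkl_L2 k \<Longrightarrow> g \<in> dunkl_L2 k \<Longrightarrow> (\<lambda>x. f x - g x) \<in> dunkl_L2 k"
proof -
  assume f: "f \<in> dunkl_L2 k" and g: "g \<in> dunkl_L2 k"
  have "sq_norm k (\<lambda>x. f x - g x) \<le> 2 * sq_norm k f + 2 * sq_norm k g"
    using f g by (intro sq_norm_diff_le) (auto simp: dunkl_L2_iff)
  also have "\<dots> < \<infinity>"
    using sq_norm_finite[OF f] sq_norm_finite[OF g] by (simp add: ennreal_mult_less_top)
  finally show ?thesis using f g by (auto simp: dunkl_L2_iff)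
qed

lemma integrable_L2_mult:
  assumes "f \<in> dunkl_L2 k" "g \<in> dunkl_L2 k"
  shows "integrable (dunkl_measure k) (\<lambda>x. f x * g x)"
proof -
  have [measurable]: "f \<in> borel_measurable borel" "g \<in> borel_measurable borel"
    using assms by (auto simp: dunkl_L2_iff)
  show ?thesis
  proof (rule Bochner_Integration.integrable_bound)
    show "integrable (dunkl_measure k) (\<lambda>x. (cmod (f x))\<^sup>2 + (cmod (g x))\<^sup>2)"
      using assms by (auto simp: dunkl_L2_def)
    show "AE x in dunkl_measure k. norm (f x * g x) \<le> norm ((cmod (f x))\<^sup>2 + (cmod (g x))\<^sup>2)"
    proof (rule AE_I2)
      fix x
      have "0 \<le> cmod (f x) * cmod (g x)" "2 * (cmod (f x) * cmod (g x)) \<le> (cmod (f x))\<^sup>2 + (cmod (g x))\<^sup>2"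
        using sum_squares_bound[of "cmod (f x)" "cmod (g x)"] by auto
      thus "norm (f x * g x) \<le> norm ((cmod (f x))\<^sup>2 + (cmod (g x))\<^sup>2)"
        unfolding norm_mult real_norm_def by linarith
    qed
  qed measurable
qed

text \<open>
  The Cauchy-Schwarz inequality in the form \<open>2 u v \<le> u\<^sup>2/d + d v\<^sup>2\<close> with a small weight \<open>d\<close>, which
  works directly with the squared norms.
\<close>
lemma tendsto_L2_pairing:
  assumes h: "\<And>n. h n \<in> dunkl_L2 k" and f: "f \<in> dunkl_L2 k" and g: "g \<in> dunkl_L2 k"
    and lim: "(\<lambda>n. sq_norm k (\<lambda>x. h n x - f x)) \<longlonglongrightarrow> 0"
  shows "(\<lambda>n. \<integral>x. h n x * g x \<partial>dunkl_measure k) \<longlonglongrightarrow> (\<integral>x. f x * g x \<partial>dunkl_measure k)"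
proof -
  define G where "G = enn2real (sq_norm k g)"
  have G: "sq_norm k g = ennreal G" "G \<ge> 0" using sq_norm_finite[OF g] by (auto simp: G_def)
  have [measurable]: "\<And>n. h n \<in> borel_measurable borel" "f \<in> borel_measurable borel" "g \<in> borel_measurable borel"
    using assms by (auto simp: dunkl_L2_iff)
  have "(\<lambda>n. norm ((\<integral>x. h n x * g x \<partial>dunkl_measure k) - (\<integral>x. f x * g x \<partial>dunkl_measure k))) \<longlonglongrightarrow> 0"
  proof (rule LIMSEQ_I)
    fix e :: real assume e: "e > 0"
    define d where "d = e / (G + 1)"
    have d: "d > 0" using e G by (simp add: d_def)
    have dG: "d * G < e" using e G by (simp add: d_def divide_simps)
    have "eventually (\<lambda>n. sq_norm k (\<lambda>x. h n x - f x) < ennreal (e * d)) sequentially"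
      using lim e d by (intro order_tendstoD) auto
    then obtain N where N: "\<And>n. n \<ge> N \<Longrightarrow> sq_norm k (\<lambda>x. h n x - f x) < ennreal (e * d)"
      by (auto simp: eventually_sequentially)
    show "\<exists>N. \<forall>n\<ge>N. norm (norm ((\<integral>x. h n x * g x \<partial>dunkl_measure k) - (\<integral>x. f x * g x \<partial>dunkl_measure k)) - 0) < e"
    proof (intro exI allI impI)
      fix n assume n: "n \<ge> N"
      have "norm ((\<integral>x. h n x * g x \<partial>dunkl_measure k) - (\<integral>x. f x * g x \<partial>dunkl_measure k)) =
            norm (\<integral>x. (h n x - f x) * g x \<partial>dunkl_measure k)"
        using integrable_L2_mult[OF h g] integrable_L2_mult[OF f g]
        by (simp add: left_diff_distrib)
      also have "ennreal \<dots> \<le> (\<integral>\<^sup>+x. ennreal (norm ((h n x - f x) * g x)) \<partial>dunkl_measure k)"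
        by (rule integral_norm_bound_ennreal) (rule integrable_L2_mult[OF dunkl_L2_diff[OF h f] g])
      also have "\<dots> \<le> (\<integral>\<^sup>+x. ennreal (1 / (2 * d)) * ennreal ((cmod (h n x - f x))\<^sup>2) + ennreal (d / 2) * ennreal ((cmod (g x))\<^sup>2) \<partial>dunkl_measure k)"
      proof (rule nn_integral_mono)
        fix x
        have "0 \<le> (cmod (h n x - f x) - d * cmod (g x))\<^sup>2 / (2 * d)" using d by simp
        also have "\<dots> = 1 / (2 * d) * (cmod (h n x - f x))\<^sup>2 + d / 2 * (cmod (g x))\<^sup>2 - cmod (h n x - f x) * cmod (g x)"
          using d by (simp add: power2_diff field_simps power2_eq_square)
        finally have "norm ((h n x - f x) * g x) \<le> 1 / (2 * d) * (cmod (h n x - f x))\<^sup>2 + d / 2 * (cmod (g x))\<^sup>2"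
          by (simp add: norm_mult)
        thus "ennreal (norm ((h n x - f x) * g x)) \<le> ennreal (1 / (2 * d)) * ennreal ((cmod (h n x - f x))\<^sup>2) + ennreal (d / 2) * ennreal ((cmod (g x))\<^sup>2)"
          using d by (simp flip: ennreal_mult ennreal_plus)
      qed
      also have "\<dots> = ennreal (1 / (2 * d)) * sq_norm k (\<lambda>x. h n x - f x) + ennreal (d / 2) * sq_norm k g"
        unfolding sq_norm_def by (simp add: nn_integral_add nn_integral_cmult)
      also have "\<dots> \<le> ennreal (1 / (2 * d)) * ennreal (e * d) + ennreal (d / 2) * sq_norm k g"
        using N[OF n] by (intro add_mono mult_left_mono) auto
      also have "\<dots> = ennreal (e / 2 + d * G / 2)"
        using d e G by (simp flip: ennreal_mult ennreal_plus)
      finally have "norm ((\<integral>x. h n x * g x \<partial>dunkl_measure k) - (\<integral>x. f x * g x \<partial>dunkl_measure k)) \<le> e / 2 + d * G / 2"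
        using d e G by (subst (asm) ennreal_le_iff) auto
      thus "norm (norm ((\<integral>x. h n x * g x \<partial>dunkl_measure k) - (\<integral>x. f x * g x \<partial>dunkl_measure k)) - 0) < e"
        using dG by simp
    qed
  qed
  thus ?thesis by (simp add: tendsto_norm_zero_iff LIM_zero_iff)
qed

lemma cnj_borel_measurable [measurable]: "cnj \<in> borel_measurable borel"
  by (intro borel_measurable_continuous_onI continuous_intros)

context
  fixes k :: real
  assumes k: "k > - 1 / 2"
begin

interpretation dunkl: sigma_finite_measure "dunkl_measure k"
  by (rule sigma_finite_dunkl)

interpretation dunkl2: pair_sigma_finite "dunkl_measure k" "dunkl_measure k" ..

declare dunkl_kernel_measurable[OF k, measurable]

lemma dunkl_transform_L1_bound:
  assumes f: "integrable (dunkl_measure k) f"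
  shows "norm (dunkl_transform_L1 k f l) \<le> (\<integral>x. norm (f x) \<partial>dunkl_measure k)"
proof -
  have "norm (dunkl_transform_L1 k f l) \<le> (\<integral>x. norm (dunkl_kernel k (- \<i> * of_real (l * x)) * f x) \<partial>dunkl_measure k)"
    unfolding dunkl_transform_L1_def by (rule integral_norm_bound)
  also have "\<dots> \<le> (\<integral>x. norm (f x) \<partial>dunkl_measure k)"
  proof (rule integral_mono_AE')
    show "AE x in dunkl_measure k. norm (dunkl_kernel k (- \<i> * of_real (l * x)) * f x) \<le> norm (f x)"
      unfolding norm_mult by (intro AE_I2 mult_left_le_one_le norm_dunkl_kernel_le_1[OF k]) auto
  qed (use f in auto)
  finally show ?thesis .
qed

lemma dunkl_transform_L1_measurable:
  assumes "integrable (dunkl_measure k) f"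
  shows "dunkl_transform_L1 k f \<in> borel_measurable borel"
proof -
  have [measurable]: "f \<in> borel_measurable borel" using assms by auto
  show ?thesis unfolding dunkl_transform_L1_def by measurable
qed

lemma dunkl_transform_integrand:
  assumes "integrable (dunkl_measure k) f"
  shows "integrable (dunkl_measure k) (\<lambda>x. dunkl_kernel k (- \<i> * of_real (l * x)) * f x)"
proof (rule Bochner_Integration.integrable_bound[OF assms])
  have [measurable]: "f \<in> borel_measurable borel" using assms by auto
  show "(\<lambda>x. dunkl_kernel k (- \<i> * of_real (l * x)) * f x) \<in> borel_measurable (dunkl_measure k)" by measurable
  show "AE x in dunkl_measure k. norm (dunkl_kernel k (- \<i> * of_real (l * x)) * f x) \<le> norm (f x)"
    unfolding norm_mult by (intro AE_I2 mult_left_le_one_le norm_dunkl_kernel_le_1[OF k]) auto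
qed

lemma dunkl_transform_L1_diff:
  assumes "integrable (dunkl_measure k) f" "integrable (dunkl_measure k) g"
  shows "dunkl_transform_L1 k (\<lambda>x. f x - g x) l = dunkl_transform_L1 k f l - dunkl_transform_L1 k g l"
  unfolding dunkl_transform_L1_def
  using dunkl_transform_integrand[OF assms(1), of l] dunkl_transform_integrand[OF assms(2), of l]
  by (simp add: right_diff_distrib)

lemma integrable_product_kernel:
  assumes "integrable (dunkl_measure k) f" "integrable (dunkl_measure k) g"
    and H: "H \<in> borel_measurable (borel \<Otimes>\<^sub>M borel)" "\<And>x y. norm (H (x, y)) \<le> 1"
  shows "integrable (dunkl_measure k \<Otimes>\<^sub>M dunkl_measure k) (\<lambda>(x, y). f x * g y * H (x, y) :: complex)"
proof -
  have [measurable]: "f \<in> borel_measurable borel" "g \<in> borel_measurable borel" "H \<in> borel_measurable (borel \<Otimes>\<^sub>M borel)" using assms by auto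
  show ?thesis
  proof (rule Bochner_Integration.integrable_bound)
    show "integrable (dunkl_measure k \<Otimes>\<^sub>M dunkl_measure k) (\<lambda>(x, y). f x * g y)"
    proof (rule dunkl2.Fubini_integrable)
      show "AE x in dunkl_measure k. integrable (dunkl_measure k) (\<lambda>y. case (x, y) of (x, y) \<Rightarrow> f x * g y)"
        using assms by auto
      show "integrable (dunkl_measure k) (\<lambda>x. \<integral>y. norm (case (x, y) of (x, y) \<Rightarrow> f x * g y) \<partial>dunkl_measure k)"
        using assms by (simp add: norm_mult)
    qed measurable
    show "AE z in dunkl_measure k \<Otimes>\<^sub>M dunkl_measure k. norm (case z of (x, y) \<Rightarrow> f x * g y * H (x, y)) \<le> norm (case z of (x, y) \<Rightarrow> f x * g y)"
    proof (rule AE_I2)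
      fix z :: "real \<times> real"
      obtain x y where z: "z = (x, y)" by (cases z)
      show "norm (case z of (x, y) \<Rightarrow> f x * g y * H (x, y)) \<le> norm (case z of (x, y) \<Rightarrow> f x * g y)"
        unfolding z using H(2)[of x y] by (simp add: norm_mult mult_left_le)
    qed
  qed measurable
qed

text \<open>
  Fubini, as the kernel is symmetric in the two variables.
\<close>
lemma dunkl_multiplication_formula:
  assumes f: "integrable (dunkl_measure k) f" and g: "integrable (dunkl_measure k) g"
  shows "(\<integral>l. dunkl_transform_L1 k f l * g l \<partial>dunkl_measure k) = (\<integral>x. f x * dunkl_transform_L1 k g x \<partial>dunkl_measure k)"
proof -
  have [measurable]: "f \<in> borel_measurable borel" "g \<in> borel_measurable borel" using assms by auto
  let ?H = "\<lambda>(x, y). dunkl_kernel k (- \<i> * of_real (x * y))"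
  have int: "integrable (dunkl_measure k \<Otimes>\<^sub>M dunkl_measure k) (\<lambda>(x, y). f x * g y * ?H (x, y))"
    by (rule integrable_product_kernel[OF f g]) (auto intro!: norm_dunkl_kernel_le_1[OF k])
  have "(\<integral>l. dunkl_transform_L1 k f l * g l \<partial>dunkl_measure k) = (\<integral>y. (\<integral>x. f x * g y * ?H (x, y) \<partial>dunkl_measure k) \<partial>dunkl_measure k)"
    unfolding dunkl_transform_L1_def
    by (subst integral_mult_left_zero[symmetric]) (simp add: mult_ac)
  also have "\<dots> = (\<integral>x. (\<integral>y. f x * g y * ?H (x, y) \<partial>dunkl_measure k) \<partial>dunkl_measure k)"
    by (rule dunkl2.Fubini_integral) (use int in simp)
  also have "\<dots> = (\<integral>x. f x * dunkl_transform_L1 k g x \<partial>dunkl_measure k)"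
    unfolding dunkl_transform_L1_def
    by (subst integral_mult_right_zero[symmetric]) (simp add: mult_ac)
  finally show ?thesis .
qed

text \<open>
  The heat kernel of the Dunkl Laplacian at time \<open>s\<close>: the integral of \<open>E(-ixl) E(iyl) exp(-s l\<^sup>2)\<close> over \<open>l\<close>.
  It is written with the angle measure so that its positivity is visible.
\<close>
definition gauss_kernel :: "real \<Rightarrow> real \<Rightarrow> real \<Rightarrow> real" where
  "gauss_kernel s x y = 1 / (2 * s) powr (k + 1) * exp (- (x\<^sup>2 + y\<^sup>2) / (4 * s)) *
      (\<integral>t. exp (x * y / (2 * s) * t) \<partial>angle_measure k)"

lemma gauss_kernel_nonneg: "gauss_kernel s x y \<ge> 0"
  unfolding gauss_kernel_def by (intro mult_nonneg_nonneg Bochner_Integration.integral_nonneg) auto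

lemma gauss_kernel_commute: "gauss_kernel s x y = gauss_kernel s y x"
  by (simp add: gauss_kernel_def ac_simps)

lemma gauss_kernel_eq: 
  "s > 0 \<Longrightarrow> complex_of_real (gauss_kernel s x y) = of_real (1 / (2 * s) powr (k + 1)) *
     of_real (exp (- (x\<^sup>2 + y\<^sup>2) / (4 * s))) * dunkl_kernel k (of_real (x * y / (2 * s)))"
  unfolding gauss_kernel_def dunkl_kernel_of_real[OF k] by simp

lemma gauss_kernel_measurable [measurable]:
  "(\<lambda>(x, y). gauss_kernel s x y) \<in> borel_measurable (borel \<Otimes>\<^sub>M borel)"
proof -
  interpret A: prob_space "angle_measure k" by (rule prob_space_angle[OF k])
  show ?thesis unfolding gauss_kernel_def by measurable
qed

lemma gauss_kernel_integral:
  assumes s: "s > 0"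
  shows "(\<integral>\<^sup>+y. ennreal (gauss_kernel s x y) \<partial>dunkl_measure k) = 1"
proof -
  have s': "1 / (4 * s) > 0" using s by simp
  have e: "exp (- (x\<^sup>2 + y\<^sup>2) / (4 * s)) = exp (- x\<^sup>2 / (4 * s)) * exp (- (1 / (4 * s)) * y\<^sup>2)" for y
    using s by (simp add: field_simps flip: exp_add)
  have "has_bochner_integral (dunkl_measure k)
     (\<lambda>y. of_real (1 / (2 * s) powr (k + 1)) * of_real (exp (- x\<^sup>2 / (4 * s))) *
       (dunkl_kernel k (of_real (x / (2 * s)) * of_real y) * of_real (exp (- (1 / (4 * s)) * y\<^sup>2))))
     (of_real (1 / (2 * s) powr (k + 1)) * of_real (exp (- x\<^sup>2 / (4 * s))) * 
     (of_real (1 / (2 * (1 / (4 * s))) powr (k + 1)) * exp ((of_real (x / (2 * s)))\<^sup>2 / of_real (4 * (1 / (4 * s))))))"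
    by (intro has_bochner_integral_mult_right gaussian_kernel[OF k s'])
  also have "(\<lambda>y. of_real (1 / (2 * s) powr (k + 1)) * of_real (exp (- x\<^sup>2 / (4 * s))) *
       (dunkl_kernel k (of_real (x / (2 * s)) * of_real y) * of_real (exp (- (1 / (4 * s)) * y\<^sup>2))))
     = (\<lambda>y. complex_of_real (gauss_kernel s x y))"
    unfolding gauss_kernel_eq[OF s] e by (simp add: mult_ac)
  also have "of_real (1 / (2 * s) powr (k + 1)) * of_real (exp (- x\<^sup>2 / (4 * s))) * 
     (of_real (1 / (2 * (1 / (4 * s))) powr (k + 1)) * exp ((of_real (x / (2 * s)))\<^sup>2 / of_real (4 * (1 / (4 * s))))) = complex_of_real 1"
  proof -
    have e0: "2 * (1 / (4 * s)) = 1 / (2 * s)" by simp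
    have e1: "1 / (2 * s) powr (k + 1) * (1 / (1 / (2 * s)) powr (k + 1)) = 1"
      using s by (simp add: powr_divide)
    have e2: "(x / (2 * s))\<^sup>2 / (4 * (1 / (4 * s))) = x\<^sup>2 / (4 * s)"
      using s by (simp add: field_simps power2_eq_square)
    have e3: "exp (- x\<^sup>2 / (4 * s)) * exp (x\<^sup>2 / (4 * s)) = 1" by (simp flip: exp_add)
    have "P * E * (Q * E') = 1" if "P * Q = 1" "E * E' = 1" for P E Q E' :: real
    proof -
      have "P * E * (Q * E') = (P * Q) * (E * E')" by simp
      thus ?thesis using that by simp
    qed
    from this[OF e1 e3] have "1 / (2 * s) powr (k + 1) * exp (- x\<^sup>2 / (4 * s)) *
       (1 / (2 * (1 / (4 * s))) powr (k + 1) * exp ((x / (2 * s))\<^sup>2 / (4 * (1 / (4 * s))))) = 1"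
      unfolding e0 e2 .
    hence "complex_of_real (1 / (2 * s) powr (k + 1) * exp (- x\<^sup>2 / (4 * s)) *
       (1 / (2 * (1 / (4 * s))) powr (k + 1) * exp ((x / (2 * s))\<^sup>2 / (4 * (1 / (4 * s)))))) = complex_of_real 1"
      by (simp only:)
    thus ?thesis by (simp only: of_real_mult of_real_power of_real_divide exp_of_real[symmetric])
  qed
  finally have "has_bochner_integral (dunkl_measure k) (gauss_kernel s x) 1"
    by (auto dest: has_bochner_integral_Re)
  thus ?thesis
    using gauss_kernel_nonneg by (subst nn_integral_eq_integral) (auto simp: has_bochner_integral_iff)
qed

text \<open>
  Damping \<open>|F h|\<^sup>2\<close> by \<open>exp(-s l\<^sup>2)\<close> turns its integral into the quadratic form of the heat kernel.
  That kernel is positive, symmetric and of total mass one, so Schur's test with \<open>2|h(x)||h(y)| \<le> |h(x)|\<^sup>2 + |h(y)|\<^sup>2\<close>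
  bounds the form by the squared norm of \<open>h\<close>. Letting \<open>s\<close> tend to \<open>0\<close> removes the damping by Fatou's lemma.
  The inequality replaces the full Plancherel theorem: injectivity is proved separately.
\<close>
lemma dunkl_bessel_inequality:
  assumes h: "integrable (dunkl_measure k) h" and h2: "h \<in> dunkl_L2 k"
  shows "sq_norm k (dunkl_transform_L1 k h) \<le> sq_norm k h"
proof -
  have [measurable]: "h \<in> borel_measurable borel" using h by auto
  let ?F = "dunkl_transform_L1 k"
  have [measurable]: "?F h \<in> borel_measurable borel" by (rule dunkl_transform_L1_measurable[OF h])
  have main: "(\<integral>\<^sup>+l. ennreal ((cmod (?F h l))\<^sup>2 * exp (- s * l\<^sup>2)) \<partial>dunkl_measure k) \<le> sq_norm k h"
    if s: "s > 0" for s
  proof -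
    have G: "integrable (dunkl_measure k) (\<lambda>l. complex_of_real (exp (- s * l\<^sup>2)))"
      using gaussian_kernel[OF k s, of 0] k by (simp add: has_bochner_integral_iff)
    \<comment> \<open>The multiplication formula with this function turns \<open>\<integral>|F h|\<^sup>2 exp(-s l\<^sup>2)\<close> into a form in \<open>h\<close>.\<close>
    let ?\<phi> = "\<lambda>l. cnj (?F h l) * complex_of_real (exp (- s * l\<^sup>2))"
    have phi: "integrable (dunkl_measure k) ?\<phi>"
    proof (rule Bochner_Integration.integrable_bound)
      show "integrable (dunkl_measure k) (\<lambda>l. (\<integral>x. norm (h x) \<partial>dunkl_measure k) * complex_of_real (exp (- s * l\<^sup>2)))"
        using G by simp
      show "AE l in dunkl_measure k. norm (?\<phi> l) \<le> norm ((\<integral>x. norm (h x) \<partial>dunkl_measure k) * complex_of_real (exp (- s * l\<^sup>2)))"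
        using dunkl_transform_L1_bound[OF h] by (intro AE_I2) (simp add: norm_mult)
    qed measurable
    have Fphi: "?F ?\<phi> x = (\<integral>y. cnj (h y) * of_real (gauss_kernel s x y) \<partial>dunkl_measure k)" for x
    proof -
      let ?H = "\<lambda>(l, y). dunkl_kernel k (- \<i> * of_real (x * l)) * dunkl_kernel k (\<i> * of_real (l * y))"
      have int: "integrable (dunkl_measure k \<Otimes>\<^sub>M dunkl_measure k) (\<lambda>(l, y). complex_of_real (exp (- s * l\<^sup>2)) * cnj (h y) * ?H (l, y))"
        by (rule integrable_product_kernel[OF G])
           (use h in \<open>auto simp: norm_mult intro!: mult_le_one norm_dunkl_kernel_le_1[OF k]\<close>)
      have cn: "cnj (?F h l) = (\<integral>y. dunkl_kernel k (\<i> * of_real (l * y)) * cnj (h y) \<partial>dunkl_measure k)" for l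
        unfolding dunkl_transform_L1_def by (subst Bochner_Integration.integral_cnj[symmetric]) (simp add: cnj_dunkl_kernel[OF k])
      have "?F ?\<phi> x = (\<integral>l. (\<integral>y. complex_of_real (exp (- s * l\<^sup>2)) * cnj (h y) * ?H (l, y) \<partial>dunkl_measure k) \<partial>dunkl_measure k)"
      proof (subst dunkl_transform_L1_def, rule Bochner_Integration.integral_cong[OF refl])
        fix l
        have "dunkl_kernel k (- \<i> * of_real (x * l)) * ?\<phi> l = 
           (dunkl_kernel k (- \<i> * of_real (x * l)) * complex_of_real (exp (- s * l\<^sup>2))) * cnj (?F h l)" by (simp only: mult_ac)
        also have "\<dots> = (\<integral>y. (dunkl_kernel k (- \<i> * of_real (x * l)) * complex_of_real (exp (- s * l\<^sup>2))) *
            (dunkl_kernel k (\<i> * of_real (l * y)) * cnj (h y)) \<partial>dunkl_measure k)"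
          unfolding cn by (rule integral_mult_right_zero[symmetric])
        also have "\<dots> = (\<integral>y. complex_of_real (exp (- s * l\<^sup>2)) * cnj (h y) * ?H (l, y) \<partial>dunkl_measure k)"
          by (simp only: prod.case mult_ac)
        finally show "dunkl_kernel k (- \<i> * of_real (x * l)) * ?\<phi> l = (\<integral>y. complex_of_real (exp (- s * l\<^sup>2)) * cnj (h y) * ?H (l, y) \<partial>dunkl_measure k)" .
      qed
      also have "\<dots> = (\<integral>y. (\<integral>l. complex_of_real (exp (- s * l\<^sup>2)) * cnj (h y) * ?H (l, y) \<partial>dunkl_measure k) \<partial>dunkl_measure k)"
        by (rule dunkl2.Fubini_integral[symmetric]) (use int in simp)
      also have "\<dots> = (\<integral>y. cnj (h y) * of_real (gauss_kernel s x y) \<partial>dunkl_measure k)"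
      proof (rule Bochner_Integration.integral_cong[OF refl])
        fix y
        have "(\<integral>l. dunkl_kernel k (- \<i> * of_real x * of_real l) * dunkl_kernel k (\<i> * of_real y * of_real l) * of_real (exp (- s * l\<^sup>2)) \<partial>dunkl_measure k)
          = of_real (1 / (2 * s) powr (k + 1)) * exp (((- \<i> * of_real x)\<^sup>2 + (\<i> * of_real y)\<^sup>2) / of_real (4 * s)) *
            dunkl_kernel k ((- \<i> * of_real x) * (\<i> * of_real y) / of_real (2 * s))"
          by (rule has_bochner_integral_integral_eq[OF gaussian_kernel_kernel[OF k s]])
        also have "\<dots> = of_real (gauss_kernel s x y)"
        proof -
          have "(- \<i> * c) * (\<i> * d) = c * d" for c d
            by (rule complex_eqI) (simp_all add: algebra_simps)
          hence "(- \<i> * of_real x) * (\<i> * of_real y) / of_real (2 * s) = complex_of_real (x * y / (2 * s))"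
            by (simp only: of_real_mult of_real_divide)
          moreover have "((- \<i> * of_real x)\<^sup>2 + (\<i> * of_real y)\<^sup>2) / of_real (4 * s) = complex_of_real (- (x\<^sup>2 + y\<^sup>2) / (4 * s))"
            by (simp add: power_mult_distrib)
          ultimately show ?thesis unfolding gauss_kernel_eq[OF s] by (simp only: exp_of_real)
        qed
        finally have gk: "(\<integral>l. dunkl_kernel k (- \<i> * of_real x * of_real l) * dunkl_kernel k (\<i> * of_real y * of_real l) * of_real (exp (- s * l\<^sup>2)) \<partial>dunkl_measure k)
          = of_real (gauss_kernel s x y)" .
        have "(\<integral>l. complex_of_real (exp (- s * l\<^sup>2)) * cnj (h y) * ?H (l, y) \<partial>dunkl_measure k) =
          (\<integral>l. cnj (h y) * (dunkl_kernel k (- \<i> * of_real x * of_real l) * dunkl_kernel k (\<i> * of_real y * of_real l) * of_real (exp (- s * l\<^sup>2))) \<partial>dunkl_measure k)"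
          by (rule Bochner_Integration.integral_cong[OF refl]) (simp only: prod.case of_real_mult mult_ac)
        also have "\<dots> = cnj (h y) * of_real (gauss_kernel s x y)"
          unfolding integral_mult_right_zero gk ..
        finally show "(\<integral>l. complex_of_real (exp (- s * l\<^sup>2)) * cnj (h y) * ?H (l, y) \<partial>dunkl_measure k) = cnj (h y) * of_real (gauss_kernel s x y)" .
      qed
      finally show ?thesis .
    qed
    have F2: "?F h l * ?\<phi> l = complex_of_real ((cmod (?F h l))\<^sup>2 * exp (- s * l\<^sup>2))" for l
      unfolding of_real_mult complex_norm_square by (simp only: mult_ac)
    have I: "integrable (dunkl_measure k) (\<lambda>l. (cmod (?F h l))\<^sup>2 * exp (- s * l\<^sup>2))"
    proof -
      have "integrable (dunkl_measure k) (\<lambda>l. ?F h l * ?\<phi> l)"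
      proof (rule Bochner_Integration.integrable_bound)
        show "integrable (dunkl_measure k) (\<lambda>l. (\<integral>x. norm (h x) \<partial>dunkl_measure k) *\<^sub>R ?\<phi> l)"
          using phi by simp
        show "AE l in dunkl_measure k. norm (?F h l * ?\<phi> l) \<le> norm ((\<integral>x. norm (h x) \<partial>dunkl_measure k) *\<^sub>R ?\<phi> l)"
          using dunkl_transform_L1_bound[OF h] by (intro AE_I2) (auto simp: norm_mult intro!: mult_mono)
      qed measurable
      thus ?thesis unfolding F2 by (auto dest: integrable_Re)
    qed
    let ?K = "\<lambda>x y. ennreal (gauss_kernel s x y)"
    let ?n = "\<lambda>x. ennreal ((cmod (h x))\<^sup>2)"
    have "(\<integral>\<^sup>+l. ennreal ((cmod (?F h l))\<^sup>2 * exp (- s * l\<^sup>2)) \<partial>dunkl_measure k) =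
        ennreal (\<integral>l. (cmod (?F h l))\<^sup>2 * exp (- s * l\<^sup>2) \<partial>dunkl_measure k)"
      by (rule nn_integral_eq_integral[OF I]) auto
    also have "(\<integral>l. (cmod (?F h l))\<^sup>2 * exp (- s * l\<^sup>2) \<partial>dunkl_measure k) = norm (\<integral>l. ?F h l * ?\<phi> l \<partial>dunkl_measure k)"
    proof -
      have "(\<integral>l. (cmod (?F h l))\<^sup>2 * exp (- s * l\<^sup>2) \<partial>dunkl_measure k) \<ge> 0" by simp
      thus ?thesis unfolding F2 integral_complex_of_real by simp
    qed
    also have "(\<integral>l. ?F h l * ?\<phi> l \<partial>dunkl_measure k) = (\<integral>x. h x * ?F ?\<phi> x \<partial>dunkl_measure k)"
      by (rule dunkl_multiplication_formula[OF h phi])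
    also have "ennreal (norm \<dots>) \<le> (\<integral>\<^sup>+x. ennreal (norm (h x * ?F ?\<phi> x)) \<partial>dunkl_measure k)"
    proof (rule integral_norm_bound_ennreal, rule Bochner_Integration.integrable_bound)
      show "integrable (dunkl_measure k) (\<lambda>x. h x * of_real (\<integral>x. norm (?\<phi> x) \<partial>dunkl_measure k))" using h by simp
      show "AE x in dunkl_measure k. norm (h x * ?F ?\<phi> x) \<le> norm (h x * of_real (\<integral>x. norm (?\<phi> x) \<partial>dunkl_measure k))"
        using dunkl_transform_L1_bound[OF phi] unfolding norm_mult by (intro AE_I2 mult_left_mono) auto
      show "(\<lambda>x. h x * ?F ?\<phi> x) \<in> borel_measurable (dunkl_measure k)"
        using dunkl_transform_L1_measurable[OF phi] by measurable
    qed
    also have "\<dots> \<le> (\<integral>\<^sup>+x. (\<integral>\<^sup>+y. ennreal (1/2) * (?n x * ?K x y) + ennreal (1/2) * (?n y * ?K x y) \<partial>dunkl_measure k) \<partial>dunkl_measure k)"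
    proof (rule nn_integral_mono)
      fix x
      have "ennreal (norm (h x * ?F ?\<phi> x)) = ennreal (norm (h x)) * ennreal (norm (?F ?\<phi> x))"
        by (simp add: norm_mult ennreal_mult)
      also have "ennreal (norm (?F ?\<phi> x)) \<le> (\<integral>\<^sup>+y. ennreal (norm (cnj (h y) * of_real (gauss_kernel s x y))) \<partial>dunkl_measure k)"
        unfolding Fphi
        by (cases "integrable (dunkl_measure k) (\<lambda>y. cnj (h y) * of_real (gauss_kernel s x y))")
           (auto intro!: integral_norm_bound_ennreal simp: not_integrable_integral_eq)
      also have "ennreal (norm (h x)) * \<dots> = (\<integral>\<^sup>+y. ennreal (norm (h x)) * ennreal (norm (cnj (h y) * of_real (gauss_kernel s x y))) \<partial>dunkl_measure k)"
        by (rule nn_integral_cmult[symmetric]) measurable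
      also have "\<dots> \<le> (\<integral>\<^sup>+y. ennreal (1/2) * (?n x * ?K x y) + ennreal (1/2) * (?n y * ?K x y) \<partial>dunkl_measure k)"
      proof (rule nn_integral_mono)
        fix y
        have "2 * (norm (h x) * norm (h y)) \<le> (cmod (h x))\<^sup>2 + (cmod (h y))\<^sup>2"
          using sum_squares_bound[of "cmod (h x)" "cmod (h y)"] by simp
        from mult_right_mono[OF this gauss_kernel_nonneg[of s x y]]
        have "norm (h x) * (norm (h y) * gauss_kernel s x y) \<le> 1/2 * ((cmod (h x))\<^sup>2 * gauss_kernel s x y) + 1/2 * ((cmod (h y))\<^sup>2 * gauss_kernel s x y)"
          by (simp add: algebra_simps)
        hence "ennreal (norm (h x) * (norm (h y) * gauss_kernel s x y)) \<le> ennreal (1/2 * ((cmod (h x))\<^sup>2 * gauss_kernel s x y) + 1/2 * ((cmod (h y))\<^sup>2 * gauss_kernel s x y))"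
          by (rule ennreal_leI)
        moreover have "ennreal (1/2 * (A * K) + 1/2 * (B * K)) = ennreal (1/2) * (ennreal A * ennreal K) + ennreal (1/2) * (ennreal B * ennreal K)"
          if "A \<ge> 0" "B \<ge> 0" "K \<ge> 0" for A B K
        proof -
          have "ennreal (1/2 * (A * K) + 1/2 * (B * K)) = ennreal (1/2 * (A * K)) + ennreal (1/2 * (B * K))"
            using that by (intro ennreal_plus) auto
          also have "ennreal (1/2 * (A * K)) = ennreal (1/2) * (ennreal A * ennreal K)"
            using that by (subst ennreal_mult, simp, simp, subst ennreal_mult) auto
          also have "ennreal (1/2 * (B * K)) = ennreal (1/2) * (ennreal B * ennreal K)"
            using that by (subst ennreal_mult, simp, simp, subst ennreal_mult) auto
          finally show ?thesis .
        qed
        moreover have "ennreal (norm (h x)) * ennreal (norm (cnj (h y) * of_real (gauss_kernel s x y))) = ennreal (norm (h x) * (norm (h y) * gauss_kernel s x y))"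
          using gauss_kernel_nonneg[of s x y] by (subst ennreal_mult[symmetric]) (auto simp: norm_mult)
        ultimately show "ennreal (norm (h x)) * ennreal (norm (cnj (h y) * of_real (gauss_kernel s x y))) \<le> ennreal (1/2) * (?n x * ?K x y) + ennreal (1/2) * (?n y * ?K x y)"
          using gauss_kernel_nonneg[of s x y] by simp
      qed
      finally show "ennreal (norm (h x * ?F ?\<phi> x)) \<le> (\<integral>\<^sup>+y. ennreal (1/2) * (?n x * ?K x y) + ennreal (1/2) * (?n y * ?K x y) \<partial>dunkl_measure k)"
        by (simp add: mult_left_mono)
    qed
    also have "\<dots> = ennreal (1/2) * (\<integral>\<^sup>+x. (\<integral>\<^sup>+y. ?n x * ?K x y \<partial>dunkl_measure k) \<partial>dunkl_measure k) + ennreal (1/2) * (\<integral>\<^sup>+x. (\<integral>\<^sup>+y. ?n y * ?K x y \<partial>dunkl_measure k) \<partial>dunkl_measure k)"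
      by (simp add: nn_integral_add nn_integral_cmult)
    also have "(\<integral>\<^sup>+x. (\<integral>\<^sup>+y. ?n y * ?K x y \<partial>dunkl_measure k) \<partial>dunkl_measure k) = (\<integral>\<^sup>+y. (\<integral>\<^sup>+x. ?n y * ?K x y \<partial>dunkl_measure k) \<partial>dunkl_measure k)"
      by (rule dunkl2.Fubini') measurable
    also have "\<dots> = sq_norm k h"
    proof -
      have "(\<integral>\<^sup>+x. ?K x y \<partial>dunkl_measure k) = (\<integral>\<^sup>+x. ?K y x \<partial>dunkl_measure k)" for y
        by (intro nn_integral_cong arg_cong[of _ _ ennreal] gauss_kernel_commute)
      thus ?thesis unfolding sq_norm_def using gauss_kernel_integral[OF s] by (simp add: nn_integral_cmult)
    qed
    also have "(\<integral>\<^sup>+x. (\<integral>\<^sup>+y. ?n x * ?K x y \<partial>dunkl_measure k) \<partial>dunkl_measure k) = sq_norm k h"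
      unfolding sq_norm_def using gauss_kernel_integral[OF s] by (simp add: nn_integral_cmult)
    also have "ennreal (1/2) * sq_norm k h + ennreal (1/2) * sq_norm k h = sq_norm k h"
    proof -
      have "ennreal (1/2) + ennreal (1/2) = 1" by (subst ennreal_plus[symmetric]) auto
      thus ?thesis unfolding distrib_right[symmetric] by (simp only: mult_1_left)
    qed
    finally show ?thesis .
  qed
  have "sq_norm k (?F h) = (\<integral>\<^sup>+l. liminf (\<lambda>n. ennreal ((cmod (?F h l))\<^sup>2 * exp (- (1 / real (Suc n)) * l\<^sup>2))) \<partial>dunkl_measure k)"
    unfolding sq_norm_def
  proof (rule nn_integral_cong)
    fix l
    have "(\<lambda>n. (cmod (?F h l))\<^sup>2 * exp (- (1 / real (Suc n)) * l\<^sup>2)) \<longlonglongrightarrow> (cmod (?F h l))\<^sup>2 * exp (- 0 * l\<^sup>2)"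
      by (intro tendsto_intros LIMSEQ_Suc[OF lim_inverse_n'])
    hence "(\<lambda>n. ennreal ((cmod (?F h l))\<^sup>2 * exp (- (1 / real (Suc n)) * l\<^sup>2))) \<longlonglongrightarrow> ennreal ((cmod (?F h l))\<^sup>2)"
      by (intro tendsto_ennrealI) (simp only: mult_zero_left exp_zero mult_1_right minus_zero)
    thus "ennreal ((cmod (?F h l))\<^sup>2) = liminf (\<lambda>n. ennreal ((cmod (?F h l))\<^sup>2 * exp (- (1 / real (Suc n)) * l\<^sup>2)))"
      by (rule lim_imp_Liminf[OF sequentially_bot, symmetric])
  qed
  also have "\<dots> \<le> liminf (\<lambda>n. \<integral>\<^sup>+l. ennreal ((cmod (?F h l))\<^sup>2 * exp (- (1 / real (Suc n)) * l\<^sup>2)) \<partial>dunkl_measure k)"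
    by (rule nn_integral_liminf) measurable
  also have "\<dots> \<le> liminf (\<lambda>n::nat. sq_norm k h)"
    by (rule Liminf_mono, rule always_eventually, rule allI, rule main) simp
  also have "\<dots> = sq_norm k h" by (simp add: Liminf_const)
  finally show ?thesis .
qed

end

section \<open>Uniqueness from moments\<close>

lemma integrable_bounded_comp:
  fixes G :: "'a \<Rightarrow> complex" and Z :: "'a \<Rightarrow> real"
  assumes G: "integrable M G" and [measurable]: "Z \<in> borel_measurable M" "\<psi> \<in> borel_measurable borel"
    and b: "\<And>x. \<bar>\<psi> (Z x)\<bar> \<le> (C::real)"
  shows "integrable M (\<lambda>x. G x * of_real (\<psi> (Z x)))"
proof (rule Bochner_Integration.integrable_bound)
  have [measurable]: "G \<in> borel_measurable M" using G by auto
  show "integrable M (\<lambda>x. C * norm (G x))" using G by simp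
  have "norm (G x * of_real (\<psi> (Z x))) \<le> C * norm (G x)" for x
    using mult_right_mono[OF b norm_ge_zero] by (simp add: norm_mult mult.commute)
  thus "AE x in M. norm (G x * of_real (\<psi> (Z x))) \<le> norm (C * norm (G x))"
    by (intro AE_I2) (metis abs_ge_self order_trans real_norm_def)
  show "(\<lambda>x. G x * of_real (\<psi> (Z x))) \<in> borel_measurable M" by measurable
qed

lemma integral_sum_comp:
  fixes G :: "'a \<Rightarrow> complex" and Z :: "'a \<Rightarrow> real"
  assumes G: "integrable M G" and Z: "Z \<in> borel_measurable M"
    and q: "\<And>i. i \<in> I \<Longrightarrow> q i \<in> borel_measurable borel" "\<And>i x. i \<in> I \<Longrightarrow> \<bar>q i (Z x)\<bar> \<le> (1::real)"
  shows "(\<integral>x. G x * of_real (\<Sum>i\<in>I. c i * q i (Z x)) \<partial>M) = (\<Sum>i\<in>I. of_real (c i) * (\<integral>x. G x * of_real (q i (Z x)) \<partial>M))"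
proof -
  have "(\<integral>x. G x * of_real (\<Sum>i\<in>I. c i * q i (Z x)) \<partial>M) = (\<integral>x. (\<Sum>i\<in>I. of_real (c i) * (G x * of_real (q i (Z x)))) \<partial>M)"
    by (rule Bochner_Integration.integral_cong) (auto simp: sum_distrib_left mult_ac)
  also have "\<dots> = (\<Sum>i\<in>I. \<integral>x. of_real (c i) * (G x * of_real (q i (Z x))) \<partial>M)"
    by (rule Bochner_Integration.integral_sum) (intro integrable_mult_right integrable_bounded_comp[OF G Z, where C = 1] q)
  finally show ?thesis by (simp only: integral_mult_right_zero)
qed

lemma bounded_limit_integral:
  fixes G :: "'a \<Rightarrow> complex" and Z :: "'a \<Rightarrow> real"
  assumes G: "integrable M G" and [measurable]: "Z \<in> borel_measurable M"
    and [measurable]: "\<And>n. q n \<in> borel_measurable borel" "\<psi> \<in> borel_measurable borel"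
    and b: "\<And>n x. \<bar>q n (Z x)\<bar> \<le> (C::real)" and l: "\<And>x. (\<lambda>n. q n (Z x)) \<longlonglongrightarrow> \<psi> (Z x)"
  shows "(\<lambda>n. \<integral>x. G x * of_real (q n (Z x)) \<partial>M) \<longlonglongrightarrow> (\<integral>x. G x * of_real (\<psi> (Z x)) \<partial>M)"
proof (rule integral_dominated_convergence)
  have [measurable]: "G \<in> borel_measurable M" using G by auto
  show "(\<lambda>x. G x * of_real (\<psi> (Z x))) \<in> borel_measurable M" "\<And>n. (\<lambda>x. G x * of_real (q n (Z x))) \<in> borel_measurable M" by measurable
  show "integrable M (\<lambda>x. C * norm (G x))" using G by simp
  show "AE x in M. (\<lambda>n. G x * of_real (q n (Z x))) \<longlonglongrightarrow> G x * of_real (\<psi> (Z x))"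
    using l by (intro AE_I2 tendsto_intros) auto
  show "AE x in M. norm (G x * of_real (q n (Z x))) \<le> C * norm (G x)" for n
    using mult_right_mono[OF b norm_ge_zero] by (intro AE_I2) (simp add: norm_mult mult.commute)
qed

text \<open>
  Polynomials are uniformly dense in the continuous functions on \<open>[0,1]\<close>.
\<close>
lemma moment_uniqueness_continuous:
  fixes G :: "'a \<Rightarrow> complex" and Z :: "'a \<Rightarrow> real" and \<psi> :: "real \<Rightarrow> real"
  assumes G: "integrable M G" "integrable M' G'"
    and Z: "Z \<in> borel_measurable M" "Z' \<in> borel_measurable M'"
    and Z01: "\<And>x. Z x \<in> {0..1}" "\<And>x. Z' x \<in> {0..1}"
    and mom: "\<And>n. (\<integral>x. G x * of_real (Z x ^ n) \<partial>M) = (\<integral>x. G' x * of_real (Z' x ^ n) \<partial>M')"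
    and \<psi>: "continuous_on {0..1} \<psi>" "\<psi> \<in> borel_measurable borel"
  shows "(\<integral>x. G x * of_real (\<psi> (Z x)) \<partial>M) = (\<integral>x. G' x * of_real (\<psi> (Z' x)) \<partial>M')"
proof -
  have "\<exists>p. real_polynomial_function p \<and> (\<forall>x\<in>{0..1}. \<bar>\<psi> x - p x\<bar> < 1 / real (Suc n))" for n
    by (rule Stone_Weierstrass_real_polynomial_function[OF compact_Icc \<psi>(1), of "1 / real (Suc n)"]) auto
  then obtain p where p: "\<And>n. real_polynomial_function (p n)"
    "\<And>n x. x \<in> {0..1} \<Longrightarrow> \<bar>\<psi> x - p n x\<bar> < 1 / real (Suc n)" by metis
  have pm: "p n \<in> borel_measurable borel" for n
    using p(1)[of n] by (intro borel_measurable_continuous_onI) (simp add: continuous_real_polymonial_function continuous_at_imp_continuous_on)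
  obtain C where C: "\<And>x. x \<in> {0..1} \<Longrightarrow> \<bar>\<psi> x\<bar> \<le> C"
    using compact_imp_bounded[OF compact_continuous_image[OF \<psi>(1) compact_Icc]] unfolding bounded_iff by force
  have pb: "\<bar>p n x\<bar> \<le> C + 1" if "x \<in> {0..1}" for n x
  proof -
    have "1 / real (Suc n) \<le> 1" by simp
    thus ?thesis using p(2)[OF that, of n] C[OF that] by linarith
  qed
  have pl: "(\<lambda>n. p n x) \<longlonglongrightarrow> \<psi> x" if "x \<in> {0..1}" for x
  proof (rule LIM_zero_cancel, rule tendsto_rabs_zero_cancel, rule tendsto_sandwich[of "\<lambda>_. 0"])
    show "(\<lambda>n. 1 / real (Suc n)) \<longlonglongrightarrow> 0" by (rule LIMSEQ_Suc[OF lim_inverse_n'])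
    show "\<forall>\<^sub>F n in sequentially. \<bar>p n x - \<psi> x\<bar> \<le> 1 / real (Suc n)"
      using p(2)[OF that] by (intro always_eventually allI) (simp add: abs_minus_commute less_imp_le)
  qed auto
  have "(\<integral>x. G x * of_real (p n (Z x)) \<partial>M) = (\<integral>x. G' x * of_real (p n (Z' x)) \<partial>M')" for n
  proof -
    obtain a N where a: "p n = (\<lambda>x. \<Sum>i\<le>N. a i * x ^ i)"
      using p(1)[of n] by (auto simp: real_polynomial_function_iff_sum)
    have z: "\<bar>x ^ i\<bar> \<le> 1" if "x \<in> {0..1}" for x :: real and i
      using that by (auto simp: power_abs intro!: power_le_one)
    show ?thesis unfolding a
      using integral_sum_comp[OF G(1) Z(1), where I = "{..N}" and q = "\<lambda>i x. x ^ i" and c = a] integral_sum_comp[OF G(2) Z(2), where I = "{..N}" and q = "\<lambda>i x. x ^ i" and c = a]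
        z[OF Z01(1)] z[OF Z01(2)] mom by simp
  qed
  moreover note bounded_limit_integral[OF G(1) Z(1) pm \<psi>(2) pb[OF Z01(1)] pl[OF Z01(1)]]
    bounded_limit_integral[OF G(2) Z(2) pm \<psi>(2) pb[OF Z01(2)] pl[OF Z01(2)]]
  ultimately show ?thesis using LIMSEQ_unique by fastforce
qed

text \<open>
  Two complex measures (of densities \<open>G\<close> and \<open>G'\<close>) whose images under maps into \<open>[0,1]\<close> have the same
  moments have the same images. The equality passes from continuous functions to half-lines by bounded
  limits, to Borel sets by Dynkin's theorem and to bounded Borel functions by simple functions. With
  \<open>Z = exp(-X)\<close> this is the uniqueness theorem for Laplace transforms.
\<close>
lemma moment_uniqueness:
  fixes G :: "'a \<Rightarrow> complex" and Z :: "'a \<Rightarrow> real" and \<psi> :: "real \<Rightarrow> real"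
  assumes G: "integrable M G" "integrable M' G'"
    and Z: "Z \<in> borel_measurable M" "Z' \<in> borel_measurable M'"
    and Z01: "\<And>x. Z x \<in> {0..1}" "\<And>x. Z' x \<in> {0..1}"
    and mom: "\<And>n. (\<integral>x. G x * of_real (Z x ^ n) \<partial>M) = (\<integral>x. G' x * of_real (Z' x ^ n) \<partial>M')"
    and \<psi>: "\<psi> \<in> borel_measurable borel" "\<And>z. \<bar>\<psi> z\<bar> \<le> C"
  shows "(\<integral>x. G x * of_real (\<psi> (Z x)) \<partial>M) = (\<integral>x. G' x * of_real (\<psi> (Z' x)) \<partial>M')"
proof -
  define good where "good \<psi> \<longleftrightarrow> (\<integral>x. G x * of_real (\<psi> (Z x)) \<partial>M) = (\<integral>x. G' x * of_real (\<psi> (Z' x)) \<partial>M')" for \<psi>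
  have cont: "good \<psi>" if "continuous_on {0..1} \<psi>" "\<psi> \<in> borel_measurable borel" for \<psi>
    unfolding good_def by (rule moment_uniqueness_continuous[OF G Z Z01 mom that])
  have lim: "good \<psi>" if "\<And>n. good (q n)" "\<And>n. q n \<in> borel_measurable borel" "\<psi> \<in> borel_measurable borel"
      "\<And>n z. \<bar>q n z\<bar> \<le> C" "\<And>z. (\<lambda>n. q n z) \<longlonglongrightarrow> \<psi> z" for q \<psi> C
    using bounded_limit_integral[OF G(1) Z(1) that(2-5)] bounded_limit_integral[OF G(2) Z(2) that(2-5)] that(1)
    unfolding good_def using LIMSEQ_unique by fastforce
  have lin: "good (\<lambda>z. \<Sum>i\<in>I. c i * q i z)" if "\<And>i. i \<in> I \<Longrightarrow> good (q i)" 
     "\<And>i. i \<in> I \<Longrightarrow> q i \<in> borel_measurable borel" "\<And>i z. i \<in> I \<Longrightarrow> \<bar>q i z\<bar> \<le> (1::real)" for I :: "'x set" and c q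
    using integral_sum_comp[OF G(1) Z(1) that(2,3), where c = c] integral_sum_comp[OF G(2) Z(2) that(2,3), where c = c] that(1)
    unfolding good_def by simp
  have sets: "good (indicator A)" if "A \<in> sets borel" for A :: "real set"
  proof -
    have st: "Int_stable (range (\<lambda>a::real. {..a}))" by (auto simp: Int_stable_def)
    have sub: "range (\<lambda>a::real. {..a}) \<subseteq> Pow UNIV" by auto
    have "A \<in> sigma_sets UNIV (range (\<lambda>a::real. {..a}))"
      using that by (simp add: borel_eq_atMost)
    with st sub show ?thesis
    proof (induction rule: sigma_sets_induct_disjoint)
      case (basic A)
      then obtain a where A: "A = {..a}" by auto
      show ?case
      proof (rule lim)
        \<comment> \<open>Continuous ramps that decrease to the indicator of the half-line.\<close>
        let ?q = "\<lambda>n z. max 0 (min 1 (1 - real n * (z - a)))"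
        have c: "continuous_on S (?q n)" for S n by (intro continuous_intros)
        show "?q n \<in> borel_measurable borel" for n by measurable
        show "good (?q n)" for n by (rule cont[OF c]) measurable
        show "indicator A \<in> borel_measurable borel" by (simp add: A)
        show "\<bar>?q n z\<bar> \<le> 1" for n z by auto
        show "(\<lambda>n. ?q n z) \<longlonglongrightarrow> indicator A z" for z
        proof (cases "z \<le> a")
          case True
          hence "real n * (z - a) \<le> 0" for n by (intro mult_nonneg_nonpos) auto
          hence "1 - real n * (z - a) \<ge> 1" for n by (simp add: algebra_simps)
          hence "(\<lambda>n. ?q n z) = (\<lambda>n. 1)" by (intro ext) (simp add: min_def max_def)
          thus ?thesis using True by (simp add: A)
        next
          case False
          obtain N where N: "1 / (z - a) < real N" using reals_Archimedean2 by blast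
          have "?q n z = 0" if "n \<ge> N" for n
          proof -
            have "1 / (z - a) \<le> real n" using N that by linarith
            hence "1 \<le> real n * (z - a)" using False by (simp add: field_simps)
            thus ?thesis by simp
          qed
          hence "eventually (\<lambda>n. ?q n z = 0) sequentially" by (auto simp: eventually_sequentially)
          thus ?thesis using False by (simp add: A tendsto_eventually)
        qed
      qed
    next
      case empty
      thus ?case using mom[of 0] by (simp add: good_def)
    next
      case (compl A)
      have [measurable]: "A \<in> sets borel" using compl(1) by (simp add: borel_eq_atMost)
      have "good (\<lambda>z. \<Sum>i\<in>{True, False}. (if i then 1 else -1) * (if i then (1::real) else indicator A z))"
      proof (rule lin)
        show "good (\<lambda>z. if i then 1 else indicator A z)" for i
          using compl.IH mom[of 0] by (cases i) (auto simp: good_def)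
      qed auto
      also have "(\<lambda>z. \<Sum>i\<in>{True, False}. (if i then 1 else -1) * (if i then (1::real) else indicator A z)) = indicator (UNIV - A)"
        by (auto simp: indicator_def)
      finally show ?case .
    next
      case (union A)
      have [measurable]: "\<And>i. A i \<in> sets borel" using union(2) by (auto simp: borel_eq_atMost)
      show ?case
      proof (rule lim)
        show "good (\<lambda>z. \<Sum>i<n. 1 * indicator (A i) z)" for n
          by (rule lin) (use union.IH in auto)
        show "\<bar>\<Sum>i<n. 1 * indicator (A i) z\<bar> \<le> (1::real)" for n z
        proof -
          have d: "disjoint_family_on A {..<n}" using union(1) by (auto simp: disjoint_family_on_def)
          show ?thesis by (simp flip: indicator_UN_disjoint[OF _ d])
        qed
        show "(\<lambda>n. \<Sum>i<n. 1 * indicator (A i) z) \<longlonglongrightarrow> (indicator (\<Union>i. A i) z :: real)" for z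
          using indicator_sums[of A z] union(1) by (auto simp: sums_def disjoint_family_on_def)
      qed measurable
    qed
  qed
  obtain s where s: "\<And>i. simple_function borel (s i)" "\<And>z. (\<lambda>i. s i z) \<longlonglongrightarrow> \<psi> z" "\<And>i z. norm (s i z) \<le> 2 * norm (\<psi> z)"
    using borel_measurable_implies_sequence_metric[OF \<psi>(1), of 0] by auto
  have "good \<psi>"
  proof (rule lim[OF _ _ \<psi>(1) _ s(2)])
    show "s i \<in> borel_measurable borel" for i using s(1) by (rule borel_measurable_simple_function)
    show "\<bar>s i z\<bar> \<le> 2 * C" for i z using s(3)[of i z] \<psi>(2)[of z] by simp
    show "good (s i)" for i
    proof -
      have fin: "finite (range (s i))" using s(1)[of i] by (simp add: simple_function_def)
      have "good (\<lambda>z. \<Sum>v\<in>range (s i). v * indicator (s i -` {v}) z)"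
      proof (rule lin)
        show "good (indicator (s i -` {v}))" for v
          using s(1)[of i] by (intro sets) (metis simple_functionD(2) inf_top_right space_borel)
        show "indicator (s i -` {v}) \<in> borel_measurable borel" for v
          using s(1)[of i] by (intro borel_measurable_indicator) (metis simple_functionD(2) inf_top_right space_borel)
      qed auto
      also have "(\<lambda>z. \<Sum>v\<in>range (s i). v * indicator (s i -` {v}) z) = s i"
      proof
        fix z
        have "(\<Sum>v\<in>range (s i). v * indicator (s i -` {v}) z) = (\<Sum>v\<in>range (s i). if v = s i z then v else 0)"
          by (rule sum.cong) (auto simp: indicator_def)
        thus "(\<Sum>v\<in>range (s i). v * indicator (s i -` {v}) z) = s i z" using fin by simp
      qed
      finally show ?thesis .
    qed
  qed
  thus ?thesis by (simp add: good_def)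
qed

section \<open>The extension of the transform to square integrable functions\<close>

text \<open>
  The condition under the choice operator in the definition of the extended transform.
\<close>
definition is_dunkl_transform :: "real \<Rightarrow> (real \<Rightarrow> complex) \<Rightarrow> (real \<Rightarrow> complex) \<Rightarrow> bool" where
  "is_dunkl_transform k f g \<longleftrightarrow> g \<in> dunkl_L2 k \<and>
        (\<exists>h. (\<forall>n::nat. h n \<in> dunkl_L2 k \<and> integrable (dunkl_measure k) (h n)) \<and>
             (\<lambda>n. sq_norm k (\<lambda>x. h n x - f x)) \<longlonglongrightarrow> 0 \<and>
             (\<lambda>n. sq_norm k (\<lambda>l. dunkl_transform_L1 k (h n) l - g l)) \<longlonglongrightarrow> 0)"

lemma dunkl_transform_L2_eq: "dunkl_transform_L2 k f = (SOME g. is_dunkl_transform k f g)"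
  unfolding dunkl_transform_L2_def is_dunkl_transform_def sq_norm_def ..

context
  fixes k :: real
  assumes k: "k > - 1 / 2"
begin

lemma dunkl_L2_truncate:
  assumes f: "f \<in> dunkl_L2 k"
  defines "h \<equiv> \<lambda>m::nat. \<lambda>x. indicator {- real m..real m} x *\<^sub>R f x"
  shows "h m \<in> dunkl_L2 k" "integrable (dunkl_measure k) (h m)"
    and "(\<lambda>m. sq_norm k (\<lambda>x. h m x - f x)) \<longlonglongrightarrow> 0"
proof -
  have [measurable]: "f \<in> borel_measurable borel" using f by (auto simp: dunkl_L2_iff)
  have I: "integrable (dunkl_measure k) (\<lambda>x. (cmod (f x))\<^sup>2)" using f by (auto simp: dunkl_L2_def)
  have [measurable]: "h m \<in> borel_measurable borel" for m unfolding h_def by measurable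
  have "integrable (dunkl_measure k) (\<lambda>x. (cmod (h m x))\<^sup>2)" for m
    by (rule Bochner_Integration.integrable_bound[OF I]) (auto simp: h_def indicator_def)
  thus "h m \<in> dunkl_L2 k" for m by (simp add: dunkl_L2_def)
  have gau: "integrable (dunkl_measure k) (\<lambda>x. exp ((real m)\<^sup>2) * exp (0 * \<bar>x\<bar> - 1 * x\<^sup>2))" for m
    using integrable_exp_gaussian[OF k, of 1 0] by simp
  show "integrable (dunkl_measure k) (h m)" for m
  proof (rule Bochner_Integration.integrable_bound[OF Bochner_Integration.integrable_add[OF gau[of m] I]])
    show "AE x in dunkl_measure k. norm (h m x) \<le> norm (exp ((real m)\<^sup>2) * exp (0 * \<bar>x\<bar> - 1 * x\<^sup>2) + (cmod (f x))\<^sup>2)"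
    proof (rule AE_I2)
      fix x
      show "norm (h m x) \<le> norm (exp ((real m)\<^sup>2) * exp (0 * \<bar>x\<bar> - 1 * x\<^sup>2) + (cmod (f x))\<^sup>2)"
      proof (cases "\<bar>x\<bar> \<le> real m")
        case True
        have "x\<^sup>2 \<le> (real m)\<^sup>2" using power_mono[OF True abs_ge_zero, of 2] by simp
        hence "1 \<le> exp ((real m)\<^sup>2) * exp (0 * \<bar>x\<bar> - 1 * x\<^sup>2)" by (simp flip: exp_add)
        moreover have "cmod (f x) \<le> 1 + (cmod (f x))\<^sup>2"
          using sum_squares_bound[of "cmod (f x)" 1] by simp (smt (verit) norm_ge_zero)
        moreover have "norm (h m x) \<le> cmod (f x)" by (simp add: h_def indicator_def)
        ultimately show ?thesis by simp
      qed (auto simp: h_def indicator_def)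
    qed
  qed measurable
  have "(\<lambda>m. \<integral>\<^sup>+x. ennreal ((cmod (h m x - f x))\<^sup>2) \<partial>dunkl_measure k) \<longlonglongrightarrow> (\<integral>\<^sup>+x. 0 \<partial>dunkl_measure k)"
  proof (rule nn_integral_dominated_convergence)
    show "(\<integral>\<^sup>+x. ennreal ((cmod (f x))\<^sup>2) \<partial>dunkl_measure k) < \<infinity>"
      using sq_norm_finite[OF f] by (simp add: sq_norm_def)
    show "AE x in dunkl_measure k. ennreal ((cmod (h m x - f x))\<^sup>2) \<le> ennreal ((cmod (f x))\<^sup>2)" for m
      by (intro AE_I2) (auto simp: h_def indicator_def)
    show "AE x in dunkl_measure k. (\<lambda>m. ennreal ((cmod (h m x - f x))\<^sup>2)) \<longlonglongrightarrow> 0"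
    proof (intro AE_I2 tendsto_eventually)
      fix x
      obtain N where N: "\<bar>x\<bar> \<le> real N" using real_arch_simple by blast
      have "ennreal ((cmod (h m x - f x))\<^sup>2) = 0" if "m \<ge> N" for m
        using N that by (auto simp: h_def indicator_def)
      thus "\<forall>\<^sub>F m in sequentially. ennreal ((cmod (h m x - f x))\<^sup>2) = 0"
        by (auto simp: eventually_sequentially)
    qed
  qed measurable
  thus "(\<lambda>m. sq_norm k (\<lambda>x. h m x - f x)) \<longlonglongrightarrow> 0" by (simp add: sq_norm_def)
qed

text \<open>
  The weighted sum of \<open>2^n |F(n+1) - F(n)|\<^sup>2\<close> has finite integral, so almost everywhere the increments
  are dominated by a geometric series.
\<close>
lemma AE_convergent_of_sq_norm:
  assumes m[measurable]: "\<And>n. F n \<in> borel_measurable borel"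
    and b: "\<And>n. sq_norm k (\<lambda>x. F (Suc n) x - F n x) \<le> ennreal (4 * (1/8) ^ n)"
  shows "AE x in dunkl_measure k. convergent (\<lambda>n. F n x)"
proof -
  let ?u = "\<lambda>n x. F (Suc n) x - F n x"
  have "(\<integral>\<^sup>+x. (\<Sum>n. ennreal (2 ^ n) * ennreal ((cmod (?u n x))\<^sup>2)) \<partial>dunkl_measure k) = (\<Sum>n. ennreal (2 ^ n) * sq_norm k (?u n))"
    unfolding sq_norm_def by (subst nn_integral_suminf) (auto simp: nn_integral_cmult)
  also have "\<dots> \<le> (\<Sum>n. ennreal (4 * (1/4) ^ n))"
  proof (rule suminf_le)
    fix n
    have "ennreal (2 ^ n) * sq_norm k (?u n) \<le> ennreal (2 ^ n) * ennreal (4 * (1/8) ^ n)"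
      using b by (rule mult_left_mono) simp
    also have "\<dots> = ennreal (4 * (1/4) ^ n)"
      by (simp flip: ennreal_mult add: power_divide) (simp add: field_simps flip: power_mult_distrib)
    finally show "ennreal (2 ^ n) * sq_norm k (?u n) \<le> ennreal (4 * (1/4) ^ n)" .
  qed auto
  also have "\<dots> = ennreal (\<Sum>n. 4 * (1/4) ^ n)"
    by (rule suminf_ennreal2) (auto intro!: summable_mult summable_geometric)
  also have "\<dots> < \<infinity>" by simp
  finally have "AE x in dunkl_measure k. (\<Sum>n. ennreal (2 ^ n) * ennreal ((cmod (?u n x))\<^sup>2)) \<noteq> \<infinity>"
    by (intro nn_integral_PInf_AE) auto
  thus ?thesis
  proof eventually_elim
    case (elim x)
    define B where "B = enn2real (\<Sum>n. ennreal (2 ^ n) * ennreal ((cmod (?u n x))\<^sup>2))"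
    have B: "(\<Sum>n. ennreal (2 ^ n) * ennreal ((cmod (?u n x))\<^sup>2)) = ennreal B" "B \<ge> 0"
      using elim by (auto simp: B_def top.not_eq_extremum)
    have ub: "cmod (?u n x) \<le> sqrt B * (1 / sqrt 2) ^ n" for n
    proof -
      have "ennreal (2 ^ n * (cmod (?u n x))\<^sup>2) = ennreal (2 ^ n) * ennreal ((cmod (?u n x))\<^sup>2)" by (simp add: ennreal_mult)
      also have "\<dots> = (\<Sum>i\<in>{n}. ennreal (2 ^ i) * ennreal ((cmod (?u i x))\<^sup>2))" by simp
      also have "\<dots> \<le> ennreal B" unfolding B(1)[symmetric] by (rule sum_le_suminf) auto
      finally have "2 ^ n * (cmod (?u n x))\<^sup>2 \<le> B" using B(2) by simp
      hence "sqrt (2 ^ n * (cmod (?u n x))\<^sup>2) \<le> sqrt B" by simp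
      hence "sqrt 2 ^ n * cmod (?u n x) \<le> sqrt B" by (simp add: real_sqrt_mult real_sqrt_power)
      thus ?thesis by (simp add: field_simps power_divide)
    qed
    have "summable (\<lambda>n. ?u n x)"
    proof (rule summable_comparison_test')
      show "summable (\<lambda>n. sqrt B * (1 / sqrt 2) ^ n)"
        by (intro summable_mult summable_geometric) (simp add: field_simps)
      show "norm (?u n x) \<le> sqrt B * (1 / sqrt 2) ^ n" for n by (rule ub)
    qed
    hence "convergent (\<lambda>n. \<Sum>i<n. ?u i x)" by (simp add: summable_iff_convergent)
    hence "convergent (\<lambda>n. F n x - F 0 x)" by (simp add: sum_lessThan_telescope[of "\<lambda>n. F n x"])
    thus ?case by (simp add: convergent_diff_const_right_iff)
  qed
qed

text \<open>
  Completeness of \<open>L\<^sup>2\<close> by hand. Truncations of \<open>f\<close> that converge at the rate \<open>8^(-n)\<close> have, by the Bessel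
  inequality, transforms with increments of the same order; these converge almost everywhere, and
  Fatou's lemma upgrades this to convergence in norm.
\<close>
lemma is_dunkl_transform_exists:
  assumes f: "f \<in> dunkl_L2 k"
  shows "\<exists>g. is_dunkl_transform k f g"
proof -
  let ?h = "\<lambda>m::nat. \<lambda>x. indicator {- real m..real m} x *\<^sub>R f x"
  let ?F = "dunkl_transform_L1 k"
  have "\<exists>m. sq_norm k (\<lambda>x. ?h m x - f x) < ennreal ((1/8) ^ n)" for n :: nat
  proof -
    have "eventually (\<lambda>m. sq_norm k (\<lambda>x. ?h m x - f x) < ennreal ((1/8) ^ n)) sequentially"
      using dunkl_L2_truncate(3)[OF f] by (rule order_tendstoD(2)) simp
    thus ?thesis by (auto simp: eventually_sequentially)
  qed
  then obtain R where R: "\<And>n. sq_norm k (\<lambda>x. ?h (R n) x - f x) < ennreal ((1/8) ^ n)" by metis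
  define h where "h n = ?h (R n)" for n
  have h2: "h n \<in> dunkl_L2 k" and h1: "integrable (dunkl_measure k) (h n)" for n
    unfolding h_def using dunkl_L2_truncate[OF f] by auto
  have hf: "sq_norm k (\<lambda>x. h n x - f x) \<le> ennreal ((1/8) ^ n)" for n
    using R[of n] by (simp add: h_def less_imp_le)
  have [measurable]: "h n \<in> borel_measurable borel" "f \<in> borel_measurable borel" for n
    using h2 f by (auto simp: dunkl_L2_iff)
  have Fm[measurable]: "?F (h n) \<in> borel_measurable borel" for n by (rule dunkl_transform_L1_measurable[OF k h1])
  have hd: "sq_norm k (\<lambda>l. ?F (h m) l - ?F (h n) l) \<le> ennreal (4 * (1/8) ^ n)" if "m \<ge> n" for m n
  proof -
    have "sq_norm k (\<lambda>l. ?F (h m) l - ?F (h n) l) = sq_norm k (?F (\<lambda>x. h m x - h n x))"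
      by (simp add: sq_norm_def dunkl_transform_L1_diff[OF k h1 h1])
    also have "\<dots> \<le> sq_norm k (\<lambda>x. h m x - h n x)"
      by (intro dunkl_bessel_inequality[OF k] Bochner_Integration.integrable_diff h1 dunkl_L2_diff h2)
    also have "\<dots> = sq_norm k (\<lambda>x. (h m x - f x) - (h n x - f x))" by simp
    also have "\<dots> \<le> 2 * sq_norm k (\<lambda>x. h m x - f x) + 2 * sq_norm k (\<lambda>x. h n x - f x)"
      by (rule sq_norm_diff_le) measurable
    also have "\<dots> \<le> 2 * ennreal ((1/8) ^ n) + 2 * ennreal ((1/8) ^ n)"
    proof (intro add_mono mult_left_mono hf)
      have "sq_norm k (\<lambda>x. h m x - f x) \<le> ennreal ((1/8) ^ m)" by (rule hf)
      also have "\<dots> \<le> ennreal ((1/8) ^ n)" using that by (intro ennreal_leI power_decreasing) auto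
      finally show "sq_norm k (\<lambda>x. h m x - f x) \<le> ennreal ((1/8) ^ n)" .
    qed auto
    also have "\<dots> = ennreal (4 * (1/8) ^ n)" by (simp add: ennreal_mult flip: distrib_right)
    finally show ?thesis .
  qed
  define g where "g l = lim (\<lambda>n. ?F (h n) l)" for l
  have [measurable]: "g \<in> borel_measurable borel"
    unfolding g_def by (rule borel_measurable_lim_metric[OF Fm])
  have "AE l in dunkl_measure k. convergent (\<lambda>n. ?F (h n) l)"
    by (rule AE_convergent_of_sq_norm[OF Fm]) (rule hd, simp)
  hence conv: "AE l in dunkl_measure k. (\<lambda>n. ?F (h n) l) \<longlonglongrightarrow> g l"
    by eventually_elim (simp add: g_def convergent_LIMSEQ_iff)
  have Fg: "sq_norm k (\<lambda>l. ?F (h n) l - g l) \<le> ennreal (4 * (1/8) ^ n)" for n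
  proof -
    have "sq_norm k (\<lambda>l. ?F (h n) l - g l) = (\<integral>\<^sup>+l. liminf (\<lambda>m. ennreal ((cmod (?F (h n) l - ?F (h m) l))\<^sup>2)) \<partial>dunkl_measure k)"
      unfolding sq_norm_def
    proof (rule nn_integral_cong_AE)
      show "AE l in dunkl_measure k. ennreal ((cmod (?F (h n) l - g l))\<^sup>2) = liminf (\<lambda>m. ennreal ((cmod (?F (h n) l - ?F (h m) l))\<^sup>2))"
        using conv
      proof eventually_elim
        case (elim l)
        hence "(\<lambda>m. ennreal ((cmod (?F (h n) l - ?F (h m) l))\<^sup>2)) \<longlonglongrightarrow> ennreal ((cmod (?F (h n) l - g l))\<^sup>2)"
          by (intro tendsto_ennrealI tendsto_intros)
        thus ?case by (rule lim_imp_Liminf[OF sequentially_bot, symmetric])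
      qed
    qed
    also have "\<dots> \<le> liminf (\<lambda>m. sq_norm k (\<lambda>l. ?F (h n) l - ?F (h m) l))"
      unfolding sq_norm_def by (rule nn_integral_liminf) measurable
    also have "\<dots> \<le> liminf (\<lambda>m::nat. ennreal (4 * (1/8) ^ n))"
    proof (rule Liminf_mono)
      show "\<forall>\<^sub>F m in sequentially. sq_norm k (\<lambda>l. ?F (h n) l - ?F (h m) l) \<le> ennreal (4 * (1/8) ^ n)"
        using hd[of n] sq_norm_minus_commute[of k "?F (h n)" "?F (h m)" for m] by (auto simp: eventually_sequentially intro!: exI[of _ n])
    qed
    also have "\<dots> = ennreal (4 * (1/8) ^ n)" by (simp add: Liminf_const)
    finally show ?thesis .
  qed
  have to0: "(\<lambda>n. ennreal (c * (1/8) ^ n)) \<longlonglongrightarrow> 0" for c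
  proof -
    have "(\<lambda>n. c * (1/8) ^ n) \<longlonglongrightarrow> c * 0" by (intro tendsto_intros LIMSEQ_power_zero) auto
    thus ?thesis using tendsto_ennrealI by fastforce
  qed
  have lim0: "(\<lambda>n. u n) \<longlonglongrightarrow> 0" if "\<And>n. u n \<le> ennreal (c * (1/8) ^ n)" for c and u :: "nat \<Rightarrow> ennreal"
    by (rule tendsto_sandwich[OF _ _ tendsto_const to0[of c]]) (use that in auto)
  have "g \<in> dunkl_L2 k"
  proof -
    have "sq_norm k (\<lambda>l. ?F (h 0) l - (?F (h 0) l - g l)) \<le> 2 * sq_norm k (?F (h 0)) + 2 * sq_norm k (\<lambda>l. ?F (h 0) l - g l)"
      by (rule sq_norm_diff_le) measurable
    also have "\<dots> \<le> 2 * sq_norm k (h 0) + 2 * ennreal (4 * (1/8) ^ 0)"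
      by (intro add_mono mult_left_mono Fg dunkl_bessel_inequality[OF k h1 h2]) auto
    also have "\<dots> < \<infinity>"
      using sq_norm_finite[OF h2[of 0]] by (simp add: ennreal_mult_less_top)
    finally show ?thesis by (simp add: dunkl_L2_iff)
  qed
  moreover have "(\<lambda>n. sq_norm k (\<lambda>x. h n x - f x)) \<longlonglongrightarrow> 0"
    by (rule lim0[of _ 1]) (simp add: hf)
  moreover have "(\<lambda>n. sq_norm k (\<lambda>l. ?F (h n) l - g l)) \<longlonglongrightarrow> 0"
    by (rule lim0[OF Fg])
  ultimately show ?thesis unfolding is_dunkl_transform_def using h1 h2 by blast
qed

lemma is_dunkl_transform_L2: "f \<in> dunkl_L2 k \<Longrightarrow> is_dunkl_transform k f (dunkl_transform_L2 k f)"
  using someI_ex[OF is_dunkl_transform_exists] by (simp add: dunkl_transform_L2_eq)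

text \<open>
  The multiplication formula passes to the limit on both sides. In this form the transform of an \<open>L\<^sup>2\<close>
  function is determined by integrals against \<open>L\<^sup>2\<close> functions with explicit transforms.
\<close>
lemma dunkl_L2_duality:
  assumes f: "f \<in> dunkl_L2 k" and g: "is_dunkl_transform k f g"
    and \<phi>: "\<phi> \<in> dunkl_L2 k" "integrable (dunkl_measure k) \<phi>"
  shows "(\<integral>l. g l * \<phi> l \<partial>dunkl_measure k) = (\<integral>x. f x * dunkl_transform_L1 k \<phi> x \<partial>dunkl_measure k)"
proof -
  let ?F = "dunkl_transform_L1 k"
  obtain h where h: "\<And>n. h n \<in> dunkl_L2 k" "\<And>n. integrable (dunkl_measure k) (h n)"
    "(\<lambda>n. sq_norm k (\<lambda>x. h n x - f x)) \<longlonglongrightarrow> 0" "(\<lambda>n. sq_norm k (\<lambda>l. ?F (h n) l - g l)) \<longlonglongrightarrow> 0"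
    and g2: "g \<in> dunkl_L2 k"
    using g unfolding is_dunkl_transform_def by blast
  have FL2: "?F u \<in> dunkl_L2 k" if "integrable (dunkl_measure k) u" "u \<in> dunkl_L2 k" for u
    using dunkl_bessel_inequality[OF k that] dunkl_transform_L1_measurable[OF k that(1)] sq_norm_finite[OF that(2)]
    by (auto simp: dunkl_L2_iff)
  have "(\<lambda>n. \<integral>x. h n x * ?F \<phi> x \<partial>dunkl_measure k) \<longlonglongrightarrow> (\<integral>x. f x * ?F \<phi> x \<partial>dunkl_measure k)"
    by (rule tendsto_L2_pairing[OF h(1) f FL2[OF \<phi>(2,1)] h(3)])
  moreover have "(\<lambda>n. \<integral>l. ?F (h n) l * \<phi> l \<partial>dunkl_measure k) \<longlonglongrightarrow> (\<integral>l. g l * \<phi> l \<partial>dunkl_measure k)"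
    by (rule tendsto_L2_pairing[OF FL2[OF h(2) h(1)] g2 \<phi>(1) h(4)])
  ultimately show ?thesis
    unfolding dunkl_multiplication_formula[OF k h(2) \<phi>(2)] by (rule LIMSEQ_unique[symmetric])
qed

lemma sq_norm_zero_AE:
  assumes [measurable]: "f \<in> borel_measurable borel" and "sq_norm k f = 0"
  shows "AE x in dunkl_measure k. f x = 0"
  using assms(2) unfolding sq_norm_def by (subst (asm) nn_integral_0_iff_AE) auto

lemma is_dunkl_transform_L1:
  assumes f: "f \<in> dunkl_L2 k" "integrable (dunkl_measure k) f" and g: "is_dunkl_transform k f g"
  shows "AE l in dunkl_measure k. g l = dunkl_transform_L1 k f l"
proof -
  let ?F = "dunkl_transform_L1 k"
  obtain h where h: "\<And>n. h n \<in> dunkl_L2 k" "\<And>n. integrable (dunkl_measure k) (h n)"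
    "(\<lambda>n. sq_norm k (\<lambda>x. h n x - f x)) \<longlonglongrightarrow> 0" "(\<lambda>n. sq_norm k (\<lambda>l. ?F (h n) l - g l)) \<longlonglongrightarrow> 0"
    and g2: "g \<in> dunkl_L2 k"
    using g unfolding is_dunkl_transform_def by blast
  have [measurable]: "g \<in> borel_measurable borel" "?F f \<in> borel_measurable borel" "\<And>n. ?F (h n) \<in> borel_measurable borel"
    using g2 f h by (auto simp: dunkl_L2_iff intro!: dunkl_transform_L1_measurable[OF k])
  have "sq_norm k (\<lambda>l. g l - ?F f l) \<le> 2 * sq_norm k (\<lambda>x. h n x - f x) + 2 * sq_norm k (\<lambda>l. ?F (h n) l - g l)" for n
  proof -
    have "sq_norm k (\<lambda>l. g l - ?F f l) = sq_norm k (\<lambda>l. (?F (h n) l - ?F f l) - (?F (h n) l - g l))" by simp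
    also have "\<dots> \<le> 2 * sq_norm k (\<lambda>l. ?F (h n) l - ?F f l) + 2 * sq_norm k (\<lambda>l. ?F (h n) l - g l)"
      by (rule sq_norm_diff_le) measurable
    also have "sq_norm k (\<lambda>l. ?F (h n) l - ?F f l) = sq_norm k (?F (\<lambda>x. h n x - f x))"
      by (simp add: sq_norm_def dunkl_transform_L1_diff[OF k h(2) f(2)])
    also have "\<dots> \<le> sq_norm k (\<lambda>x. h n x - f x)"
      by (intro dunkl_bessel_inequality[OF k] Bochner_Integration.integrable_diff h dunkl_L2_diff f)
    finally show ?thesis by (simp add: mult_left_mono)
  qed
  moreover have "(\<lambda>n. 2 * sq_norm k (\<lambda>x. h n x - f x) + 2 * sq_norm k (\<lambda>l. ?F (h n) l - g l)) \<longlonglongrightarrow> 2 * 0 + 2 * 0"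
    by (intro tendsto_add ennreal_tendsto_cmult h) auto
  ultimately have "sq_norm k (\<lambda>l. g l - ?F f l) \<le> 2 * 0 + 2 * 0"
    by (intro LIMSEQ_le_const) auto
  hence "AE x in dunkl_measure k. g x - ?F f x = 0" by (intro sq_norm_zero_AE) auto
  thus ?thesis by simp
qed

text \<open>
  The hypothesis says that all moments of the complex measure \<open>f exp(-x\<^sup>2) d\<mu>\<close> in the variable
  \<open>exp(-x\<^sup>2)\<close> vanish, so its integrals against functions of \<open>x\<^sup>2\<close> vanish. The sign of the real (or
  imaginary) part of \<open>u(x) = f(x) exp(-x\<^sup>2) + f(-x) exp(-x\<^sup>2)\<close> is such a function.
\<close>
lemma even_part_zero:
  fixes f :: "real \<Rightarrow> complex"
  assumes f: "integrable (dunkl_measure k) (\<lambda>x. f x * of_real (exp (- x\<^sup>2)))" and [measurable]: "f \<in> borel_measurable borel"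
    and zero: "\<And>n. n \<ge> 1 \<Longrightarrow> (\<integral>x. f x * of_real (exp (- real n * x\<^sup>2)) \<partial>dunkl_measure k) = 0"
  shows "AE x in dunkl_measure k. f x + f (- x) = 0"
proof -
  let ?G = "\<lambda>x. f x * of_real (exp (- x\<^sup>2)) :: complex"
  have gz: "(\<integral>x. ?G x * of_real (\<psi> (exp (- x\<^sup>2))) \<partial>dunkl_measure k) = 0"
    if "\<psi> \<in> borel_measurable borel" "\<And>z. \<bar>\<psi> z\<bar> \<le> (1::real)" for \<psi>
  proof -
    have "(\<integral>x. ?G x * of_real (\<psi> (exp (- x\<^sup>2))) \<partial>dunkl_measure k) = (\<integral>x. 0 * of_real (\<psi> (exp (- x\<^sup>2))) \<partial>dunkl_measure k)"
    proof (rule moment_uniqueness[OF f _ _ _ _ _ _ that])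
      show "(\<integral>x. ?G x * of_real (exp (- x\<^sup>2) ^ n) \<partial>dunkl_measure k) = (\<integral>x. 0 * of_real (exp (- x\<^sup>2) ^ n) \<partial>dunkl_measure k)" for n
      proof -
        have "exp (- real (Suc n) * x\<^sup>2) = exp (- x\<^sup>2) * exp (- x\<^sup>2) ^ n" for x :: real
          unfolding minus_mult_commute[of "real (Suc n)"] exp_of_nat_mult power_Suc ..
        hence eq: "?G x * of_real (exp (- x\<^sup>2) ^ n) = f x * of_real (exp (- real (Suc n) * x\<^sup>2))" for x
          by (simp only: mult.assoc of_real_mult)
        show ?thesis unfolding eq using zero[of "Suc n"] by (simp del: of_nat_Suc)
      qed
    qed auto
    thus ?thesis by simp
  qed
  define u where "u x = ?G x + ?G (-x)" for x
  have um[measurable]: "u \<in> borel_measurable borel" unfolding u_def by measurable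
  have ueven: "u \<bar>x\<bar> = u x" for x by (auto simp: u_def abs_if add.commute)
  have Gr: "integrable (dunkl_measure k) (\<lambda>x. ?G (-x))"
    using has_bochner_integral_dunkl_reflect[OF k, of ?G] f by (fastforce simp: has_bochner_integral_iff)
  have ui: "integrable (dunkl_measure k) u" unfolding u_def using f Gr by (rule Bochner_Integration.integrable_add)
  have uz: "(\<integral>x. u x * of_real (\<psi> (exp (- x\<^sup>2))) \<partial>dunkl_measure k) = 0"
    if [measurable]: "\<psi> \<in> borel_measurable borel" and b: "\<And>z. \<bar>\<psi> z\<bar> \<le> (1::real)" for \<psi>
  proof -
    let ?H = "\<lambda>x. ?G x * of_real (\<psi> (exp (- x\<^sup>2)))"
    have "integrable (dunkl_measure k) ?H"
      by (rule Bochner_Integration.integrable_bound[OF f]) (auto simp: norm_mult intro!: AE_I2 mult_left_le b)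
    hence H: "has_bochner_integral (dunkl_measure k) ?H 0" using gz[OF that] by (simp add: has_bochner_integral_iff)
    have "has_bochner_integral (dunkl_measure k) (\<lambda>x. ?H (-x)) 0"
      by (rule has_bochner_integral_dunkl_reflect[OF k _ H]) measurable
    from has_bochner_integral_add[OF H this]
    have "has_bochner_integral (dunkl_measure k) (\<lambda>x. u x * of_real (\<psi> (exp (- x\<^sup>2)))) 0"
      by (simp add: u_def algebra_simps)
    thus ?thesis by (simp add: has_bochner_integral_iff)
  qed
  have part: "AE x in dunkl_measure k. v x = 0" if v: "v = (\<lambda>x. Re (u x)) \<or> v = (\<lambda>x. Im (u x))" for v
  proof -
    have [measurable]: "v \<in> borel_measurable borel" using v by auto
    have vi: "integrable (dunkl_measure k) v" using v ui by auto
    have ve: "v \<bar>x\<bar> = v x" for x using v ueven by auto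
    \<comment> \<open>At \<open>z = exp(-x\<^sup>2)\<close> the argument of \<open>v\<close> is \<open>|x|\<close>, and \<open>v\<close> is even.\<close>
    define \<psi> where "\<psi> z = sgn (v (sqrt (- ln z)))" for z
    have [measurable]: "\<psi> \<in> borel_measurable borel" unfolding \<psi>_def by measurable
    have b: "\<bar>\<psi> z\<bar> \<le> 1" for z by (simp add: \<psi>_def sgn_if)
    have ps: "\<psi> (exp (- x\<^sup>2)) = sgn (v x)" for x by (simp add: \<psi>_def ve)
    have i: "integrable (dunkl_measure k) (\<lambda>x. u x * of_real (\<psi> (exp (- x\<^sup>2))))"
      by (rule Bochner_Integration.integrable_bound[OF ui]) (auto simp: norm_mult intro!: AE_I2 mult_left_le b)
    have "(\<integral>x. v x * \<psi> (exp (- x\<^sup>2)) \<partial>dunkl_measure k) = 0"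
      using v
    proof
      assume v: "v = (\<lambda>x. Re (u x))"
      have "(\<integral>x. v x * \<psi> (exp (- x\<^sup>2)) \<partial>dunkl_measure k) = Re (\<integral>x. u x * of_real (\<psi> (exp (- x\<^sup>2))) \<partial>dunkl_measure k)"
        unfolding integral_Re[OF i, symmetric] by (simp add: v)
      thus ?thesis using uz[of \<psi>] b by simp
    next
      assume v: "v = (\<lambda>x. Im (u x))"
      have "(\<integral>x. v x * \<psi> (exp (- x\<^sup>2)) \<partial>dunkl_measure k) = Im (\<integral>x. u x * of_real (\<psi> (exp (- x\<^sup>2))) \<partial>dunkl_measure k)"
        unfolding integral_Im[OF i, symmetric] by (simp add: v)
      thus ?thesis using uz[of \<psi>] b by simp
    qed
    hence "(\<integral>x. \<bar>v x\<bar> \<partial>dunkl_measure k) = 0" unfolding ps by (simp add: abs_sgn)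
    thus "AE x in dunkl_measure k. v x = 0"
      using vi by (subst (asm) integral_nonneg_eq_0_iff_AE) auto
  qed
  have "AE x in dunkl_measure k. Re (u x) = 0" "AE x in dunkl_measure k. Im (u x) = 0"
    using part[of "\<lambda>x. Re (u x)"] part[of "\<lambda>x. Im (u x)"] by auto
  thus ?thesis
  proof eventually_elim
    case (elim x)
    hence "u x = 0" by (simp add: complex_eq_iff)
    hence "(f x + f (-x)) * of_real (exp (- x\<^sup>2)) = 0" by (simp add: u_def distrib_right)
    thus ?case by simp
  qed
qed

end

section \<open>Injectivity, and the translates of balls\<close>

text \<open>
  Roesler's formula for the translate of an even function, applied to the indicator of a ball.
\<close>
definition ball_translate :: "real \<Rightarrow> real \<Rightarrow> real \<Rightarrow> real \<Rightarrow> real" where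
  "ball_translate k r y x = measure (angle_measure k) {t. x\<^sup>2 + y\<^sup>2 - 2 * x * y * t < r\<^sup>2}"

context
  fixes k :: real
  assumes k: "k > - 1 / 2"
begin

interpretation dunkl: sigma_finite_measure "dunkl_measure k"
  by (rule sigma_finite_dunkl)

interpretation angle: prob_space "angle_measure k"
  by (rule prob_space_angle[OF k])

interpretation da: pair_sigma_finite "dunkl_measure k" "angle_measure k" ..

declare dunkl_kernel_measurable[OF k, measurable]

lemma AE_dunkl_nonzero: "AE x in dunkl_measure k. x \<noteq> 0"
proof -
  have "AE x in lborel. x \<noteq> (0::real)" by (rule AE_lborel_singleton)
  thus ?thesis unfolding dunkl_measure_eq by (subst AE_density) auto
qed

lemma gaussian_L2:
  assumes s: "s > 0"
  shows "(\<lambda>l. complex_of_real (l ^ j * exp (- s * l\<^sup>2))) \<in> dunkl_L2 k"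
proof -
  have "has_bochner_integral (dunkl_measure k) (\<lambda>x. x ^ (2 * j) * exp (- (2 * s) * x\<^sup>2))
           (Gamma (real j + k + 1) / Gamma (k + 1) / (2 * s) ^ j / (2 * (2 * s)) powr (k + 1))"
    using k s by (intro gaussian_moment) auto
  moreover have "(cmod (complex_of_real (l ^ j * exp (- s * l\<^sup>2))))\<^sup>2 = l ^ (2 * j) * exp (- (2 * s) * l\<^sup>2)" for l
  proof -
    have "(exp (- s * l\<^sup>2))\<^sup>2 = exp (- (2 * s) * l\<^sup>2)" by (simp add: power2_eq_square flip: exp_add)
    moreover have "(l ^ j)\<^sup>2 = l ^ (2 * j)" by (simp add: mult.commute flip: power_mult)
    ultimately show ?thesis unfolding norm_of_real power2_abs power_mult_distrib by (simp only:)
  qed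
  ultimately show ?thesis
    by (simp add: dunkl_L2_def has_bochner_integral_iff del: of_real_mult of_real_power)
qed

text \<open>
  By duality the difference of the two functions is orthogonal to the transforms of \<open>exp(-s l\<^sup>2)\<close> and
  \<open>l exp(-s l\<^sup>2)\<close>, which are again a Gaussian and \<open>x\<close> times a Gaussian. Hence its even and its odd part vanish.
\<close>
lemma dunkl_transform_L2_inject:
  assumes f1: "f1 \<in> dunkl_L2 k" and f2: "f2 \<in> dunkl_L2 k"
    and eq: "AE l in dunkl_measure k. dunkl_transform_L2 k f1 l = dunkl_transform_L2 k f2 l"
  shows "AE x in dunkl_measure k. f1 x = f2 x"
proof -
  let ?F = "dunkl_transform_L1 k"
  define f where "f x = f1 x - f2 x" for x
  have f: "f \<in> dunkl_L2 k" unfolding f_def by (rule dunkl_L2_diff[OF f1 f2])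
  have [measurable]: "f \<in> borel_measurable borel" using f by (simp add: dunkl_L2_iff)
  have t1: "is_dunkl_transform k f1 (dunkl_transform_L2 k f1)" and t2: "is_dunkl_transform k f2 (dunkl_transform_L2 k f2)"
    using is_dunkl_transform_L2[OF k] f1 f2 by auto
  have [measurable]: "dunkl_transform_L2 k f1 \<in> borel_measurable borel" "dunkl_transform_L2 k f2 \<in> borel_measurable borel"
    using t1 t2 by (auto simp: is_dunkl_transform_def dunkl_L2_iff)
  have ortho: "(\<integral>x. f x * ?F \<phi> x \<partial>dunkl_measure k) = 0"
    if \<phi>: "\<phi> \<in> dunkl_L2 k" "integrable (dunkl_measure k) \<phi>" for \<phi>
  proof -
    have [measurable]: "\<phi> \<in> borel_measurable borel" using \<phi> by (simp add: dunkl_L2_iff)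
    have FL2: "?F \<phi> \<in> dunkl_L2 k"
      using dunkl_bessel_inequality[OF k \<phi>(2,1)] dunkl_transform_L1_measurable[OF k \<phi>(2)] sq_norm_finite[OF \<phi>(1)]
      by (auto simp: dunkl_L2_iff)
    have "(\<integral>l. dunkl_transform_L2 k f1 l * \<phi> l \<partial>dunkl_measure k) = (\<integral>l. dunkl_transform_L2 k f2 l * \<phi> l \<partial>dunkl_measure k)"
      by (rule integral_cong_AE) (use eq in auto)
    hence "(\<integral>x. f1 x * ?F \<phi> x \<partial>dunkl_measure k) = (\<integral>x. f2 x * ?F \<phi> x \<partial>dunkl_measure k)"
      unfolding dunkl_L2_duality[OF k f1 t1 \<phi>] dunkl_L2_duality[OF k f2 t2 \<phi>] .
    thus ?thesis unfolding f_def left_diff_distrib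
      using integrable_L2_mult[OF f1 FL2] integrable_L2_mult[OF f2 FL2] by simp
  qed
  have s: "real n > 0" "1 / (4 * real n) > 0" if "n \<ge> 1" for n using that by auto
  have e: "(- \<i> * of_real x)\<^sup>2 / of_real (4 * (1 / (4 * real n))) = complex_of_real (- real n * x\<^sup>2)" if "n \<ge> 1" for n x
    using s[OF that] by (simp add: power_mult_distrib)
  have even: "AE x in dunkl_measure k. f x + f (- x) = 0"
  proof (rule even_part_zero[OF k])
    show "integrable (dunkl_measure k) (\<lambda>x. f x * of_real (exp (- x\<^sup>2)))"
      using integrable_L2_mult[OF f gaussian_L2[of 1 0]] by simp
    fix n :: nat assume n: "n \<ge> 1"
    let ?e = "1 / (4 * real n)"
    let ?c = "complex_of_real (1 / (2 * ?e) powr (k + 1))"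
    have F: "?F (\<lambda>l. complex_of_real (l ^ 0 * exp (- ?e * l\<^sup>2))) x = ?c * of_real (exp (- real n * x\<^sup>2))" for x
    proof -
      have "?F (\<lambda>l. complex_of_real (l ^ 0 * exp (- ?e * l\<^sup>2))) x =
        (\<integral>l. dunkl_kernel k ((- \<i> * of_real x) * of_real l) * of_real (exp (- ?e * l\<^sup>2)) \<partial>dunkl_measure k)"
        unfolding dunkl_transform_L1_def by (simp only: of_real_mult power_0 mult_1_left mult.assoc of_real_1)
      also have "\<dots> = ?c * exp ((- \<i> * of_real x)\<^sup>2 / of_real (4 * ?e))"
        by (rule has_bochner_integral_integral_eq[OF gaussian_kernel[OF k s(2)[OF n]]])
      finally show ?thesis unfolding e[OF n] exp_of_real .
    qed
    have c: "?c \<noteq> 0" using n unfolding of_real_eq_0_iff by simp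
    have "integrable (dunkl_measure k) (\<lambda>l. complex_of_real (l ^ 0 * exp (- ?e * l\<^sup>2)))"
      using gaussian_kernel[OF k s(2)[OF n], of 0] k by (simp add: has_bochner_integral_iff)
    from ortho[OF gaussian_L2[OF s(2)[OF n]] this]
    have "(\<integral>x. ?c * (f x * of_real (exp (- real n * x\<^sup>2))) \<partial>dunkl_measure k) = 0"
      unfolding F by (simp only: mult_ac)
    hence "?c * (\<integral>x. f x * of_real (exp (- real n * x\<^sup>2)) \<partial>dunkl_measure k) = 0"
      unfolding integral_mult_right_zero .
    thus "(\<integral>x. f x * of_real (exp (- real n * x\<^sup>2)) \<partial>dunkl_measure k) = 0"
      using c mult_eq_0_iff[of ?c] by blast
  qed measurable
  have odd: "AE x in dunkl_measure k. f x * of_real x + f (- x) * of_real (- x) = 0"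
  proof (rule even_part_zero[OF k, of "\<lambda>x. f x * of_real x"])
    show "integrable (dunkl_measure k) (\<lambda>x. f x * of_real x * of_real (exp (- x\<^sup>2)))"
      using integrable_L2_mult[OF f gaussian_L2[of 1 1]] by (simp add: mult.assoc)
    fix n :: nat assume n: "n \<ge> 1"
    let ?e = "1 / (4 * real n)"
    let ?c = "complex_of_real (1 / (2 * ?e) powr (k + 2)) * - \<i>"
    have F: "?F (\<lambda>l. complex_of_real (l ^ 1 * exp (- ?e * l\<^sup>2))) x = ?c * (of_real x * of_real (exp (- real n * x\<^sup>2)))" for x
    proof -
      have "?F (\<lambda>l. complex_of_real (l ^ 1 * exp (- ?e * l\<^sup>2))) x =
        (\<integral>l. dunkl_kernel k ((- \<i> * of_real x) * of_real l) * of_real (l * exp (- ?e * l\<^sup>2)) \<partial>dunkl_measure k)"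
        unfolding dunkl_transform_L1_def by (simp only: of_real_mult power_one_right mult.assoc)
      also have "\<dots> = of_real (1 / (2 * ?e) powr (k + 2)) * (- \<i> * of_real x) * exp ((- \<i> * of_real x)\<^sup>2 / of_real (4 * ?e))"
        by (rule has_bochner_integral_integral_eq[OF gaussian_kernel_first_moment[OF k s(2)[OF n]]])
      finally show ?thesis unfolding e[OF n] exp_of_real by (simp only: mult.assoc)
    qed
    have c: "?c \<noteq> 0" using n unfolding mult_eq_0_iff of_real_eq_0_iff by simp
    have "integrable (dunkl_measure k) (\<lambda>l. complex_of_real (l ^ 1 * exp (- ?e * l\<^sup>2)))"
      using gaussian_kernel_first_moment[OF k s(2)[OF n], of 0] k by (simp add: has_bochner_integral_iff)
    from ortho[OF gaussian_L2[OF s(2)[OF n]] this]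
    have "(\<integral>x. ?c * (f x * of_real x * of_real (exp (- real n * x\<^sup>2))) \<partial>dunkl_measure k) = 0"
      unfolding F by (simp only: mult_ac)
    hence "?c * (\<integral>x. f x * of_real x * of_real (exp (- real n * x\<^sup>2)) \<partial>dunkl_measure k) = 0"
      unfolding integral_mult_right_zero .
    thus "(\<integral>x. f x * of_real x * of_real (exp (- real n * x\<^sup>2)) \<partial>dunkl_measure k) = 0"
      using c mult_eq_0_iff[of ?c] by blast
  qed measurable
  from even odd AE_dunkl_nonzero show ?thesis
  proof eventually_elim
    case (elim x)
    hence "f (-x) = - f x" by (simp add: add_eq_0_iff)
    hence "f x * of_real x * 2 = 0" using elim(2) by auto
    hence "f x = 0" using elim(3) by simp
    thus ?case by (simp add: f_def)
  qed
qed

lemma ball_translate_01: "0 \<le> ball_translate k r y x" "ball_translate k r y x \<le> 1"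
  by (auto simp: ball_translate_def)

lemma ball_translate_measurable [measurable]:
  "(\<lambda>(y, x). ball_translate k r y x) \<in> borel_measurable (borel \<Otimes>\<^sub>M borel)"
proof -
  have "ball_translate k r y x = (\<integral>t. indicator {t. x\<^sup>2 + y\<^sup>2 - 2 * x * y * t < r\<^sup>2} t \<partial>angle_measure k)" for y x
    by (simp add: ball_translate_def)
  moreover have "(\<lambda>(y, x). (\<integral>t. indicator {t. x\<^sup>2 + y\<^sup>2 - 2 * x * y * t < r\<^sup>2} t \<partial>angle_measure k) :: real) \<in> borel_measurable (borel \<Otimes>\<^sub>M borel)"
    unfolding indicator_def by measurable
  ultimately show ?thesis by simp
qed

lemma ball_translate_support:
  assumes r: "r > 0" and "ball_translate k r y x \<noteq> 0"
  shows "\<bar>\<bar>x\<bar> - \<bar>y\<bar>\<bar> < r"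
proof (rule ccontr)
  assume "\<not> ?thesis"
  hence "r\<^sup>2 \<le> (\<bar>x\<bar> - \<bar>y\<bar>)\<^sup>2" using r power_mono[of r "\<bar>\<bar>x\<bar> - \<bar>y\<bar>\<bar>" 2] by simp
  also have "(\<bar>x\<bar> - \<bar>y\<bar>)\<^sup>2 = x\<^sup>2 + y\<^sup>2 - 2 * (\<bar>x\<bar> * \<bar>y\<bar>)" by (simp add: power2_diff)
  finally have 1: "r\<^sup>2 \<le> x\<^sup>2 + y\<^sup>2 - 2 * (\<bar>x\<bar> * \<bar>y\<bar>)" .
  have "AE t in angle_measure k. t \<notin> {t. x\<^sup>2 + y\<^sup>2 - 2 * x * y * t < r\<^sup>2}"
    using AE_angle[OF k]
  proof eventually_elim
    case (elim t)
    have "x * y * t \<le> \<bar>x * y * t\<bar>" by simp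
    also have "\<dots> = \<bar>x\<bar> * \<bar>y\<bar> * \<bar>t\<bar>" by (simp add: abs_mult)
    also have "\<dots> \<le> \<bar>x\<bar> * \<bar>y\<bar> * 1" using elim by (intro mult_left_mono) auto
    finally show ?case using 1 by simp
  qed
  hence "measure (angle_measure k) {t. x\<^sup>2 + y\<^sup>2 - 2 * x * y * t < r\<^sup>2} = 0"
    by (intro measure_eq_0_null_sets, subst AE_iff_null_sets) auto
  thus False using assms by (simp add: ball_translate_def)
qed

text \<open>
  A bounded function of bounded support is dominated by a multiple of a Gaussian.
\<close>
lemma bounded_support_L12:
  fixes f :: "real \<Rightarrow> real"
  assumes [measurable]: "f \<in> borel_measurable borel" and b: "\<And>x. \<bar>f x\<bar> \<le> 1" "\<And>x. \<bar>x\<bar> > R \<Longrightarrow> f x = 0"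
  shows "integrable (dunkl_measure k) f" "(\<lambda>x. complex_of_real (f x)) \<in> dunkl_L2 k"
proof -
  have g: "integrable (dunkl_measure k) (\<lambda>x. exp (R\<^sup>2) * exp (0 * \<bar>x\<bar> - 1 * x\<^sup>2))"
    using integrable_exp_gaussian[OF k, of 1 0] by simp
  have le: "\<bar>f x\<bar> \<le> exp (R\<^sup>2) * exp (0 * \<bar>x\<bar> - 1 * x\<^sup>2)" for x
  proof (cases "\<bar>x\<bar> > R")
    case False
    hence "x\<^sup>2 \<le> R\<^sup>2" using power_mono[of "\<bar>x\<bar>" R 2] by simp
    hence "1 \<le> exp (R\<^sup>2) * exp (0 * \<bar>x\<bar> - 1 * x\<^sup>2)" by (simp flip: exp_add)
    thus ?thesis using b(1)[of x] by linarith
  qed (use b in auto)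
  show 1: "integrable (dunkl_measure k) f"
    by (rule Bochner_Integration.integrable_bound[OF g]) (use le in auto)
  have "integrable (dunkl_measure k) (\<lambda>x. (f x)\<^sup>2)"
  proof (rule Bochner_Integration.integrable_bound[OF 1])
    have "(f x)\<^sup>2 \<le> \<bar>f x\<bar>" for x
      using mult_left_le[OF b(1)[of x] abs_ge_zero[of "f x"]] by (simp add: power2_eq_square)
    thus "AE x in dunkl_measure k. norm ((f x)\<^sup>2) \<le> norm (f x)" by (intro AE_I2) simp
  qed measurable
  thus "(\<lambda>x. complex_of_real (f x)) \<in> dunkl_L2 k" by (simp add: dunkl_L2_def)
qed

lemma ball_translate_L12:
  assumes r: "r > 0"
  shows "integrable (dunkl_measure k) (ball_translate k r y)" "(\<lambda>x. complex_of_real (ball_translate k r y x)) \<in> dunkl_L2 k"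
proof -
  have [measurable]: "ball_translate k r y \<in> borel_measurable borel"
    using measurable_Pair2[OF ball_translate_measurable[of r], of y] by simp
  show "integrable (dunkl_measure k) (ball_translate k r y)" "(\<lambda>x. complex_of_real (ball_translate k r y x)) \<in> dunkl_L2 k"
    by (rule bounded_support_L12[of _ "\<bar>y\<bar> + r"];
        use ball_translate_01[of r y] ball_translate_support[OF r, of y] in force)+
qed

lemma indicator_ball_L12:
  assumes r: "r > 0"
  shows "integrable (dunkl_measure k) (indicator (centred_ball r) :: real \<Rightarrow> complex)" "(indicator (centred_ball r) :: real \<Rightarrow> complex) \<in> dunkl_L2 k"
proof -
  have "(indicator (centred_ball r) :: real \<Rightarrow> complex) = (\<lambda>x. complex_of_real (indicator (centred_ball r) x))"
    by (auto simp: indicator_def)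
  moreover have "integrable (dunkl_measure k) (indicator (centred_ball r) :: real \<Rightarrow> real)"
      "(\<lambda>x. complex_of_real (indicator (centred_ball r) x)) \<in> dunkl_L2 k"
    by (rule bounded_support_L12[of _ r]; auto simp: indicator_def abs_if split: if_splits)+
  ultimately show "integrable (dunkl_measure k) (indicator (centred_ball r) :: real \<Rightarrow> complex)" "(indicator (centred_ball r) :: real \<Rightarrow> complex) \<in> dunkl_L2 k"
    by (simp_all only: integrable_of_real)
qed

text \<open>
  The indicator of \<open>B\<^sub>r\<close> is a function of \<open>x\<^sup>2\<close>. For \<open>exp(-m x\<^sup>2)\<close> in its place the identity is Weber's
  integral: averaging \<open>exp(-m(x\<^sup>2 + y\<^sup>2 - 2xyt))\<close> over \<open>t\<close> gives \<open>exp(-m(x\<^sup>2 + y\<^sup>2)) E(2mxy)\<close>. Both sides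
  are integrals of a complex measure in the variable \<open>x\<^sup>2 + y\<^sup>2 - 2xyt\<close> (respectively \<open>x\<^sup>2\<close>), so agreement for
  the exponentials with \<open>m = 1, 2, ...\<close> extends to the indicator by uniqueness from moments.
\<close>
lemma dunkl_transform_ball_translate:
  assumes r: "r > 0"
  shows "dunkl_transform_L1 k (\<lambda>x. of_real (ball_translate k r y x)) l =
     dunkl_kernel k (- \<i> * of_real (l * y)) * dunkl_transform_L1 k (indicator (centred_ball r)) l"
proof -
  let ?E = "\<lambda>x. dunkl_kernel k (- \<i> * of_real (l * x))"
  have E1: "norm (?E x) \<le> 1" for x by (rule norm_dunkl_kernel_le_1[OF k]) simp
  \<comment> \<open>The expression is nonnegative for \<open>|t| \<le> 1\<close>; the maximum keeps \<open>exp(-q)\<close> in \<open>[0,1]\<close> for all \<open>t\<close>.\<close>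
  define q where "q = (\<lambda>(x, t). max 0 (x\<^sup>2 + y\<^sup>2 - 2 * x * y * t))"
  have [measurable]: "q \<in> borel_measurable (borel \<Otimes>\<^sub>M borel)" unfolding q_def by measurable
  have q0: "q z \<ge> 0" for z by (auto simp: q_def split: prod.split)
  have qAE: "AE t in angle_measure k. q (x, t) = x\<^sup>2 + y\<^sup>2 - 2 * x * y * t" for x
    using AE_angle[OF k]
  proof eventually_elim
    case (elim t)
    have "x * y * t \<le> \<bar>x * y * t\<bar>" by simp
    also have "\<dots> = \<bar>x\<bar> * \<bar>y\<bar> * \<bar>t\<bar>" by (simp add: abs_mult)
    also have "\<dots> \<le> \<bar>x\<bar> * \<bar>y\<bar> * 1" using elim by (intro mult_left_mono) auto
    also have "2 * \<dots> \<le> x\<^sup>2 + y\<^sup>2" using sum_squares_bound[of "\<bar>x\<bar>" "\<bar>y\<bar>"] by simp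
    finally show ?case by (simp add: q_def)
  qed
  define G where "G z = ?E (fst z) * complex_of_real (exp (- q z))" for z
  define Z where "Z z = exp (- q z)" for z
  let ?M = "dunkl_measure k \<Otimes>\<^sub>M angle_measure k"
  have Gm[measurable]: "G \<in> borel_measurable ?M" unfolding G_def by measurable
  have Zm: "Z \<in> borel_measurable ?M" unfolding Z_def by measurable
  have dom: "integrable ?M (\<lambda>z. exp (2 * \<bar>y\<bar> * \<bar>fst z\<bar> - 1 * (fst z)\<^sup>2))"
  proof (rule da.Fubini_integrable)
    show "integrable (dunkl_measure k) (\<lambda>x. \<integral>t. norm (exp (2 * \<bar>y\<bar> * \<bar>fst (x, t)\<bar> - 1 * (fst (x, t))\<^sup>2)) \<partial>angle_measure k)"
      using integrable_exp_gaussian[OF k, of 1 "2 * \<bar>y\<bar>"] angle.prob_space by simp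
  qed auto
  have Gi: "integrable ?M G"
  proof (rule Bochner_Integration.integrable_bound[OF dom Gm])
    show "AE z in ?M. norm (G z) \<le> norm (exp (2 * \<bar>y\<bar> * \<bar>fst z\<bar> - 1 * (fst z)\<^sup>2))"
    proof (rule da.AE_pair_measure)
      show "{z \<in> space ?M. norm (G z) \<le> norm (exp (2 * \<bar>y\<bar> * \<bar>fst z\<bar> - 1 * (fst z)\<^sup>2))} \<in> sets ?M" by measurable
      show "AE x in dunkl_measure k. AE t in angle_measure k. norm (G (x, t)) \<le> norm (exp (2 * \<bar>y\<bar> * \<bar>fst (x, t)\<bar> - 1 * (fst (x, t))\<^sup>2))"
      proof (rule AE_I2)
        fix x
        show "AE t in angle_measure k. norm (G (x, t)) \<le> norm (exp (2 * \<bar>y\<bar> * \<bar>fst (x, t)\<bar> - 1 * (fst (x, t))\<^sup>2))"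
          using AE_angle[OF k] qAE[of x]
        proof eventually_elim
          case (elim t)
          have "x * y * t \<le> \<bar>x * y * t\<bar>" by simp
          also have "\<dots> = \<bar>x\<bar> * \<bar>y\<bar> * \<bar>t\<bar>" by (simp add: abs_mult)
          also have "\<dots> \<le> \<bar>x\<bar> * \<bar>y\<bar> * 1" using elim by (intro mult_left_mono) auto
          finally have "x * y * t \<le> \<bar>x\<bar> * \<bar>y\<bar>" by simp
          moreover have "- q (x, t) = 2 * (x * y * t) - x\<^sup>2 - y\<^sup>2" unfolding elim by simp
          moreover have "2 * \<bar>y\<bar> * \<bar>x\<bar> = 2 * (\<bar>x\<bar> * \<bar>y\<bar>)" by simp
          ultimately have "- q (x, t) \<le> 2 * \<bar>y\<bar> * \<bar>x\<bar> - 1 * x\<^sup>2"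
            using zero_le_power2[of y] by linarith
          moreover have "norm (G (x, t)) \<le> 1 * exp (- q (x, t))"
            unfolding G_def norm_mult using E1 by (intro mult_mono) auto
          ultimately show ?case by (simp add: order_trans)
        qed
      qed
    qed
  qed
  define G' where "G' x = ?E y * (?E x * complex_of_real (exp (- x\<^sup>2)))" for x
  have G'i: "integrable (dunkl_measure k) G'"
    unfolding G'_def using gaussian_kernel[OF k, of 1 "- \<i> * of_real l"]
    by (intro integrable_mult_right) (simp add: has_bochner_integral_iff mult.assoc)
  \<comment> \<open>Multiplying by \<open>\<psi>\<close> removes the factor \<open>exp(-q)\<close> and restricts to \<open>q < r\<^sup>2\<close>.\<close>
  define \<psi> where "\<psi> z = (if z > exp (- (r\<^sup>2)) then 1 / z else 0)" for z :: real
  have \<psi>m[measurable]: "\<psi> \<in> borel_measurable borel" unfolding \<psi>_def by measurable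
  have \<psi>b: "\<bar>\<psi> z\<bar> \<le> exp (r\<^sup>2)" for z
  proof (cases "z > exp (- (r\<^sup>2))")
    case True
    hence z: "z > 0" by (smt (verit) exp_gt_zero)
    have "1 / z \<le> 1 / exp (- (r\<^sup>2))" using True by (intro divide_left_mono) (use z in auto)
    thus ?thesis using z True by (simp add: \<psi>_def exp_minus field_simps)
  qed (auto simp: \<psi>_def)
  have \<psi>e: "complex_of_real (exp (- c)) * of_real (\<psi> (exp (- c))) = (if c < r\<^sup>2 then 1 else 0)" for c
    by (auto simp: \<psi>_def simp flip: of_real_mult)
  have "(\<integral>z. G z * of_real (\<psi> (Z z)) \<partial>?M) = (\<integral>x. G' x * of_real (\<psi> (exp (- x\<^sup>2))) \<partial>dunkl_measure k)"
  proof (rule moment_uniqueness[OF Gi G'i Zm _ _ _ _ \<psi>m \<psi>b])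
    show "Z z \<in> {0..1}" for z using q0[of z] by (simp add: Z_def)
    show "exp (- x\<^sup>2) \<in> {0..1}" for x :: real by simp
    fix n :: nat
    define m where "m = real (Suc n)"
    have m: "m > 0" by (simp add: m_def)
    have pw: "exp (- c) * exp (- c) ^ n = exp (- m * c)" for c :: real
      unfolding m_def minus_mult_commute[of "real (Suc n)"] exp_of_nat_mult power_Suc ..
    have GZ: "G z * of_real (Z z ^ n) = ?E (fst z) * of_real (exp (- m * q z))" for z
      unfolding G_def Z_def pw[symmetric] by (simp only: of_real_mult mult.assoc)
    have GZi: "integrable ?M (\<lambda>z. ?E (fst z) * of_real (exp (- m * q z)))"
      unfolding GZ[symmetric]
    proof (rule Bochner_Integration.integrable_bound[OF Gi])
      show "(\<lambda>z. G z * of_real (Z z ^ n)) \<in> borel_measurable ?M" using Zm by measurable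
      show "AE z in ?M. norm (G z * of_real (Z z ^ n)) \<le> norm (G z)"
        using q0 by (intro AE_I2) (auto simp: norm_mult Z_def norm_power intro!: mult_left_le power_le_one)
    qed
    have "(\<integral>z. G z * of_real (Z z ^ n) \<partial>?M) = (\<integral>x. (\<integral>t. ?E x * of_real (exp (- m * q (x, t))) \<partial>angle_measure k) \<partial>dunkl_measure k)"
      unfolding GZ using da.integral_fst'[OF GZi] by simp
    also have "\<dots> = (\<integral>x. of_real (exp (- m * y\<^sup>2)) * (dunkl_kernel k ((- \<i> * of_real l) * of_real x) * dunkl_kernel k (of_real (2 * m * y) * of_real x) * of_real (exp (- m * x\<^sup>2))) \<partial>dunkl_measure k)"
    proof (rule Bochner_Integration.integral_cong[OF refl])
      fix x
      have "(\<integral>t. ?E x * of_real (exp (- m * q (x, t))) \<partial>angle_measure k) =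
        (\<integral>t. (?E x * of_real (exp (- m * y\<^sup>2)) * of_real (exp (- m * x\<^sup>2))) * exp (of_real (2 * m * y) * of_real x * of_real t) \<partial>angle_measure k)"
      proof (rule integral_cong_AE)
        show "AE t in angle_measure k. ?E x * of_real (exp (- m * q (x, t))) =
          (?E x * of_real (exp (- m * y\<^sup>2)) * of_real (exp (- m * x\<^sup>2))) * exp (of_real (2 * m * y) * of_real x * of_real t)"
          using qAE[of x]
        proof eventually_elim
          case (elim t)
          have "exp (- m * q (x, t)) = exp (- m * y\<^sup>2) * exp (- m * x\<^sup>2) * exp (2 * m * y * x * t)"
            unfolding elim by (simp add: algebra_simps flip: exp_add)
          thus ?case by (simp add: mult.assoc flip: exp_of_real)
        qed
      qed measurable
      also have "\<dots> = (?E x * of_real (exp (- m * y\<^sup>2)) * of_real (exp (- m * x\<^sup>2))) * dunkl_kernel k (of_real (2 * m * y) * of_real x)"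
        unfolding dunkl_kernel_laplace[OF k, of "of_real (2 * m * y) * of_real x"] by (rule integral_mult_right_zero)
      finally show "(\<integral>t. ?E x * of_real (exp (- m * q (x, t))) \<partial>angle_measure k) =
         of_real (exp (- m * y\<^sup>2)) * (dunkl_kernel k ((- \<i> * of_real l) * of_real x) * dunkl_kernel k (of_real (2 * m * y) * of_real x) * of_real (exp (- m * x\<^sup>2)))"
        by (simp only: of_real_mult mult_ac)
    qed
    also have "\<dots> = of_real (exp (- m * y\<^sup>2)) * (of_real (1 / (2 * m) powr (k + 1)) * exp (((- \<i> * of_real l)\<^sup>2 + (of_real (2 * m * y))\<^sup>2) / of_real (4 * m)) *
        dunkl_kernel k ((- \<i> * of_real l) * of_real (2 * m * y) / of_real (2 * m)))"
      unfolding integral_mult_right_zero has_bochner_integral_integral_eq[OF gaussian_kernel_kernel[OF k m]] ..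
    also have "(- \<i> * of_real l) * of_real (2 * m * y) / of_real (2 * m) = - \<i> * of_real (l * y)"
      using m by simp
    also have "exp (((- \<i> * of_real l)\<^sup>2 + (of_real (2 * m * y))\<^sup>2) / of_real (4 * m)) = complex_of_real (exp (- (l\<^sup>2) / (4 * m))) * of_real (exp (m * y\<^sup>2))"
    proof -
      have "((- \<i> * of_real l)\<^sup>2 + (of_real (2 * m * y))\<^sup>2) / of_real (4 * m) = complex_of_real ((- (l\<^sup>2) + (2 * m * y)\<^sup>2) / (4 * m))"
        by (simp add: power_mult_distrib)
      also have "(- (l\<^sup>2) + (2 * m * y)\<^sup>2) / (4 * m) = - (l\<^sup>2) / (4 * m) + m * y\<^sup>2"
        using m by (simp add: field_simps power2_eq_square)
      finally show ?thesis by (simp only: exp_of_real exp_add of_real_mult)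
    qed
    finally have L: "(\<integral>z. G z * of_real (Z z ^ n) \<partial>?M) = ?E y * (of_real (1 / (2 * m) powr (k + 1)) * of_real (exp (- (l\<^sup>2) / (4 * m))))"
    proof -
      assume a: "(\<integral>z. G z * of_real (Z z ^ n) \<partial>?M) = of_real (exp (- m * y\<^sup>2)) * (of_real (1 / (2 * m) powr (k + 1)) * (complex_of_real (exp (- (l\<^sup>2) / (4 * m))) * of_real (exp (m * y\<^sup>2))) * ?E y)"
      have "complex_of_real (exp (- m * y\<^sup>2)) * of_real (exp (m * y\<^sup>2)) = 1" by (simp flip: of_real_mult exp_add)
      hence "of_real (exp (- m * y\<^sup>2)) * (P * (Q * of_real (exp (m * y\<^sup>2))) * R) = R * (P * Q)" for P Q R :: complex
        by (metis (no_types, lifting) mult.assoc mult.commute mult.left_neutral)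
      thus ?thesis unfolding a .
    qed
    have "(\<integral>x. G' x * of_real (exp (- x\<^sup>2) ^ n) \<partial>dunkl_measure k) = (\<integral>x. ?E y * (dunkl_kernel k ((- \<i> * of_real l) * of_real x) * of_real (exp (- m * x\<^sup>2))) \<partial>dunkl_measure k)"
      unfolding G'_def pw[symmetric] by (simp only: of_real_mult mult.assoc)
    also have "\<dots> = ?E y * (of_real (1 / (2 * m) powr (k + 1)) * exp ((- \<i> * of_real l)\<^sup>2 / of_real (4 * m)))"
      unfolding integral_mult_right_zero has_bochner_integral_integral_eq[OF gaussian_kernel[OF k m]] ..
    also have "(- \<i> * of_real l)\<^sup>2 / of_real (4 * m) = complex_of_real (- (l\<^sup>2) / (4 * m))" by (simp add: power_mult_distrib)
    finally show "(\<integral>z. G z * of_real (Z z ^ n) \<partial>?M) = (\<integral>x. G' x * of_real (exp (- x\<^sup>2) ^ n) \<partial>dunkl_measure k)"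
      unfolding L exp_of_real ..
  qed auto
  also have "(\<integral>x. G' x * of_real (\<psi> (exp (- x\<^sup>2))) \<partial>dunkl_measure k) = (\<integral>x. ?E y * (?E x * indicator (centred_ball r) x) \<partial>dunkl_measure k)"
  proof (rule Bochner_Integration.integral_cong[OF refl])
    fix x
    have "x\<^sup>2 < r\<^sup>2 \<longleftrightarrow> x \<in> centred_ball r" using r abs_le_square_iff[of r x] by (auto simp: not_le[symmetric] abs_if split: if_splits)
    thus "G' x * of_real (\<psi> (exp (- x\<^sup>2))) = ?E y * (?E x * indicator (centred_ball r) x)"
      unfolding G'_def mult.assoc \<psi>e by (simp add: indicator_def)
  qed
  also have "\<dots> = ?E y * dunkl_transform_L1 k (indicator (centred_ball r)) l"
    unfolding dunkl_transform_L1_def by (rule integral_mult_right_zero)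
  also have "(\<integral>z. G z * of_real (\<psi> (Z z)) \<partial>?M) = dunkl_transform_L1 k (\<lambda>x. of_real (ball_translate k r y x)) l"
  proof -
    have Gpsi: "G z * of_real (\<psi> (Z z)) = ?E (fst z) * (if q z < r\<^sup>2 then 1 else 0)" for z
      unfolding G_def Z_def mult.assoc \<psi>e ..
    have "integrable ?M (\<lambda>z. G z * of_real (\<psi> (Z z)))"
    proof (rule Bochner_Integration.integrable_bound)
      show "integrable ?M (\<lambda>z. exp (r\<^sup>2) * norm (G z))" using Gi by simp
      show "(\<lambda>z. G z * of_real (\<psi> (Z z))) \<in> borel_measurable ?M" using Zm by measurable
      show "AE z in ?M. norm (G z * of_real (\<psi> (Z z))) \<le> norm (exp (r\<^sup>2) * norm (G z))"
      proof (rule AE_I2)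
        fix z
        have "norm (G z * of_real (\<psi> (Z z))) = \<bar>\<psi> (Z z)\<bar> * norm (G z)" by (simp add: norm_mult)
        also have "\<dots> \<le> exp (r\<^sup>2) * norm (G z)" by (rule mult_right_mono[OF \<psi>b norm_ge_zero])
        finally show "norm (G z * of_real (\<psi> (Z z))) \<le> norm (exp (r\<^sup>2) * norm (G z))" by simp
      qed
    qed
    hence "(\<integral>z. G z * of_real (\<psi> (Z z)) \<partial>?M) = (\<integral>x. (\<integral>t. ?E x * (if q (x, t) < r\<^sup>2 then 1 else 0) \<partial>angle_measure k) \<partial>dunkl_measure k)"
      unfolding Gpsi using da.integral_fst' by fastforce
    also have "\<dots> = dunkl_transform_L1 k (\<lambda>x. of_real (ball_translate k r y x)) l"
      unfolding dunkl_transform_L1_def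
    proof (rule Bochner_Integration.integral_cong[OF refl])
      fix x
      have "(\<integral>t. (if q (x, t) < r\<^sup>2 then 1 else 0) \<partial>angle_measure k) = (\<integral>t. complex_of_real (indicator {t. x\<^sup>2 + y\<^sup>2 - 2 * x * y * t < r\<^sup>2} t) \<partial>angle_measure k)"
        using r by (intro Bochner_Integration.integral_cong) (auto simp: q_def indicator_def)
      also have "\<dots> = of_real (ball_translate k r y x)"
        by (simp add: ball_translate_def)
      finally show "(\<integral>t. ?E x * (if q (x, t) < r\<^sup>2 then 1 else 0) \<partial>angle_measure k) = ?E x * of_real (ball_translate k r y x)"
        unfolding integral_mult_right_zero by simp
    qed
    finally show ?thesis .
  qed
  finally show ?thesis .
qed

text \<open>
  The explicit function satisfies the condition that defines the translate, and injectivity of the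
  transform leaves no other choice up to null sets.
\<close>
theorem translated_ball_AE:
  assumes r: "r > 0"
  shows "AE x in dunkl_measure k. translated_ball k r y x = ball_translate k r y x"
proof -
  let ?\<chi> = "indicator (centred_ball r) :: real \<Rightarrow> complex"
  let ?T = "\<lambda>x. complex_of_real (ball_translate k r y x)"
  let ?P = "\<lambda>g. g \<in> dunkl_L2 k \<and> (AE x in dunkl_measure k. dunkl_transform_L2 k g x = dunkl_kernel k (\<i> * of_real (x * - y)) * dunkl_transform_L2 k ?\<chi> x)"
  have T: "?T \<in> dunkl_L2 k" "integrable (dunkl_measure k) ?T"
    using ball_translate_L12[OF r, of y] by auto
  note \<chi> = indicator_ball_L12[OF r]
  have "AE l in dunkl_measure k. dunkl_transform_L2 k ?T l = dunkl_transform_L1 k ?T l"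
    by (rule is_dunkl_transform_L1[OF k T is_dunkl_transform_L2[OF k T(1)]])
  moreover have "AE l in dunkl_measure k. dunkl_transform_L2 k ?\<chi> l = dunkl_transform_L1 k ?\<chi> l"
    by (rule is_dunkl_transform_L1[OF k \<chi>(2,1) is_dunkl_transform_L2[OF k \<chi>(2)]])
  ultimately have TF: "AE x in dunkl_measure k. dunkl_transform_L2 k ?T x = dunkl_kernel k (\<i> * of_real (x * - y)) * dunkl_transform_L2 k ?\<chi> x"
    by eventually_elim (simp add: dunkl_transform_ball_translate[OF r])
  hence "?P ?T" using T by simp
  hence P: "?P (dunkl_translate k (- y) ?\<chi>)"
    unfolding dunkl_translate_def by (rule someI[of ?P])
  have "AE x in dunkl_measure k. dunkl_translate k (- y) ?\<chi> x = ?T x"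
    by (rule dunkl_transform_L2_inject) (use P T TF in auto)
  thus ?thesis by eventually_elim (simp add: translated_ball_def)
qed

end

section \<open>Two-sided bounds for translated balls\<close>

text \<open>
  The ball \<open>B(y,r)\<close> of the theory, up to the point \<open>0\<close>: the preimage of an interval under the absolute
  value. In this form the triangle inequality is that of the line.
\<close>
definition annulus :: "real \<Rightarrow> real \<Rightarrow> real set" where
  "annulus y r = {x. \<bar>\<bar>x\<bar> - \<bar>y\<bar>\<bar> < r}"

text \<open>
  Comparable with the measure of the annulus.
\<close>
definition annulus_vol :: "real \<Rightarrow> real \<Rightarrow> real \<Rightarrow> real" where
  "annulus_vol k y r = r * (\<bar>y\<bar> + r) powr (2 * k + 1)"

text \<open>
  Comparable with \<open>\<mu>(B(0,r)) / \<mu>(B(y,r))\<close>, and with the height of the translate of the indicator of \<open>B(0,r)\<close>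
  near \<open>y\<close>.
\<close>
definition ball_ratio :: "real \<Rightarrow> real \<Rightarrow> real \<Rightarrow> real" where
  "ball_ratio k y r = (r / (\<bar>y\<bar> + r)) powr (2 * k + 1)"

lemma annulus_measurable [measurable]: "annulus y r \<in> sets borel"
  unfolding annulus_def by measurable

lemma annulus_eq: "annulus y r = {y - r<..<y + r} \<union> {- y - r<..<- y + r}"
  unfolding annulus_def by (auto simp: abs_if split: if_splits)

lemma ball_ratio_nonneg: "ball_ratio k y r \<ge> 0"
  by (simp add: ball_ratio_def)

lemma annulus_vol_pos: "r > 0 \<Longrightarrow> annulus_vol k y r > 0"
  by (simp add: annulus_vol_def)

lemma ball_ratio_vol: "r > 0 \<Longrightarrow> ball_ratio k y r * annulus_vol k y r = r powr (2 * k + 2)"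
proof -
  assume r: "r > 0"
  have "r powr (2 * k + 2) = r powr (2 * k + 1) * r powr 1"
    unfolding powr_add[symmetric] by (simp add: add.commute)
  thus ?thesis using r by (simp add: ball_ratio_def annulus_vol_def powr_divide)
qed

context
  fixes k :: real
  assumes k: "k > - 1 / 2"
begin

interpretation angle: prob_space "angle_measure k"
  by (rule prob_space_angle[OF k])

lemma ball_ratio_mono:
  assumes "0 < r" "r \<le> s"
  shows "ball_ratio k y r \<le> ball_ratio k y s"
  unfolding ball_ratio_def
proof (rule powr_mono2)
  show "r / (\<bar>y\<bar> + r) \<le> s / (\<bar>y\<bar> + s)"
    using assms mult_right_mono[OF assms(2), of "\<bar>y\<bar>"] by (simp add: divide_simps algebra_simps)
qed (use assms k in auto)

lemma nn_integral_powr_0: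
  assumes "c > 0" "a > 0"
  shows "(\<integral>\<^sup>+u. ennreal (indicator {0..c} u * u powr (a - 1)) \<partial>lborel) = ennreal (c powr a / a)"
proof -
  have "((\<lambda>u. u powr (a - 1)) has_integral (c powr (a - 1 + 1) / (a - 1 + 1))) {0..c}"
    by (rule has_integral_powr_from_0) (use assms in auto)
  thus ?thesis
    using nn_integral_has_integral_lebesgue[of "{0..c}" "\<lambda>u. u powr (a - 1)"]
    by (simp add: nn_integral_completion)
qed

lemma emeasure_angle:
  assumes [measurable]: "A \<in> sets borel"
  shows "emeasure (angle_measure k) A = (\<integral>\<^sup>+t. ennreal (angle_density k t * indicator A t) \<partial>lborel)"
  unfolding angle_measure_def using angle_density_nonneg[OF k]
  by (subst emeasure_density) (auto simp: indicator_def intro!: nn_integral_cong)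

text \<open>
  Near \<open>t = 1\<close> the density behaves like \<open>(1 - t)^(k-1/2)\<close>; near \<open>t = -1\<close> it is smaller by the factor
  \<open>1 + t\<close>.
\<close>
lemma angle_tail_le:
  "\<exists>C>0. \<forall>\<delta>>0. measure (angle_measure k) {t. 1 - \<bar>t\<bar> < \<delta>} \<le> C * \<delta> powr (k + 1/2)"
proof -
  let ?a = "k + 1/2"
  have a: "?a > 0" using k by simp
  define Z where "Z = 2 powr (2 * k + 1) * Beta (k + 3/2) (k + 1/2)"
  have Z: "Z > 0" unfolding Z_def using Beta_pos[of "k + 3/2" "k + 1/2"] k by simp
  define M where "M = 2 powr ?a / Z"
  have M: "M > 0" using Z by (simp add: M_def)
  have dens: "angle_density k t \<le> M * (1 - \<bar>t\<bar>) powr (?a - 1)" if t: "-1 < t" "t < 1" for t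
  proof -
    have "(1 + t) powr (k + 1/2) * (1 - t) powr (k - 1/2) \<le> 2 powr ?a * (1 - \<bar>t\<bar>) powr (?a - 1)"
    proof (cases "t \<ge> 0")
      case True
      have "(1 + t) powr (k + 1/2) \<le> 2 powr ?a" using t True a by (intro powr_mono2) auto
      thus ?thesis using True t by (simp add: mult_right_mono)
    next
      case False
      have "(1 + t) powr (k + 1/2) = (1 - \<bar>t\<bar>) powr (?a - 1) * (1 - \<bar>t\<bar>)"
        using False t powr_add[of "1 + t" "?a - 1" 1] by (simp add: add.commute)
      also have "\<dots> \<le> (1 - \<bar>t\<bar>) powr (?a - 1) * 1" using False by (intro mult_left_mono) auto
      finally have 1: "(1 + t) powr (k + 1/2) \<le> (1 - \<bar>t\<bar>) powr (?a - 1)" by simp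
      have "(1 - t) powr (k - 1/2) \<le> (1 - t) powr ?a" using False by (intro powr_mono) auto
      also have "\<dots> \<le> 2 powr ?a" using False t a by (intro powr_mono2) auto
      finally have "(1 + t) powr (k + 1/2) * (1 - t) powr (k - 1/2) \<le> (1 - \<bar>t\<bar>) powr (?a - 1) * 2 powr ?a"
        using 1 by (intro mult_mono) auto
      thus ?thesis by (simp add: mult.commute)
    qed
    thus ?thesis using t Z by (simp add: angle_density_def M_def Z_def[symmetric] divide_right_mono)
  qed
  have "measure (angle_measure k) {t. 1 - \<bar>t\<bar> < \<delta>} \<le> 2 * M / ?a * \<delta> powr ?a" if \<delta>: "\<delta> > 0" for \<delta>
  proof -
    let ?g = "\<lambda>u. ennreal (indicator {0..\<delta>} u * u powr (?a - 1))"
    have "emeasure (angle_measure k) {t. 1 - \<bar>t\<bar> < \<delta>} = (\<integral>\<^sup>+t. ennreal (angle_density k t * indicator {t. 1 - \<bar>t\<bar> < \<delta>} t) \<partial>lborel)"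
      by (rule emeasure_angle) measurable
    also have "\<dots> \<le> (\<integral>\<^sup>+t. ennreal M * ?g (1 + (-1) * t) + ennreal M * ?g (1 + 1 * t) \<partial>lborel)"
    proof (rule nn_integral_mono)
      fix t :: real
      show "ennreal (angle_density k t * indicator {t. 1 - \<bar>t\<bar> < \<delta>} t) \<le> ennreal M * ?g (1 + (-1) * t) + ennreal M * ?g (1 + 1 * t)"
      proof (cases "-1 < t \<and> t < 1 \<and> 1 - \<bar>t\<bar> < \<delta>")
        case True
        have eq: "ennreal (angle_density k t * indicator {t. 1 - \<bar>t\<bar> < \<delta>} t) \<le> ennreal M * ?g (1 - \<bar>t\<bar>)"
        proof -
          have "\<bar>t\<bar> \<le> 1" using True by auto
          thus ?thesis using True dens[of t] M by (simp add: ennreal_mult[symmetric] indicator_def ennreal_leI)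
        qed
        show ?thesis
        proof (cases "t \<ge> 0")
          case True
          hence "ennreal M * ?g (1 - \<bar>t\<bar>) = ennreal M * ?g (1 + (-1) * t)" by simp
          from eq[unfolded this] show ?thesis by (intro add_increasing2 zero_le)
        next
          case False
          hence "ennreal M * ?g (1 - \<bar>t\<bar>) = ennreal M * ?g (1 + 1 * t)" by simp
          from eq[unfolded this] show ?thesis by (intro add_increasing zero_le)
        qed
      next
        case False
        hence "angle_density k t * indicator {t. 1 - \<bar>t\<bar> < \<delta>} t = 0" by (auto simp: angle_density_def indicator_def)
        thus ?thesis by (simp only: ennreal_0 zero_le)
      qed
    qed
    also have "\<dots> = ennreal M * (\<integral>\<^sup>+t. ?g (1 + (-1) * t) \<partial>lborel) + ennreal M * (\<integral>\<^sup>+t. ?g (1 + 1 * t) \<partial>lborel)"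
      by (subst nn_integral_add; (subst nn_integral_cmult)?) (auto simp: nn_integral_cmult)
    also have "(\<integral>\<^sup>+t. ?g (1 + (-1) * t) \<partial>lborel) = (\<integral>\<^sup>+u. ?g u \<partial>lborel)"
      by (subst nn_integral_real_affine[of ?g "-1" 1]) auto
    also have "(\<integral>\<^sup>+t. ?g (1 + 1 * t) \<partial>lborel) = (\<integral>\<^sup>+u. ?g u \<partial>lborel)"
      by (subst nn_integral_real_affine[of ?g "1" 1]) auto
    also have "(\<integral>\<^sup>+u. ?g u \<partial>lborel) = ennreal (\<delta> powr ?a / ?a)" by (rule nn_integral_powr_0[OF \<delta> a])
    also have "ennreal M * ennreal (\<delta> powr ?a / ?a) + ennreal M * ennreal (\<delta> powr ?a / ?a) = ennreal (2 * M / ?a * \<delta> powr ?a)"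
    proof -
      have "ennreal M * ennreal (\<delta> powr ?a / ?a) + ennreal M * ennreal (\<delta> powr ?a / ?a) = ennreal (M * (\<delta> powr ?a / ?a) + M * (\<delta> powr ?a / ?a))"
      proof -
        have "ennreal M * ennreal (\<delta> powr ?a / ?a) = ennreal (M * (\<delta> powr ?a / ?a))"
          using M a by (intro ennreal_mult[symmetric]) auto
        moreover have "M * (\<delta> powr ?a / ?a) \<ge> 0" using M a by simp
        ultimately show ?thesis by (simp only: ennreal_plus)
      qed
      also have "M * (\<delta> powr ?a / ?a) + M * (\<delta> powr ?a / ?a) = 2 * M / ?a * \<delta> powr ?a" by simp
      finally show ?thesis .
    qed
    finally show ?thesis
      using M a by (simp add: angle.emeasure_eq_measure)
  qed
  moreover have "2 * M / ?a > 0" using M a by simp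
  ultimately show ?thesis by blast
qed

lemma angle_tail_ge:
  "\<exists>c>0. \<forall>\<delta>>0. \<delta> \<le> 1 \<longrightarrow> c * \<delta> powr (k + 1/2) \<le> measure (angle_measure k) {t. 1 - t < \<delta>}"
proof -
  let ?a = "k + 1/2"
  have a: "?a > 0" using k by simp
  define Z where "Z = 2 powr (2 * k + 1) * Beta (k + 3/2) (k + 1/2)"
  have Z: "Z > 0" unfolding Z_def using Beta_pos[of "k + 3/2" "k + 1/2"] k by simp
  have "1 / Z / ?a * \<delta> powr ?a \<le> measure (angle_measure k) {t. 1 - t < \<delta>}" if \<delta>: "\<delta> > 0" "\<delta> \<le> 1" for \<delta>
  proof -
    let ?g = "\<lambda>u. ennreal (indicator {0..\<delta>} u * u powr (?a - 1))"
    have "ennreal (1 / Z / ?a * \<delta> powr ?a) = ennreal (1 / Z) * ennreal (\<delta> powr ?a / ?a)"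
      using Z a by (subst ennreal_mult[symmetric]) auto
    also have "ennreal (\<delta> powr ?a / ?a) = (\<integral>\<^sup>+u. ?g u \<partial>lborel)" by (rule nn_integral_powr_0[OF \<delta>(1) a, symmetric])
    also have "\<dots> = (\<integral>\<^sup>+t. ?g (1 + (-1) * t) \<partial>lborel)"
      by (subst nn_integral_real_affine[of ?g "-1" 1]) auto
    also have "ennreal (1 / Z) * \<dots> = (\<integral>\<^sup>+t. ennreal (1 / Z) * ?g (1 + (-1) * t) \<partial>lborel)"
      by (rule nn_integral_cmult[symmetric]) measurable
    also have "\<dots> \<le> (\<integral>\<^sup>+t. ennreal (angle_density k t * indicator {t. 1 - t < \<delta>} t) \<partial>lborel)"
    proof (rule nn_integral_mono_AE)
      have "AE t in lborel. t \<noteq> (1::real)" "AE t in lborel. t \<noteq> (1 - \<delta>::real)" by (rule AE_lborel_singleton)+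
      thus "AE t in lborel. ennreal (1 / Z) * ?g (1 + (-1) * t) \<le> ennreal (angle_density k t * indicator {t. 1 - t < \<delta>} t)"
      proof eventually_elim
        case (elim t)
        show ?case
        proof (cases "1 - \<delta> \<le> t \<and> t \<le> 1")
          case True
          hence t: "1 - \<delta> < t" "t < 1" using elim by auto
          hence t0: "t > 0" using \<delta> by linarith
          have "1 \<le> (1 + t) powr (k + 1/2)" using t0 a by (intro ge_one_powr_ge_zero) auto
          hence "(1 - t) powr (k - 1/2) \<le> (1 + t) powr (k + 1/2) * (1 - t) powr (k - 1/2)"
            by (simp add: mult_le_cancel_right1)
          hence "1 / Z * (1 - t) powr (k - 1/2) \<le> angle_density k t"
            using t t0 Z by (simp add: angle_density_def Z_def[symmetric] divide_right_mono)
          thus ?thesis using t Z \<delta> by (simp add: ennreal_mult[symmetric] ennreal_leI)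
        qed (auto simp: indicator_def)
      qed
    qed
    also have "\<dots> = emeasure (angle_measure k) {t. 1 - t < \<delta>}"
      by (rule emeasure_angle[symmetric]) measurable
    finally show ?thesis using Z a by (simp add: angle.emeasure_eq_measure)
  qed
  moreover have "1 / Z / ?a > 0" using Z a by simp
  ultimately show ?thesis by blast
qed

text \<open>
  The inequality that defines the event forces \<open>1 - |t| < (r/|y|)\<^sup>2\<close> when \<open>|y| > 2r\<close>, since then \<open>|x| \<ge> |y|/2\<close>;
  the tail bound gives \<open>(r/|y|)^(2k+1)\<close>. When \<open>|y| \<le> 2r\<close> the ratio is bounded below and the trivial bound suffices.
\<close>
lemma ball_translate_le:
  "\<exists>C>0. \<forall>r>0. \<forall>y x. ball_translate k r y x \<le> C * ball_ratio k y r"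
proof -
  obtain C where C: "C > 0" "\<And>\<delta>. \<delta> > 0 \<Longrightarrow> measure (angle_measure k) {t. 1 - \<bar>t\<bar> < \<delta>} \<le> C * \<delta> powr (k + 1/2)"
    using angle_tail_le by blast
  define D where "D = max (3 powr (2 * k + 1)) (C * (3/2) powr (2 * k + 1))"
  have w: "2 * k + 1 > 0" using k by simp
  have "ball_translate k r y x \<le> D * ball_ratio k y r" if r: "r > 0" for r y x
  proof (cases "\<bar>y\<bar> \<le> 2 * r")
    case True
    have "1 / 3 \<le> r / (\<bar>y\<bar> + r)" using True r by (simp add: field_simps)
    hence "(1 / 3) powr (2 * k + 1) \<le> ball_ratio k y r"
      unfolding ball_ratio_def using w by (intro powr_mono2) auto
    hence "1 \<le> 3 powr (2 * k + 1) * ball_ratio k y r" by (simp add: powr_divide field_simps)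
    also have "\<dots> \<le> D * ball_ratio k y r" by (intro mult_right_mono) (auto simp: D_def ball_ratio_nonneg)
    finally show ?thesis using ball_translate_01(2)[OF k, of r y x] by linarith
  next
    case False
    show ?thesis
    proof (cases "ball_translate k r y x = 0")
      case True
      have "0 \<le> D" using C by (simp add: D_def le_max_iff_disj)
      thus ?thesis using True ball_ratio_nonneg[of k y r] by simp
    next
      case nz: False
      have s: "\<bar>\<bar>x\<bar> - \<bar>y\<bar>\<bar> < r" by (rule ball_translate_support[OF k r nz])
      have y: "\<bar>y\<bar> > 0" and x: "\<bar>x\<bar> \<ge> \<bar>y\<bar> / 2" using False s r by auto
      define \<delta> where "\<delta> = (r / \<bar>y\<bar>)\<^sup>2"
      have \<delta>: "\<delta> > 0" using r y by (simp add: \<delta>_def)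
      have "ball_translate k r y x \<le> measure (angle_measure k) {t. 1 - \<bar>t\<bar> < \<delta>}"
        unfolding ball_translate_def
      proof (rule angle.finite_measure_mono)
        show "{t. x\<^sup>2 + y\<^sup>2 - 2 * x * y * t < r\<^sup>2} \<subseteq> {t. 1 - \<bar>t\<bar> < \<delta>}"
        proof (intro subsetI CollectI; drule CollectD)
          fix t assume t: "x\<^sup>2 + y\<^sup>2 - 2 * x * y * t < r\<^sup>2"
          have "x * y * t \<le> \<bar>x * y * t\<bar>" by simp
          also have "\<dots> = \<bar>x\<bar> * \<bar>y\<bar> * \<bar>t\<bar>" by (simp add: abs_mult)
          finally have "2 * (\<bar>x\<bar> * \<bar>y\<bar>) * (1 - \<bar>t\<bar>) \<le> 2 * (\<bar>x\<bar> * \<bar>y\<bar>) - 2 * x * y * t"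
            by (simp add: right_diff_distrib)
          also have "\<dots> \<le> x\<^sup>2 + y\<^sup>2 - 2 * x * y * t"
            using sum_squares_bound[of "\<bar>x\<bar>" "\<bar>y\<bar>"] by simp
          finally have 1: "2 * (\<bar>x\<bar> * \<bar>y\<bar>) * (1 - \<bar>t\<bar>) < r\<^sup>2" using t by linarith
          show "1 - \<bar>t\<bar> < \<delta>"
          proof (cases "1 - \<bar>t\<bar> \<le> 0")
            case False
            have "\<bar>y\<bar> / 2 * \<bar>y\<bar> \<le> \<bar>x\<bar> * \<bar>y\<bar>" using x by (intro mult_right_mono) auto
            hence "y\<^sup>2 \<le> 2 * (\<bar>x\<bar> * \<bar>y\<bar>)" by (simp add: power2_eq_square)
            hence "y\<^sup>2 * (1 - \<bar>t\<bar>) \<le> 2 * (\<bar>x\<bar> * \<bar>y\<bar>) * (1 - \<bar>t\<bar>)" using False by (intro mult_right_mono) auto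
            hence "y\<^sup>2 * (1 - \<bar>t\<bar>) < r\<^sup>2" using 1 by linarith
            thus ?thesis using y by (simp add: \<delta>_def power_divide field_simps)
          qed (use \<delta> in linarith)
        qed
      qed measurable
      also have "\<dots> \<le> C * \<delta> powr (k + 1/2)" by (rule C(2)[OF \<delta>])
      also have "\<delta> powr (k + 1/2) = (r / \<bar>y\<bar>) powr (2 * k + 1)"
        using r y by (simp add: \<delta>_def powr_powr algebra_simps flip: powr_numeral)
      also have "\<dots> \<le> (3/2 * (r / (\<bar>y\<bar> + r))) powr (2 * k + 1)"
        using r y False w by (intro powr_mono2) (auto simp: field_simps)
      also have "\<dots> = (3/2) powr (2 * k + 1) * ball_ratio k y r"
        unfolding ball_ratio_def by (rule powr_mult)
      finally have "ball_translate k r y x \<le> C * (3/2) powr (2 * k + 1) * ball_ratio k y r"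
        using C(1) by (simp add: mult.assoc)
      also have "\<dots> \<le> D * ball_ratio k y r"
        by (intro mult_right_mono) (auto simp: D_def ball_ratio_nonneg)
      finally show ?thesis .
    qed
  qed
  moreover have "D > 0" unfolding D_def by (simp add: less_max_iff_disj)
  ultimately show ?thesis by blast
qed

text \<open>
  As \<open>x\<^sup>2 + y\<^sup>2 - 2xyt = (x - y)\<^sup>2 + 2xy(1 - t)\<close>, the event contains \<open>1 - t < (3/8)(r/(|y|+r))\<^sup>2\<close> if \<open>xy > 0\<close>, and it is
  almost sure otherwise. The bound holds only for \<open>x\<close> near \<open>y\<close>: near \<open>-y\<close> the translate is much smaller.
\<close>
lemma ball_translate_ge:
  "\<exists>c>0. \<forall>r>0. \<forall>y x. \<bar>x - y\<bar> < r / 2 \<longrightarrow> c * ball_ratio k y r \<le> ball_translate k r y x"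
proof -
  obtain c where c: "c > 0" "\<And>\<delta>. \<delta> > 0 \<Longrightarrow> \<delta> \<le> 1 \<Longrightarrow> c * \<delta> powr (k + 1/2) \<le> measure (angle_measure k) {t. 1 - t < \<delta>}"
    using angle_tail_ge by blast
  define d where "d = min 1 (c * (3/8) powr (k + 1/2))"
  have w: "2 * k + 1 > 0" using k by simp
  have "d * ball_ratio k y r \<le> ball_translate k r y x" if r: "r > 0" and xy: "\<bar>x - y\<bar> < r / 2" for r y x
  proof (cases "x * y \<le> 0")
    case True
    have "AE t in angle_measure k. t \<in> {t. x\<^sup>2 + y\<^sup>2 - 2 * x * y * t < r\<^sup>2}"
      using AE_angle[OF k]
    proof eventually_elim
      case (elim t)
      have "- (x * y) * t \<le> - (x * y) * 1" using True elim by (intro mult_left_mono) auto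
      hence "x\<^sup>2 + y\<^sup>2 - 2 * x * y * t \<le> (x - y)\<^sup>2" by (simp add: power2_diff)
      also have "\<dots> = \<bar>x - y\<bar>\<^sup>2" by simp
      also have "\<dots> < r\<^sup>2" using xy r by (intro power_strict_mono) auto
      finally show ?case by simp
    qed
    hence "ball_translate k r y x = 1"
      unfolding ball_translate_def by (subst angle.prob_eq_1) auto
    moreover have "ball_ratio k y r \<le> 1"
      unfolding ball_ratio_def using r w by (intro powr_le1) auto
    hence "d * ball_ratio k y r \<le> 1 * 1"
      using c by (intro mult_mono) (auto simp: d_def ball_ratio_nonneg)
    ultimately show ?thesis by simp
  next
    case False
    define \<delta> where "\<delta> = 3/8 * (r / (\<bar>y\<bar> + r))\<^sup>2"
    have q: "r / (\<bar>y\<bar> + r) > 0" "r / (\<bar>y\<bar> + r) \<le> 1" using r by auto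
    have \<delta>: "\<delta> > 0" "\<delta> \<le> 1" unfolding \<delta>_def using q power_le_one[of "r / (\<bar>y\<bar> + r)" 2] by auto
    have pos: "x * y > 0" using False by simp
    have "x * y \<le> (\<bar>y\<bar> + r)\<^sup>2"
    proof -
      have "\<bar>x\<bar> \<le> \<bar>y\<bar> + r" using xy by linarith
      hence "\<bar>x\<bar> * \<bar>y\<bar> \<le> (\<bar>y\<bar> + r) * (\<bar>y\<bar> + r)" using r by (intro mult_mono) auto
      thus ?thesis using pos by (simp add: power2_eq_square flip: abs_mult)
    qed
    have "ball_ratio k y r = ((r / (\<bar>y\<bar> + r))\<^sup>2) powr (k + 1/2)"
      unfolding ball_ratio_def using q by (simp add: powr_powr algebra_simps flip: powr_numeral)
    hence "c * (3/8) powr (k + 1/2) * ball_ratio k y r = c * \<delta> powr (k + 1/2)"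
      unfolding \<delta>_def by (subst powr_mult) auto
    moreover have "d * ball_ratio k y r \<le> c * (3/8) powr (k + 1/2) * ball_ratio k y r"
      by (intro mult_right_mono) (auto simp: d_def ball_ratio_nonneg)
    ultimately have "d * ball_ratio k y r \<le> measure (angle_measure k) {t. 1 - t < \<delta>}"
      using c(2)[OF \<delta>] by linarith
    also have "\<dots> \<le> ball_translate k r y x"
      unfolding ball_translate_def
    proof (rule angle.finite_measure_mono)
      show "{t. 1 - t < \<delta>} \<subseteq> {t. x\<^sup>2 + y\<^sup>2 - 2 * x * y * t < r\<^sup>2}"
      proof (intro subsetI CollectI; drule CollectD)
        fix t assume t: "1 - t < \<delta>"
        have "2 * (x * y) * (1 - t) \<le> 2 * (x * y) * \<delta>" using t pos by (intro mult_left_mono) auto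
        also have "\<dots> \<le> 2 * (\<bar>y\<bar> + r)\<^sup>2 * \<delta>" using \<open>x * y \<le> (\<bar>y\<bar> + r)\<^sup>2\<close> \<delta> by (intro mult_right_mono) auto
        also have "\<dots> = 3/4 * r\<^sup>2" using r by (simp add: \<delta>_def power_divide field_simps)
        finally have "2 * (x * y) * (1 - t) \<le> 3/4 * r\<^sup>2" .
        moreover have "(x - y)\<^sup>2 < 1/4 * r\<^sup>2"
        proof -
          have "\<bar>x - y\<bar>\<^sup>2 < (r / 2)\<^sup>2" using xy by (intro power_strict_mono) auto
          thus ?thesis by (simp add: power_divide)
        qed
        moreover have "x\<^sup>2 + y\<^sup>2 - 2 * x * y * t = (x - y)\<^sup>2 + 2 * (x * y) * (1 - t)"
          by (simp add: power2_eq_square algebra_simps)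
        ultimately show "x\<^sup>2 + y\<^sup>2 - 2 * x * y * t < r\<^sup>2" by linarith
      qed
    qed measurable
    finally show ?thesis .
  qed
  moreover have "d > 0" using c by (simp add: d_def)
  ultimately show ?thesis by blast
qed

section \<open>Volumes\<close>

lemma nn_integral_dunkl_reflect:
  assumes [measurable]: "h \<in> borel_measurable borel"
  shows "(\<integral>\<^sup>+x. h (- x) \<partial>dunkl_measure k) = (\<integral>\<^sup>+x. h x \<partial>dunkl_measure k)"
proof -
  have "(\<integral>\<^sup>+x. ennreal (dunkl_density k x) * h x \<partial>lborel) = (\<integral>\<^sup>+x. ennreal (dunkl_density k (0 + (-1) * x)) * h (0 + (-1) * x) \<partial>lborel)"
    by (subst nn_integral_real_affine[of _ "-1" 0]) auto
  also have "\<dots> = (\<integral>\<^sup>+x. ennreal (dunkl_density k x) * h (- x) \<partial>lborel)"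
    by (simp add: dunkl_density_def)
  finally show ?thesis using k by (simp add: nn_integral_dunkl)
qed

lemma emeasure_annulus_le:
  "\<exists>C>0. \<forall>r>0. \<forall>y. emeasure (dunkl_measure k) (annulus y r) \<le> ennreal (C * annulus_vol k y r)"
proof -
  define c0 where "c0 = 1 / (2 powr (k + 1) * Gamma (k + 1))"
  have c0: "c0 > 0" unfolding c0_def using k by (simp add: Gamma_real_pos)
  have "emeasure (dunkl_measure k) (annulus y r) \<le> ennreal (4 * c0 * annulus_vol k y r)" if r: "r > 0" for r y
  proof -
    have "emeasure (dunkl_measure k) (annulus y r) = (\<integral>\<^sup>+x. ennreal (dunkl_density k x) * indicator (annulus y r) x \<partial>lborel)"
      unfolding dunkl_measure_eq by (rule emeasure_density) auto
    also have "\<dots> \<le> (\<integral>\<^sup>+x. ennreal (c0 * (\<bar>y\<bar> + r) powr (2 * k + 1)) * indicator (annulus y r) x \<partial>lborel)"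
    proof (rule nn_integral_mono)
      fix x
      show "ennreal (dunkl_density k x) * indicator (annulus y r) x \<le> ennreal (c0 * (\<bar>y\<bar> + r) powr (2 * k + 1)) * indicator (annulus y r) x"
      proof (cases "x \<in> annulus y r")
        case True
        hence "\<bar>x\<bar> \<le> \<bar>y\<bar> + r" by (simp add: annulus_def)
        hence "\<bar>x\<bar> powr (2 * k + 1) \<le> (\<bar>y\<bar> + r) powr (2 * k + 1)" using k by (intro powr_mono2) auto
        hence "c0 * \<bar>x\<bar> powr (2 * k + 1) \<le> c0 * (\<bar>y\<bar> + r) powr (2 * k + 1)" using c0 by (intro mult_left_mono) auto
        thus ?thesis using True by (simp add: dunkl_density_def c0_def ennreal_leI)
      qed auto
    qed
    also have "\<dots> = ennreal (c0 * (\<bar>y\<bar> + r) powr (2 * k + 1)) * emeasure lborel (annulus y r)"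
      by (rule nn_integral_cmult_indicator) auto
    also have "emeasure lborel (annulus y r) \<le> ennreal (2 * r) + ennreal (2 * r)"
      unfolding annulus_eq by (rule order_trans[OF emeasure_subadditive]) (use r in auto)
    also have "ennreal (c0 * (\<bar>y\<bar> + r) powr (2 * k + 1)) * (ennreal (2 * r) + ennreal (2 * r)) = ennreal (4 * c0 * annulus_vol k y r)"
    proof -
      have "ennreal (2 * r) + ennreal (2 * r) = ennreal (4 * r)" using r by (subst ennreal_plus[symmetric]) auto
      thus ?thesis using r c0 by (simp add: annulus_vol_def mult_ac flip: ennreal_mult)
    qed
    finally show ?thesis by (simp add: mult_left_mono)
  qed
  thus ?thesis using c0 by (intro exI[of _ "4 * c0"]) auto
qed

text \<open>
  The annulus contains the interval from \<open>|y| + r/2\<close> to \<open>|y| + r\<close>, where the density is at least that at \<open>r/2\<close>.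
\<close>
lemma emeasure_annulus_ge:
  "\<exists>c>0. \<forall>r>0. \<forall>y. ennreal (c * r powr (2 * k + 2)) \<le> emeasure (dunkl_measure k) (annulus y r)"
proof -
  define c0 where "c0 = 1 / (2 powr (k + 1) * Gamma (k + 1))"
  have c0: "c0 > 0" unfolding c0_def using k by (simp add: Gamma_real_pos)
  define c where "c = c0 * (1/2) powr (2 * k + 1) / 2"
  have "ennreal (c * r powr (2 * k + 2)) \<le> emeasure (dunkl_measure k) (annulus y r)" if r: "r > 0" for r y
  proof -
    let ?J = "{\<bar>y\<bar> + r / 2<..<\<bar>y\<bar> + r}"
    have "r powr (2 * k + 2) = r powr (2 * k + 1) * r powr 1" unfolding powr_add[symmetric] by (simp add: add.commute)
    hence "c * r powr (2 * k + 2) = c0 * (r / 2) powr (2 * k + 1) * (r / 2)"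
      using r by (simp add: c_def powr_divide)
    hence "ennreal (c * r powr (2 * k + 2)) = ennreal (c0 * (r / 2) powr (2 * k + 1)) * ennreal (r / 2)"
      using r c0 by (simp only: ennreal_mult[symmetric] mult_nonneg_nonneg powr_ge_zero less_imp_le)
    also have "ennreal (r / 2) = emeasure lborel ?J"
      using r by simp
    also have "ennreal (c0 * (r / 2) powr (2 * k + 1)) * \<dots> = (\<integral>\<^sup>+x. ennreal (c0 * (r / 2) powr (2 * k + 1)) * indicator ?J x \<partial>lborel)"
      by (rule nn_integral_cmult_indicator[symmetric]) auto
    also have "\<dots> \<le> (\<integral>\<^sup>+x. ennreal (dunkl_density k x) * indicator (annulus y r) x \<partial>lborel)"
    proof (rule nn_integral_mono)
      fix x
      show "ennreal (c0 * (r / 2) powr (2 * k + 1)) * indicator ?J x \<le> ennreal (dunkl_density k x) * indicator (annulus y r) x"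
      proof (cases "x \<in> ?J")
        case True
        hence x: "x \<in> annulus y r" "r / 2 \<le> \<bar>x\<bar>" using r by (auto simp: annulus_def)
        hence "(r / 2) powr (2 * k + 1) \<le> \<bar>x\<bar> powr (2 * k + 1)" using k r by (intro powr_mono2) auto
        hence "c0 * (r / 2) powr (2 * k + 1) \<le> c0 * \<bar>x\<bar> powr (2 * k + 1)" using c0 by (intro mult_left_mono) auto
        thus ?thesis using True x by (simp add: dunkl_density_def c0_def ennreal_leI)
      qed auto
    qed
    also have "\<dots> = emeasure (dunkl_measure k) (annulus y r)"
      unfolding dunkl_measure_eq by (rule emeasure_density[symmetric]) auto
    finally show ?thesis .
  qed
  thus ?thesis using c0 by (intro exI[of _ c]) (auto simp: c_def)
qed

text \<open>
  Homogeneity of the density under dilations.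
\<close>
lemma measure_centred_ball:
  "\<exists>b>0. \<forall>r>0. measure (dunkl_measure k) (centred_ball r) = b * r powr (2 * k + 2)"
proof -
  obtain C where C: "\<And>r y. r > 0 \<Longrightarrow> emeasure (dunkl_measure k) (annulus y r) \<le> ennreal (C * annulus_vol k y r)"
    using emeasure_annulus_le by blast
  obtain c where c: "c > 0" "\<And>r y. r > 0 \<Longrightarrow> ennreal (c * r powr (2 * k + 2)) \<le> emeasure (dunkl_measure k) (annulus y r)"
    using emeasure_annulus_ge by blast
  have ann: "annulus 0 r = centred_ball r" for r by (auto simp: annulus_def)
  define b where "b = measure (dunkl_measure k) (centred_ball 1)"
  have fin: "emeasure (dunkl_measure k) (centred_ball r) < \<infinity>" if "r > 0" for r
    using C[OF that, of 0] unfolding ann by (rule le_less_trans) simp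
  have eb: "emeasure (dunkl_measure k) (centred_ball 1) = ennreal b"
    unfolding b_def using fin[of 1] by (intro emeasure_eq_ennreal_measure) auto
  have "b > 0"
  proof -
    have "ennreal c \<le> ennreal b" using c(2)[of 1 0] unfolding ann eb by simp
    thus ?thesis using c(1) by (cases "b \<ge> 0") (auto simp: ennreal_le_iff2)
  qed
  moreover have "measure (dunkl_measure k) (centred_ball r) = b * r powr (2 * k + 2)" if r: "r > 0" for r
  proof -
    have "emeasure (dunkl_measure k) (centred_ball r) = (\<integral>\<^sup>+x. ennreal (dunkl_density k x) * indicator (centred_ball r) x \<partial>lborel)"
      unfolding dunkl_measure_eq by (rule emeasure_density) auto
    also have "\<dots> = ennreal r * (\<integral>\<^sup>+x. ennreal (dunkl_density k (0 + r * x)) * indicator (centred_ball r) (0 + r * x) \<partial>lborel)"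
      using r by (subst nn_integral_real_affine[of _ r 0]) auto
    also have "(\<integral>\<^sup>+x. ennreal (dunkl_density k (0 + r * x)) * indicator (centred_ball r) (0 + r * x) \<partial>lborel) =
       (\<integral>\<^sup>+x. ennreal (r powr (2 * k + 1)) * (ennreal (dunkl_density k x) * indicator (centred_ball 1) x) \<partial>lborel)"
    proof (rule nn_integral_cong)
      fix x
      have "dunkl_density k (0 + r * x) = r powr (2 * k + 1) * dunkl_density k x"
        using r by (simp add: dunkl_density_def abs_mult powr_mult)
      moreover have "indicator (centred_ball r) (0 + r * x) = (indicator (centred_ball 1) x :: ennreal)"
      proof -
        have "(- r < r * x) = (-1 < x)" "(r * x < r) = (x < 1)"
          using r mult_less_cancel_left_pos[of r "-1" x] mult_less_cancel_left_pos[of r x 1] by auto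
        thus ?thesis by (simp add: indicator_def)
      qed
      ultimately show "ennreal (dunkl_density k (0 + r * x)) * indicator (centred_ball r) (0 + r * x) = ennreal (r powr (2 * k + 1)) * (ennreal (dunkl_density k x) * indicator (centred_ball 1) x)"
        by (simp add: ennreal_mult' mult.assoc)
    qed
    also have "\<dots> = ennreal (r powr (2 * k + 1)) * (\<integral>\<^sup>+x. ennreal (dunkl_density k x) * indicator (centred_ball 1) x \<partial>lborel)"
      by (rule nn_integral_cmult) auto
    also have "(\<integral>\<^sup>+x. ennreal (dunkl_density k x) * indicator (centred_ball 1) x \<partial>lborel) = emeasure (dunkl_measure k) (centred_ball 1)"
      unfolding dunkl_measure_eq by (rule emeasure_density[symmetric]) auto
    also have "ennreal r * (ennreal (r powr (2 * k + 1)) * emeasure (dunkl_measure k) (centred_ball 1)) = ennreal (b * r powr (2 * k + 2))"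
    proof -
      have "r powr (2 * k + 2) = r powr (2 * k + 1) * r powr 1" unfolding powr_add[symmetric] by (simp add: add.commute)
      thus ?thesis unfolding eb using r \<open>b > 0\<close> by (simp add: mult_ac flip: ennreal_mult)
    qed
    finally show ?thesis using \<open>b > 0\<close> by (simp add: measure_def)
  qed
  ultimately show ?thesis by blast
qed

end

section \<open>Powers on the extended half-line\<close>

lemma ennreal_rpow_ennreal [simp]: "x \<ge> 0 \<Longrightarrow> ennreal_rpow (ennreal x) a = ennreal (x powr a)"
  by (simp add: ennreal_rpow_def)

lemma ennreal_rpow_0 [simp]: "ennreal_rpow 0 a = 0"
  by (simp add: ennreal_rpow_def)

lemma ennreal_rpow_top [simp]: "ennreal_rpow \<infinity> a = \<infinity>" "ennreal_rpow top a = top"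
  by (simp_all add: ennreal_rpow_def)

lemma ennreal_rpow_measurable [measurable]: "(\<lambda>x. ennreal_rpow x a) \<in> borel_measurable borel"
  unfolding ennreal_rpow_def by measurable

lemma ennreal_rpow_mono:
  assumes "a > 0" "x \<le> y"
  shows "ennreal_rpow x a \<le> ennreal_rpow y a"
proof (cases y)
  case (real v)
  then obtain u where "x = ennreal u" "u \<ge> 0" "u \<le> v"
    using assms(2) by (cases x) (auto simp: top_unique)
  thus ?thesis using real assms by (simp add: ennreal_leI powr_mono2)
qed simp

lemma ennreal_rpow_mult:
  assumes "c > 0"
  shows "ennreal_rpow (ennreal c * x) a = ennreal (c powr a) * ennreal_rpow x a"
proof (cases x)
  case (real u)
  thus ?thesis using assms by (simp add: powr_mult flip: ennreal_mult)
next
  case top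
  thus ?thesis using assms by (simp add: ennreal_mult_top)
qed

lemma ennreal_rpow_rpow:
  assumes "a > 0"
  shows "ennreal_rpow (ennreal_rpow x a) b = ennreal_rpow x (a * b)"
  by (cases x) (use assms in \<open>auto simp: powr_powr\<close>)

lemma ennreal_rpow_1 [simp]: "ennreal_rpow x 1 = x"
  by (cases x) auto

lemma ennreal_rpow_max: "a > 0 \<Longrightarrow> ennreal_rpow (max x y) a \<le> ennreal_rpow x a + ennreal_rpow y a"
  by (cases "x \<le> y") (auto simp: max_def)

lemma ennreal_rpow_le_iff:
  assumes "a > 0" "K \<ge> 0" "ennreal_rpow x a \<le> ennreal (K powr a)"
  shows "x \<le> ennreal K"
proof (cases x)
  case (real u)
  hence "u powr a \<le> K powr a" using assms by simp
  hence "u \<le> K" using assms real powr_less_mono2[of a K u] by (meson not_le)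
  thus ?thesis using real by (simp add: ennreal_leI)
qed (use assms in \<open>simp add: top_unique\<close>)

section \<open>Annular averages\<close>

definition annulus_integral :: "real \<Rightarrow> (real \<Rightarrow> ennreal) \<Rightarrow> real \<Rightarrow> real \<Rightarrow> ennreal" where
  "annulus_integral k F r y = (\<integral>\<^sup>+x. F x * indicator (annulus y r) x \<partial>dunkl_measure k)"

text \<open>
  The integral over the annulus times the height of the translate; it dominates \<open>smoothed_integral\<close> and is easier
  to compare at different centres and radii.
\<close>
definition annulus_avg :: "real \<Rightarrow> (real \<Rightarrow> ennreal) \<Rightarrow> real \<Rightarrow> real \<Rightarrow> ennreal" where
  "annulus_avg k F r y = ennreal (ball_ratio k y r) * annulus_integral k F r y"

text \<open>
  The integral of \<open>F\<close> against the translate of the indicator of \<open>B(0,r)\<close>, which the amalgam norms and the maximal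
  operators are made of.
\<close>
definition smoothed_integral :: "real \<Rightarrow> (real \<Rightarrow> ennreal) \<Rightarrow> real \<Rightarrow> real \<Rightarrow> ennreal" where
  "smoothed_integral k F r y = (\<integral>\<^sup>+x. F x * ennreal (ball_translate k r y x) \<partial>dunkl_measure k)"

lemma ball_ratio_pos: "r > 0 \<Longrightarrow> ball_ratio k y r > 0"
  by (simp add: ball_ratio_def)

lemma annulus_subset:
  assumes "x \<in> annulus y r" and "r + s \<le> R"
  shows "annulus x s \<subseteq> annulus y R"
proof
  fix z assume "z \<in> annulus x s"
  moreover have "\<bar>Z - Y\<bar> \<le> \<bar>Z - X\<bar> + \<bar>X - Y\<bar>" for X Y Z :: real by linarith
  from this[of "\<bar>z\<bar>" "\<bar>y\<bar>" "\<bar>x\<bar>"] assms calculation show "z \<in> annulus y R"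
    unfolding annulus_def mem_Collect_eq by linarith
qed

lemma annulus_commute: "x \<in> annulus y r \<longleftrightarrow> y \<in> annulus x r"
  by (simp add: annulus_def abs_minus_commute)

lemma annulus_integral_mono_set:
  "annulus x s \<subseteq> annulus y r \<Longrightarrow> annulus_integral k F s x \<le> annulus_integral k F r y"
  unfolding annulus_integral_def
  by (intro nn_integral_mono) (auto simp: indicator_def)

context
  fixes k :: real
  assumes k: "k > - 1 / 2"
begin

interpretation dunkl: sigma_finite_measure "dunkl_measure k"
  by (rule sigma_finite_dunkl)

declare ball_translate_measurable[OF k, measurable]

lemma annulus_integral_measurable:
  assumes [measurable]: "F \<in> borel_measurable borel"
  shows "annulus_integral k F r \<in> borel_measurable borel"
  unfolding annulus_integral_def annulus_def indicator_def by measurable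

lemma annulus_avg_measurable:
  assumes [measurable]: "F \<in> borel_measurable borel"
  shows "annulus_avg k F r \<in> borel_measurable borel"
  using annulus_integral_measurable[OF assms] unfolding annulus_avg_def ball_ratio_def by measurable

lemma smoothed_integral_measurable:
  assumes [measurable]: "F \<in> borel_measurable borel"
  shows "smoothed_integral k F r \<in> borel_measurable borel"
  unfolding smoothed_integral_def by measurable

lemma smoothed_integral_le_avg:
  "\<exists>C>0. \<forall>F \<in> borel_measurable borel. \<forall>r>0. \<forall>y. smoothed_integral k F r y \<le> ennreal C * annulus_avg k F r y"
proof -
  obtain C where C: "C > 0" "\<And>r y x. r > 0 \<Longrightarrow> ball_translate k r y x \<le> C * ball_ratio k y r"
    using ball_translate_le[OF k] by blast
  have "smoothed_integral k F r y \<le> ennreal C * annulus_avg k F r y" if [measurable]: "F \<in> borel_measurable borel" and r: "r > 0" for F r y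
  proof -
    have "smoothed_integral k F r y \<le> (\<integral>\<^sup>+x. ennreal (C * ball_ratio k y r) * (F x * indicator (annulus y r) x) \<partial>dunkl_measure k)"
      unfolding smoothed_integral_def
    proof (rule nn_integral_mono)
      fix x
      show "F x * ennreal (ball_translate k r y x) \<le> ennreal (C * ball_ratio k y r) * (F x * indicator (annulus y r) x)"
      proof (cases "ball_translate k r y x = 0")
        case False
        hence "x \<in> annulus y r" using ball_translate_support[OF k r] by (auto simp: annulus_def)
        thus ?thesis using C(2)[OF r, of y x] by (simp add: mult.commute[of "F x"] mult_right_mono ennreal_leI)
      qed simp
    qed
    also have "\<dots> = ennreal (C * ball_ratio k y r) * annulus_integral k F r y"
      unfolding annulus_integral_def by (rule nn_integral_cmult) measurable
    finally show ?thesis using C(1) by (simp add: annulus_avg_def ennreal_mult' mult.assoc)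
  qed
  with C(1) show ?thesis by blast
qed

text \<open>
  The annulus is the union of intervals around \<open>y\<close> and \<open>-y\<close>, and each is seen by the translate centred there. A
  converse bound by the translate at \<open>y\<close> alone fails, because that translate hardly charges the interval around \<open>-y\<close>.
\<close>
lemma avg_le_smoothed_integral:
  "\<exists>C>0. \<forall>F \<in> borel_measurable borel. \<forall>r>0. \<forall>y.
     annulus_avg k F r y \<le> ennreal C * max (smoothed_integral k F (2 * r) y) (smoothed_integral k F (2 * r) (- y))"
proof -
  obtain c where c: "c > 0" "\<And>r y x. r > 0 \<Longrightarrow> \<bar>x - y\<bar> < r / 2 \<Longrightarrow> c * ball_ratio k y r \<le> ball_translate k r y x"
    using ball_translate_ge[OF k] by blast
  have "annulus_avg k F r y \<le> ennreal (2 / c) * max (smoothed_integral k F (2 * r) y) (smoothed_integral k F (2 * r) (- y))"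
    if [measurable]: "F \<in> borel_measurable borel" and r: "r > 0" for F r y
  proof -
    have T: "ennreal (ball_ratio k y r) * indicator (annulus y r) x \<le> ennreal (1 / c) * (ennreal (ball_translate k (2 * r) y x) + ennreal (ball_translate k (2 * r) (- y) x))" for x
    proof (cases "x \<in> annulus y r")
      case True
      have br: "ball_ratio k y r \<le> ball_ratio k y (2 * r)" "ball_ratio k (- y) (2 * r) = ball_ratio k y (2 * r)"
        using ball_ratio_mono[OF k r, of "2 * r"] r by (simp_all add: ball_ratio_def)
      have "\<bar>x - y\<bar> < (2 * r) / 2 \<or> \<bar>x - (- y)\<bar> < (2 * r) / 2"
        using True unfolding annulus_eq by auto
      hence "c * ball_ratio k y (2 * r) \<le> ball_translate k (2 * r) y x + ball_translate k (2 * r) (- y) x"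
      proof
        assume "\<bar>x - y\<bar> < (2 * r) / 2"
        from c(2)[OF _ this] r ball_translate_01(1)[OF k, of "2 * r" "- y" x] show ?thesis by simp
      next
        assume "\<bar>x - (- y)\<bar> < (2 * r) / 2"
        from c(2)[OF _ this] r ball_translate_01(1)[OF k, of "2 * r" y x] br(2) show ?thesis by simp
      qed
      hence "c * ball_ratio k y r \<le> ball_translate k (2 * r) y x + ball_translate k (2 * r) (- y) x"
        using mult_left_mono[OF br(1), of c] c(1) by linarith
      hence "ball_ratio k y r \<le> 1 / c * (ball_translate k (2 * r) y x + ball_translate k (2 * r) (- y) x)"
        using c(1) by (simp add: field_simps)
      hence "ennreal (ball_ratio k y r) \<le> ennreal (1 / c * (ball_translate k (2 * r) y x + ball_translate k (2 * r) (- y) x))"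
        by (rule ennreal_leI)
      also have "\<dots> = ennreal (1 / c) * (ennreal (ball_translate k (2 * r) y x) + ennreal (ball_translate k (2 * r) (- y) x))"
        using c(1) ball_translate_01(1)[OF k] by (subst ennreal_mult) auto
      finally show ?thesis using True by simp
    qed simp
    have "annulus_avg k F r y = (\<integral>\<^sup>+x. ennreal (ball_ratio k y r) * (F x * indicator (annulus y r) x) \<partial>dunkl_measure k)"
      unfolding annulus_avg_def annulus_integral_def by (rule nn_integral_cmult[symmetric]) measurable
    also have "\<dots> \<le> (\<integral>\<^sup>+x. ennreal (1 / c) * (F x * ennreal (ball_translate k (2 * r) y x) + F x * ennreal (ball_translate k (2 * r) (- y) x)) \<partial>dunkl_measure k)"
    proof (rule nn_integral_mono)
      fix x
      from mult_left_mono[OF T[of x], of "F x"]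
      show "ennreal (ball_ratio k y r) * (F x * indicator (annulus y r) x) \<le> ennreal (1 / c) * (F x * ennreal (ball_translate k (2 * r) y x) + F x * ennreal (ball_translate k (2 * r) (- y) x))"
        by (simp add: mult_ac distrib_left)
    qed
    also have "\<dots> = ennreal (1 / c) * (smoothed_integral k F (2 * r) y + smoothed_integral k F (2 * r) (- y))"
    proof -
      have [measurable]: "ball_translate k (2 * r) z \<in> borel_measurable borel" for z
        using measurable_Pair2[OF ball_translate_measurable[OF k, of "2 * r"], of z] by simp
      show ?thesis unfolding smoothed_integral_def
        by (subst nn_integral_cmult, measurable) (subst nn_integral_add, measurable)
    qed
    also have "\<dots> \<le> ennreal (1 / c) * (2 * max (smoothed_integral k F (2 * r) y) (smoothed_integral k F (2 * r) (- y)))"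
      unfolding mult_2 by (rule mult_left_mono[OF add_mono]) simp_all
    also have "\<dots> = ennreal (2 / c) * max (smoothed_integral k F (2 * r) y) (smoothed_integral k F (2 * r) (- y))"
    proof -
      have "ennreal (2 / c) = ennreal (1 / c) * 2"
        using c(1) ennreal_mult[of "1 / c" 2] by simp
      thus ?thesis by (simp only: mult.assoc)
    qed
    finally show ?thesis .
  qed
  moreover have "2 / c > 0" using c by simp
  ultimately show ?thesis by blast
qed

text \<open>
  The reflected term of the pointwise bound has the same \<open>L\<^sup>p\<close> norm, because \<open>\<mu>\<close> is even.
\<close>
lemma avg_Lp_le:
  assumes p: "p > 0"
  shows "\<exists>C>0. \<forall>F \<in> borel_measurable borel. \<forall>r>0.
     (\<integral>\<^sup>+y. ennreal_rpow (annulus_avg k F r y) p \<partial>dunkl_measure k) \<le>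
       ennreal C * (\<integral>\<^sup>+y. ennreal_rpow (smoothed_integral k F (2 * r) y) p \<partial>dunkl_measure k)"
proof -
  obtain C where C: "C > 0" "\<And>F r y. F \<in> borel_measurable borel \<Longrightarrow> r > 0 \<Longrightarrow>
     annulus_avg k F r y \<le> ennreal C * max (smoothed_integral k F (2 * r) y) (smoothed_integral k F (2 * r) (- y))"
    using avg_le_smoothed_integral by blast
  have "(\<integral>\<^sup>+y. ennreal_rpow (annulus_avg k F r y) p \<partial>dunkl_measure k) \<le>
       ennreal (C powr p * 2) * (\<integral>\<^sup>+y. ennreal_rpow (smoothed_integral k F (2 * r) y) p \<partial>dunkl_measure k)"
    if F[measurable]: "F \<in> borel_measurable borel" and r: "r > 0" for F r
  proof -
    let ?A = "\<lambda>y. ennreal_rpow (smoothed_integral k F (2 * r) y) p"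
    have [measurable]: "smoothed_integral k F (2 * r) \<in> borel_measurable borel" by (rule smoothed_integral_measurable[OF F])
    have "(\<integral>\<^sup>+y. ennreal_rpow (annulus_avg k F r y) p \<partial>dunkl_measure k) \<le> (\<integral>\<^sup>+y. ennreal (C powr p) * (?A y + ?A (- y)) \<partial>dunkl_measure k)"
    proof (rule nn_integral_mono)
      fix y
      have "ennreal_rpow (annulus_avg k F r y) p \<le> ennreal_rpow (ennreal C * max (smoothed_integral k F (2 * r) y) (smoothed_integral k F (2 * r) (- y))) p"
        by (rule ennreal_rpow_mono[OF p C(2)[OF F r]])
      also have "\<dots> \<le> ennreal (C powr p) * (?A y + ?A (- y))"
        unfolding ennreal_rpow_mult[OF C(1)] by (intro mult_left_mono ennreal_rpow_max p) auto
      finally show "ennreal_rpow (annulus_avg k F r y) p \<le> ennreal (C powr p) * (?A y + ?A (- y))" .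
    qed
    also have "\<dots> = ennreal (C powr p) * ((\<integral>\<^sup>+y. ?A y \<partial>dunkl_measure k) + (\<integral>\<^sup>+y. ?A (- y) \<partial>dunkl_measure k))"
      by (subst nn_integral_cmult, measurable) (subst nn_integral_add, measurable)
    also have "(\<integral>\<^sup>+y. ?A (- y) \<partial>dunkl_measure k) = (\<integral>\<^sup>+y. ?A y \<partial>dunkl_measure k)"
      by (rule nn_integral_dunkl_reflect[OF k]) measurable
    also have "ennreal (C powr p) * ((\<integral>\<^sup>+y. ?A y \<partial>dunkl_measure k) + (\<integral>\<^sup>+y. ?A y \<partial>dunkl_measure k)) = ennreal (C powr p * 2) * (\<integral>\<^sup>+y. ?A y \<partial>dunkl_measure k)"
      using ennreal_mult[of "C powr p" 2] by (simp add: mult_2[symmetric] mult.assoc)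
    finally show ?thesis .
  qed
  moreover have "C powr p * 2 > 0" using C by simp
  ultimately show ?thesis by blast
qed

text \<open>
  For \<open>z\<close> in the annulus around \<open>y\<close> the average at \<open>(y,r)\<close> is dominated by the one at \<open>(z,2r)\<close>. Integrating the
  \<open>p\<close>-th powers over \<open>z\<close> bounds the average at every single point by its \<open>L\<^sup>p\<close> norm.
\<close>
lemma annulus_avg_pointwise:
  assumes p: "p > 0"
  shows "\<exists>C>0. \<forall>F \<in> borel_measurable borel. \<forall>r>0. \<forall>y.
     ennreal (r powr (2 * k + 2)) * ennreal_rpow (annulus_avg k F r y) p \<le>
       ennreal C * (\<integral>\<^sup>+z. ennreal_rpow (annulus_avg k F (2 * r) z) p \<partial>dunkl_measure k)"
proof -
  obtain c where c: "c > 0" "\<And>r y. r > 0 \<Longrightarrow> ennreal (c * r powr (2 * k + 2)) \<le> emeasure (dunkl_measure k) (annulus y r)"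
    using emeasure_annulus_ge[OF k] by blast
  define D where "D = 3 powr (2 * k + 1)"
  have D: "D > 0" by (simp add: D_def)
  have "ennreal (r powr (2 * k + 2)) * ennreal_rpow (annulus_avg k F r y) p \<le>
       ennreal (D powr p / c) * (\<integral>\<^sup>+z. ennreal_rpow (annulus_avg k F (2 * r) z) p \<partial>dunkl_measure k)"
    if F[measurable]: "F \<in> borel_measurable borel" and r: "r > 0" for F r y
  proof -
    let ?g = "ennreal_rpow (annulus_avg k F r y) p"
    let ?G = "\<lambda>z. ennreal_rpow (annulus_avg k F (2 * r) z) p"
    have [measurable]: "annulus_avg k F (2 * r) \<in> borel_measurable borel" by (rule annulus_avg_measurable[OF F])
    have le: "?g \<le> ennreal (D powr p) * ?G z" if z: "z \<in> annulus y r" for z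
    proof -
      have "r / (\<bar>y\<bar> + r) \<le> 3 * (2 * r / (\<bar>z\<bar> + 2 * r))"
      proof -
        have "\<bar>z\<bar> + 2 * r \<le> 6 * (\<bar>y\<bar> + r)" using z r by (auto simp: annulus_def)
        moreover have "\<bar>z\<bar> + 2 * r > 0" "\<bar>y\<bar> + r > 0" using r by auto
        ultimately have "6 * r / (6 * (\<bar>y\<bar> + r)) \<le> 6 * r / (\<bar>z\<bar> + 2 * r)"
          using r by (intro divide_left_mono mult_pos_pos) auto
        also have "6 * r / (6 * (\<bar>y\<bar> + r)) = r / (\<bar>y\<bar> + r)" by (rule mult_divide_mult_cancel_left) simp
        finally show ?thesis by simp
      qed
      hence "ball_ratio k y r \<le> (3 * (2 * r / (\<bar>z\<bar> + 2 * r))) powr (2 * k + 1)"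
        unfolding ball_ratio_def using r k by (intro powr_mono2) auto
      also have "\<dots> = D * ball_ratio k z (2 * r)" unfolding D_def ball_ratio_def by (rule powr_mult)
      finally have "ennreal (ball_ratio k y r) \<le> ennreal D * ennreal (ball_ratio k z (2 * r))"
        using D by (simp add: ball_ratio_nonneg ennreal_leI flip: ennreal_mult)
      moreover have "annulus_integral k F r y \<le> annulus_integral k F (2 * r) z"
        using z by (intro annulus_integral_mono_set annulus_subset[of _ _ r]) (auto simp: annulus_commute)
      ultimately have "annulus_avg k F r y \<le> ennreal D * annulus_avg k F (2 * r) z"
        unfolding annulus_avg_def mult.assoc[symmetric] by (rule mult_mono) auto
      thus ?thesis using ennreal_rpow_mono[OF p] ennreal_rpow_mult[OF D] by metis
    qed
    have "ennreal (c * r powr (2 * k + 2)) * ?g \<le> emeasure (dunkl_measure k) (annulus y r) * ?g"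
      by (intro mult_right_mono c r) auto
    also have "\<dots> = (\<integral>\<^sup>+z. ?g * indicator (annulus y r) z \<partial>dunkl_measure k)"
      by (subst nn_integral_cmult_indicator) (auto simp: mult.commute)
    also have "\<dots> \<le> (\<integral>\<^sup>+z. ennreal (D powr p) * ?G z \<partial>dunkl_measure k)"
      by (rule nn_integral_mono) (use le in \<open>auto simp: indicator_def\<close>)
    also have "\<dots> = ennreal (D powr p) * (\<integral>\<^sup>+z. ?G z \<partial>dunkl_measure k)"
      by (rule nn_integral_cmult) measurable
    finally have "ennreal (1 / c) * (ennreal (c * r powr (2 * k + 2)) * ?g) \<le> ennreal (1 / c) * (ennreal (D powr p) * (\<integral>\<^sup>+z. ?G z \<partial>dunkl_measure k))"
      by (rule mult_left_mono) simp
    moreover have "ennreal (1 / c) * (ennreal (c * r powr (2 * k + 2)) * ?g) = ennreal (r powr (2 * k + 2)) * ?g"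
      using c(1) by (simp add: mult.assoc[symmetric] ennreal_mult[symmetric])
    moreover have "ennreal (1 / c) * (ennreal (D powr p) * (\<integral>\<^sup>+z. ?G z \<partial>dunkl_measure k)) = ennreal (D powr p / c) * (\<integral>\<^sup>+z. ?G z \<partial>dunkl_measure k)"
      using c(1) by (simp add: mult.assoc[symmetric] ennreal_mult[symmetric])
    ultimately show ?thesis by simp
  qed
  moreover have "D powr p / c > 0" using D c by simp
  ultimately show ?thesis by blast
qed

section \<open>Weak type estimate for the annular maximal function\<close>

lemma annulus_vol_scale: "r > 0 \<Longrightarrow> t \<ge> 1 \<Longrightarrow> annulus_vol k y (t * r) \<le> t powr (2 * k + 2) * annulus_vol k y r"
proof -
  assume r: "r > 0" and t: "t \<ge> 1"
  have "(\<bar>y\<bar> + t * r) powr (2 * k + 1) \<le> (t * (\<bar>y\<bar> + r)) powr (2 * k + 1)"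
    using r t k mult_right_mono[OF t, of "\<bar>y\<bar>"] by (intro powr_mono2) (auto simp: distrib_left)
  also have "\<dots> = t powr (2 * k + 1) * (\<bar>y\<bar> + r) powr (2 * k + 1)" by (rule powr_mult)
  finally have "t * r * (\<bar>y\<bar> + t * r) powr (2 * k + 1) \<le> t * r * (t powr (2 * k + 1) * (\<bar>y\<bar> + r) powr (2 * k + 1))"
    using r t by (intro mult_left_mono) auto
  moreover have "t powr (2 * k + 2) = t powr (2 * k + 1) * t powr 1"
    unfolding powr_add[symmetric] by (simp add: add.commute)
  ultimately show ?thesis using t by (simp add: annulus_vol_def mult_ac)
qed

text \<open>
  Vitali's covering argument on the line, applied to the intervals of radius \<open>s\<close> around \<open>|x|\<close>: a disjoint
  subfamily, enlarged five times, still covers the set, and the volumes are doubling. The radii are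
  bounded because \<open>annulus_vol\<close> tends to infinity with the radius while the integral of \<open>g\<close> is finite. The covering set is produced
  explicitly because the set to be covered need not be measurable.
\<close>
lemma annular_weak_type:
  "\<exists>C>0. \<forall>g \<in> borel_measurable borel. \<forall>lev>0. \<exists>B\<in>sets borel.
     {x. \<exists>s>0. ennreal (lev * annulus_vol k x s) < annulus_integral k g s x} \<subseteq> B \<and>
     emeasure (dunkl_measure k) B \<le> ennreal (C / lev) * (\<integral>\<^sup>+x. g x \<partial>dunkl_measure k)"
proof -
  obtain C where C: "C > 0" "\<And>r y. r > 0 \<Longrightarrow> emeasure (dunkl_measure k) (annulus y r) \<le> ennreal (C * annulus_vol k y r)"
    using emeasure_annulus_le[OF k] by blast
  define D where "D = C * 5 powr (2 * k + 2)"
  have D: "D > 0" using C by (simp add: D_def)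
  have "\<exists>B\<in>sets borel.
     {x. \<exists>s>0. ennreal (lev * annulus_vol k x s) < annulus_integral k g s x} \<subseteq> B \<and>
     emeasure (dunkl_measure k) B \<le> ennreal (D / lev) * (\<integral>\<^sup>+x. g x \<partial>dunkl_measure k)"
    if g[measurable]: "g \<in> borel_measurable borel" and lev: "lev > 0" for g lev
  proof (cases "(\<integral>\<^sup>+x. g x \<partial>dunkl_measure k) = \<infinity>")
    case True
    thus ?thesis using D lev by (intro bexI[of _ UNIV]) (auto simp: ennreal_mult_top)
  next
    case False
    then obtain I where I: "(\<integral>\<^sup>+x. g x \<partial>dunkl_measure k) = ennreal I" "I \<ge> 0"
      by (metis ennreal_cases infinity_ennreal_def)
    define E where "E = {x. \<exists>s>0. ennreal (lev * annulus_vol k x s) < annulus_integral k g s x}"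
    have "\<exists>s. \<forall>x\<in>E. s x > 0 \<and> ennreal (lev * annulus_vol k x (s x)) < annulus_integral k g (s x) x"
      unfolding E_def by (intro bchoice) auto
    then obtain s where s: "\<And>x. x \<in> E \<Longrightarrow> s x > 0"
      "\<And>x. x \<in> E \<Longrightarrow> ennreal (lev * annulus_vol k x (s x)) < annulus_integral k g (s x) x" by blast
    have bd: "s x \<le> (I / lev) powr (1 / (2 * k + 2))" if x: "x \<in> E" for x
    proof -
      have "ennreal (lev * annulus_vol k x (s x)) \<le> ennreal I"
        unfolding I(1)[symmetric] using s(2)[OF x]
        by (rule less_imp_le[THEN order_trans]) (auto simp: annulus_integral_def indicator_def intro!: nn_integral_mono)
      hence 1: "lev * annulus_vol k x (s x) \<le> I" using I by simp
      have "s x powr (2 * k + 2) = s x powr (2 * k + 1) * s x powr 1"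
        unfolding powr_add[symmetric] by (simp add: add.commute)
      also have "\<dots> \<le> (\<bar>x\<bar> + s x) powr (2 * k + 1) * s x"
        using s(1)[OF x] k by (simp, intro powr_mono2) auto
      finally have "s x powr (2 * k + 2) \<le> annulus_vol k x (s x)" by (simp add: annulus_vol_def mult.commute)
      hence "lev * s x powr (2 * k + 2) \<le> I" using 1 lev mult_left_mono[of "s x powr (2 * k + 2)" "annulus_vol k x (s x)" lev] by linarith
      hence "s x powr (2 * k + 2) \<le> I / lev" using lev by (simp add: field_simps)
      hence "(s x powr (2 * k + 2)) powr (1 / (2 * k + 2)) \<le> (I / lev) powr (1 / (2 * k + 2))"
        using k by (intro powr_mono2) auto
      thus ?thesis using s(1)[OF x] k by (simp add: powr_powr)
    qed
    obtain K where K: "countable K" "K \<subseteq> E"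
      "pairwise (\<lambda>i j. disjnt (cball \<bar>i\<bar> (s i)) (cball \<bar>j\<bar> (s j))) K"
      "\<And>i. i \<in> E \<Longrightarrow> \<exists>j. j \<in> K \<and> \<not> disjnt (cball \<bar>i\<bar> (s i)) (cball \<bar>j\<bar> (s j)) \<and> cball \<bar>i\<bar> (s i) \<subseteq> ball \<bar>j\<bar> (5 * s j)"
    proof (rule Vitali_covering_lemma_cballs_balls[of E s "(I / lev) powr (1 / (2 * k + 2))" abs])
      show "0 < s i \<and> s i \<le> (I / lev) powr (1 / (2 * k + 2))" if "i \<in> E" for i using s(1) bd that by auto
    qed blast
    define B where "B = (\<Union>j\<in>K. annulus j (5 * s j))"
    have B[measurable]: "B \<in> sets borel" unfolding B_def using K(1) by (intro sets.countable_UN') auto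
    have "E \<subseteq> B"
    proof
      fix x assume x: "x \<in> E"
      then obtain j where j: "j \<in> K" "cball \<bar>x\<bar> (s x) \<subseteq> ball \<bar>j\<bar> (5 * s j)" using K(4) by blast
      have "\<bar>x\<bar> \<in> cball \<bar>x\<bar> (s x)" using s(1)[OF x] by simp
      hence "\<bar>x\<bar> \<in> ball \<bar>j\<bar> (5 * s j)" using j by blast
      hence "x \<in> annulus j (5 * s j)" by (simp add: annulus_def dist_real_def abs_minus_commute)
      thus "x \<in> B" using j by (auto simp: B_def)
    qed
    moreover have "emeasure (dunkl_measure k) B \<le> ennreal (D / lev) * ennreal I"
    proof -
      have "emeasure (dunkl_measure k) B = (\<integral>\<^sup>+x. indicator B x \<partial>dunkl_measure k)" by simp
      also have "\<dots> \<le> (\<integral>\<^sup>+x. (\<integral>\<^sup>+j. indicator (annulus j (5 * s j)) x \<partial>count_space K) \<partial>dunkl_measure k)"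
      proof (rule nn_integral_mono)
        fix x
        show "(indicator B x :: ennreal) \<le> (\<integral>\<^sup>+j. indicator (annulus j (5 * s j)) x \<partial>count_space K)"
        proof (cases "x \<in> B")
          case True
          then obtain j where j: "j \<in> K" "x \<in> annulus j (5 * s j)" by (auto simp: B_def)
          have "(indicator B x :: ennreal) = (\<integral>\<^sup>+i. indicator {j} i \<partial>count_space K)"
            using True j by (simp add: one_ennreal_def[symmetric])
          also have "\<dots> \<le> (\<integral>\<^sup>+j. indicator (annulus j (5 * s j)) x \<partial>count_space K)"
            using j by (intro nn_integral_mono) (auto simp: indicator_def)
          finally show ?thesis .
        qed simp
      qed
      also have "\<dots> = (\<integral>\<^sup>+j. (\<integral>\<^sup>+x. indicator (annulus j (5 * s j)) x \<partial>dunkl_measure k) \<partial>count_space K)"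
        by (rule nn_integral_count_space_nn_integral[OF K(1)]) simp
      also have "\<dots> \<le> (\<integral>\<^sup>+j. ennreal (D / lev) * annulus_integral k g (s j) j \<partial>count_space K)"
      proof (rule nn_integral_mono)
        fix j assume "j \<in> space (count_space K)"
        hence j: "j \<in> E" using K(2) by auto
        have "(\<integral>\<^sup>+x. indicator (annulus j (5 * s j)) x \<partial>dunkl_measure k) \<le> ennreal (C * annulus_vol k j (5 * s j))"
          using C(2)[of "5 * s j" j] s(1)[OF j] by simp
        also have "\<dots> \<le> ennreal (C * (5 powr (2 * k + 2) * annulus_vol k j (s j)))"
          using C(1) s(1)[OF j] by (intro ennreal_leI mult_left_mono annulus_vol_scale) auto
        also have "\<dots> = ennreal (D / lev) * ennreal (lev * annulus_vol k j (s j))"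
          using lev D annulus_vol_pos[OF s(1)[OF j], of k j] by (simp add: D_def mult_ac flip: ennreal_mult)
        also have "\<dots> \<le> ennreal (D / lev) * annulus_integral k g (s j) j"
          using s(2)[OF j] by (intro mult_left_mono) auto
        finally show "(\<integral>\<^sup>+x. indicator (annulus j (5 * s j)) x \<partial>dunkl_measure k) \<le> ennreal (D / lev) * annulus_integral k g (s j) j" .
      qed
      also have "\<dots> = ennreal (D / lev) * (\<integral>\<^sup>+j. annulus_integral k g (s j) j \<partial>count_space K)"
        by (rule nn_integral_cmult) simp
      also have "(\<integral>\<^sup>+j. annulus_integral k g (s j) j \<partial>count_space K) = (\<integral>\<^sup>+x. (\<integral>\<^sup>+j. g x * indicator (annulus j (s j)) x \<partial>count_space K) \<partial>dunkl_measure k)"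
        unfolding annulus_integral_def
        by (rule nn_integral_count_space_nn_integral[OF K(1), symmetric]) measurable
      also have "\<dots> \<le> (\<integral>\<^sup>+x. g x \<partial>dunkl_measure k)"
      proof (rule nn_integral_mono)
        fix x
        show "(\<integral>\<^sup>+j. g x * indicator (annulus j (s j)) x \<partial>count_space K) \<le> g x"
        proof (cases "\<exists>j\<in>K. x \<in> annulus j (s j)")
          case True
          then obtain j where j: "j \<in> K" "x \<in> annulus j (s j)" by blast
          have inb: "\<bar>x\<bar> \<in> cball \<bar>i\<bar> (s i)" if "x \<in> annulus i (s i)" for i
            using that by (simp add: annulus_def dist_real_def abs_minus_commute)
          have "x \<notin> annulus i (s i)" if "i \<in> K" "i \<noteq> j" for i
            using K(3) that j inb[of i] inb[of j] unfolding pairwise_def disjnt_def by blast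
          hence "(\<integral>\<^sup>+j. g x * indicator (annulus j (s j)) x \<partial>count_space K) \<le> (\<integral>\<^sup>+i. g x * indicator {j} i \<partial>count_space K)"
            by (intro nn_integral_mono) (auto simp: indicator_def)
          also have "\<dots> = g x" using j by (subst nn_integral_cmult_indicator) (auto simp: one_ennreal_def[symmetric])
          finally show ?thesis .
        next
          case False
          hence "(\<integral>\<^sup>+j. g x * indicator (annulus j (s j)) x \<partial>count_space K) = (\<integral>\<^sup>+j. 0 \<partial>count_space K)"
            by (intro nn_integral_cong) (auto simp: indicator_def)
          thus ?thesis by simp
        qed
      qed
      finally show ?thesis unfolding I(1) by (simp add: mult_left_mono)
    qed
    ultimately show ?thesis using B unfolding E_def I(1) by blast
  qed
  with D show ?thesis by blast
qed

end

section \<open>Weak norms and dyadic majorants\<close>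

text \<open>
  The right-hand side is the value of \<open>t s^(1/q)\<close> at the level \<open>t\<close> where \<open>t^(-q) \<Psi> = s\<close>; measurable covers of the
  level sets suffice for an upper bound.
\<close>
lemma weak_Lp_norm_le:
  assumes q: "q > 0"
    and cov: "\<And>t. t > 0 \<Longrightarrow> \<exists>B\<in>sets borel. {x. ennreal t < W x} \<subseteq> B \<and> emeasure (dunkl_measure k) B \<le> ennreal (t powr (- q)) * \<Psi>"
  shows "weak_Lp_norm k q W \<le> ennreal_rpow \<Psi> (1 / q)"
  unfolding weak_Lp_norm_def
proof (rule SUP_least)
  fix s :: real assume "s \<in> {0<..}"
  hence s: "s > 0" by simp
  have dist: "distribution_fun k W t \<le> ennreal (t powr (- q)) * \<Psi>" if t: "t > 0" for t
  proof -
    obtain B where B: "B \<in> sets borel" "{x. ennreal t < W x} \<subseteq> B" "emeasure (dunkl_measure k) B \<le> ennreal (t powr (- q)) * \<Psi>"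
      using cov[OF t] by blast
    have "distribution_fun k W t \<le> emeasure (dunkl_measure k) B"
      unfolding distribution_fun_def by (rule emeasure_mono) (use B in auto)
    thus ?thesis using B(3) by (rule order_trans)
  qed
  have rear: "decreasing_rearrangement k W s \<le> ennreal t" if "t > 0" "ennreal (t powr (- q)) * \<Psi> \<le> ennreal s" for t
    unfolding decreasing_rearrangement_def
    by (rule INF_lower) (use that order_trans[OF dist[OF that(1)] that(2)] in auto)
  show "ennreal (s powr (1 / q)) * decreasing_rearrangement k W s \<le> ennreal_rpow \<Psi> (1 / q)"
  proof (cases \<Psi>)
    case (real P)
    show ?thesis
    proof (cases "P = 0")
      case True
      hence "decreasing_rearrangement k W s \<le> ennreal t" if "t > 0" for t
        using rear[OF that] real by simp
      hence "decreasing_rearrangement k W s \<le> 0"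
        using ennreal_le_epsilon[of 0 "decreasing_rearrangement k W s"] by simp
      thus ?thesis by simp
    next
      case False
      hence P: "P > 0" using real by simp
      define t where "t = (P / s) powr (1 / q)"
      have t: "t > 0" using P s by (simp add: t_def)
      have "t powr (- q) * P = s"
        using P s q by (simp add: t_def powr_powr powr_minus field_simps)
      hence "ennreal (t powr (- q)) * \<Psi> \<le> ennreal s"
        using real P by (simp flip: ennreal_mult)
      hence "ennreal (s powr (1 / q)) * decreasing_rearrangement k W s \<le> ennreal (s powr (1 / q)) * ennreal t"
        by (intro mult_left_mono rear t) auto
      also have "\<dots> = ennreal (P powr (1 / q))"
        using s P by (simp add: t_def powr_divide flip: ennreal_mult)
      finally show ?thesis using real by simp
    qed
  qed simp
qed

lemma annulus_integral_eq_avg: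
  assumes "r > 0"
  shows "annulus_integral k F r y = ennreal (1 / ball_ratio k y r) * annulus_avg k F r y"
proof -
  have "ball_ratio k y r > 0" using assms by (simp add: ball_ratio_def)
  thus ?thesis by (simp add: annulus_avg_def mult.assoc[symmetric] ennreal_mult[symmetric])
qed

context
  fixes k :: real
  assumes k: "k > - 1 / 2"
begin

text \<open>
  The local weak type estimate. A point \<open>x\<close> of the annulus of radius \<open>r\<close> can have a large average for two reasons.
  If the radius \<open>s\<close> is below \<open>r\<close>, only the values of \<open>F\<close> within distance \<open>2r\<close> matter, and the weak type estimate
  applies to this part. If \<open>s \<ge> r\<close>, the average is dominated by the one around \<open>y\<close> at a dyadic radius
  \<open>2^j r\<close>, \<open>j \<ge> 1\<close>, hence by \<open>H\<close>; this happens only if \<open>H\<close> exceeds a multiple of the level, and then the whole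
  annulus is an admissible cover.
\<close>
lemma annular_cover:
  "\<exists>C>0. \<forall>F \<in> borel_measurable borel. \<forall>r>0. \<forall>y. \<forall>lev>0. \<forall>H.
     (\<forall>j. annulus_avg k F (2 ^ Suc j * r) y \<le> ennreal ((2 ^ Suc j * r) powr (2 * k + 2)) * H) \<longrightarrow>
     (\<exists>B\<in>sets borel. {x \<in> annulus y r. \<exists>s>0. ennreal (lev * s powr (2 * k + 2)) < annulus_avg k F s x} \<subseteq> B \<and>
        emeasure (dunkl_measure k) B \<le> ennreal (C / lev * annulus_vol k y r) * H)"
proof -
  obtain C1 where C1: "C1 > 0" "\<And>g lev. g \<in> borel_measurable borel \<Longrightarrow> lev > 0 \<Longrightarrow> \<exists>B\<in>sets borel.
     {x. \<exists>s>0. ennreal (lev * annulus_vol k x s) < annulus_integral k g s x} \<subseteq> B \<and>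
     emeasure (dunkl_measure k) B \<le> ennreal (C1 / lev) * (\<integral>\<^sup>+x. g x \<partial>dunkl_measure k)"
    using annular_weak_type[OF k] by blast
  obtain C2 where C2: "C2 > 0" "\<And>r y. r > 0 \<Longrightarrow> emeasure (dunkl_measure k) (annulus y r) \<le> ennreal (C2 * annulus_vol k y r)"
    using emeasure_annulus_le[OF k] by blast
  define c4 where "c4 = 4 * 5 powr (2 * k + 1)"
  have c4: "c4 > 0" by (simp add: c4_def)
  define C where "C = max (C1 * 2 powr (2 * k + 2)) (C2 * c4)"
  have C: "C > 0" using C1(1) by (simp add: C_def less_max_iff_disj)
  have "\<exists>B\<in>sets borel. {x \<in> annulus y r. \<exists>s>0. ennreal (lev * s powr (2 * k + 2)) < annulus_avg k F s x} \<subseteq> B \<and>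
        emeasure (dunkl_measure k) B \<le> ennreal (C / lev * annulus_vol k y r) * H"
    if F[measurable]: "F \<in> borel_measurable borel" and r: "r > 0" and lev: "lev > 0"
    and H: "\<And>j. annulus_avg k F (2 ^ Suc j * r) y \<le> ennreal ((2 ^ Suc j * r) powr (2 * k + 2)) * H"
    for F r y lev H
  proof -
    have V: "annulus_vol k y r > 0" by (rule annulus_vol_pos[OF r])
    have N: "annulus_integral k F (2 ^ Suc j * r) y \<le> ennreal (annulus_vol k y (2 ^ Suc j * r)) * H" for j
    proof -
      let ?s = "2 ^ Suc j * r"
      have s: "?s > 0" using r by simp
      have br: "ball_ratio k y ?s > 0" by (rule ball_ratio_pos[OF s])
      have "annulus_integral k F ?s y \<le> ennreal (1 / ball_ratio k y ?s) * (ennreal (?s powr (2 * k + 2)) * H)"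
        unfolding annulus_integral_eq_avg[OF s, of k F y] by (rule mult_left_mono[OF H]) simp
      also have "\<dots> = ennreal (annulus_vol k y ?s) * H"
        unfolding ball_ratio_vol[OF s, symmetric, of k y] using br annulus_vol_pos[OF s, of k y]
        by (simp add: mult.assoc[symmetric] ennreal_mult[symmetric])
      finally show ?thesis .
    qed
    let ?D = "{x \<in> annulus y r. \<exists>s>0. ennreal (lev * s powr (2 * k + 2)) < annulus_avg k F s x}"
    show ?thesis
    proof (cases "H \<le> ennreal (lev / c4)")
      case True
      let ?g = "\<lambda>x. F x * indicator (annulus y (2 * r)) x"
      obtain B where B: "B \<in> sets borel" "{x. \<exists>s>0. ennreal (lev * annulus_vol k x s) < annulus_integral k ?g s x} \<subseteq> B"
        "emeasure (dunkl_measure k) B \<le> ennreal (C1 / lev) * (\<integral>\<^sup>+x. ?g x \<partial>dunkl_measure k)"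
        using C1(2)[of ?g lev] lev by auto
      have "?D \<subseteq> B"
      proof
        fix x assume "x \<in> ?D"
        then obtain s where x: "x \<in> annulus y r" and s: "s > 0" and G: "ennreal (lev * s powr (2 * k + 2)) < annulus_avg k F s x" by auto
        have br: "ball_ratio k x s > 0" using s by (simp add: ball_ratio_def)
        have vx: "annulus_vol k x s > 0" by (rule annulus_vol_pos[OF s])
        have big: "ennreal (lev * annulus_vol k x s) < annulus_integral k F s x"
        proof (rule ccontr)
          assume "\<not> ?thesis"
          hence "annulus_avg k F s x \<le> ennreal (ball_ratio k x s) * ennreal (lev * annulus_vol k x s)"
            unfolding annulus_avg_def by (intro mult_left_mono) auto
          also have "\<dots> = ennreal (lev * s powr (2 * k + 2))"
            unfolding ball_ratio_vol[OF s, symmetric, of k x] using br vx lev by (simp add: mult_ac flip: ennreal_mult)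
          finally show False using G by simp
        qed
        have "s < r"
        proof (rule ccontr)
          assume "\<not> s < r"
          hence sr: "s \<ge> r" by simp
          have "\<exists>n::nat. 2 * s \<le> 2 ^ n * r"
          proof -
            obtain n where "2 * s / r < 2 ^ n" using real_arch_pow[of 2 "2 * s / r"] by auto
            thus ?thesis using r by (intro exI[of _ n]) (simp add: field_simps)
          qed
          \<comment> \<open>The least such \<open>n\<close> gives a dyadic radius between \<open>2s\<close> and \<open>4s\<close>, and \<open>n \<ge> 1\<close> since \<open>s \<ge> r\<close>.\<close>
          then obtain n where n: "2 * s \<le> 2 ^ n * r" "\<And>m. m < n \<Longrightarrow> \<not> 2 * s \<le> 2 ^ m * r"
            using exists_least_iff[of "\<lambda>n. 2 * s \<le> 2 ^ n * r"] by blast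
          have "n \<noteq> 0" using n(1) sr r by (cases n) auto
          then obtain j where j: "n = Suc j" by (cases n) auto
          let ?R = "2 ^ Suc j * r"
          have "2 ^ j * r < 2 * s" using n(2)[of j] by (simp add: j not_le)
          moreover have "?R = 2 * (2 ^ j * r)" by simp
          ultimately have R: "2 * s \<le> ?R" "?R \<le> 4 * s" using n(1) unfolding j by linarith+
          have "annulus_integral k F s x \<le> annulus_integral k F ?R y"
          proof (rule annulus_integral_mono_set)
            show "annulus x s \<subseteq> annulus y ?R"
              using x sr R(1) by (intro annulus_subset[of _ _ r]) auto
          qed
          also have "\<dots> \<le> ennreal (annulus_vol k y ?R) * H" by (rule N)
          also have "\<dots> \<le> ennreal (c4 * annulus_vol k x s) * ennreal (lev / c4)"
          proof (intro mult_mono True ennreal_leI)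
            have "\<bar>y\<bar> < \<bar>x\<bar> + r" using x unfolding annulus_def mem_Collect_eq by linarith
            moreover have "Y + R \<le> 5 * (X + s)" if "Y < X + r" "R \<le> 4 * s" "0 \<le> X" for X Y R
              using that sr by argo
            ultimately have "\<bar>y\<bar> + ?R \<le> 5 * (\<bar>x\<bar> + s)" using R(2) abs_ge_zero[of x] by blast
            hence "(\<bar>y\<bar> + ?R) powr (2 * k + 1) \<le> (5 * (\<bar>x\<bar> + s)) powr (2 * k + 1)"
              using k r by (intro powr_mono2) auto
            also have "\<dots> = 5 powr (2 * k + 1) * (\<bar>x\<bar> + s) powr (2 * k + 1)" by (rule powr_mult)
            finally have "?R * (\<bar>y\<bar> + ?R) powr (2 * k + 1) \<le> (4 * s) * (5 powr (2 * k + 1) * (\<bar>x\<bar> + s) powr (2 * k + 1))"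
              by (rule mult_mono[OF R(2)]) (use s in auto)
            thus "annulus_vol k y ?R \<le> c4 * annulus_vol k x s"
              by (simp add: annulus_vol_def c4_def mult_ac)
          qed auto
          also have "\<dots> = ennreal (lev * annulus_vol k x s)"
            using c4 vx lev by (simp flip: ennreal_mult)
          finally show False using big by simp
        qed
        have "annulus_integral k ?g s x = annulus_integral k F s x"
          unfolding annulus_integral_def
        proof (rule nn_integral_cong)
          fix z
          have "z \<in> annulus x s \<Longrightarrow> z \<in> annulus y (2 * r)"
            using annulus_subset[OF x, of s "2 * r"] \<open>s < r\<close> by auto
          thus "F z * indicator (annulus y (2 * r)) z * indicator (annulus x s) z = F z * indicator (annulus x s) z"
            by (auto simp: indicator_def)
        qed
        hence "ennreal (lev * annulus_vol k x s) < annulus_integral k ?g s x" using big by (simp only:)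
        thus "x \<in> B" using B(2) s by blast
      qed
      moreover have "emeasure (dunkl_measure k) B \<le> ennreal (C / lev * annulus_vol k y r) * H"
      proof -
        have "(\<integral>\<^sup>+x. ?g x \<partial>dunkl_measure k) \<le> ennreal (annulus_vol k y (2 * r)) * H"
          using N[of 0] by (simp add: annulus_integral_def)
        also have "\<dots> \<le> ennreal (2 powr (2 * k + 2) * annulus_vol k y r) * H"
          using r by (intro mult_right_mono ennreal_leI annulus_vol_scale[OF k]) auto
        finally have "emeasure (dunkl_measure k) B \<le> ennreal (C1 / lev) * (ennreal (2 powr (2 * k + 2) * annulus_vol k y r) * H)"
          using B(3) by (meson mult_left_mono order_trans zero_le)
        also have "\<dots> = ennreal (C1 * 2 powr (2 * k + 2) / lev * annulus_vol k y r) * H"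
          using C1(1) lev V by (simp add: mult.assoc[symmetric] ennreal_mult[symmetric])
        also have "\<dots> \<le> ennreal (C / lev * annulus_vol k y r) * H"
          using V lev by (intro mult_right_mono ennreal_leI divide_right_mono) (auto simp: C_def)
        finally show ?thesis .
      qed
      ultimately show ?thesis using B(1) by blast
    next
      case False
      have "emeasure (dunkl_measure k) (annulus y r) \<le> ennreal (C2 * annulus_vol k y r)" by (rule C2(2)[OF r])
      also have "\<dots> = ennreal (C2 * c4 / lev * annulus_vol k y r) * ennreal (lev / c4)"
        using C2(1) c4 lev V by (simp flip: ennreal_mult)
      also have "\<dots> \<le> ennreal (C / lev * annulus_vol k y r) * H"
        using False V lev by (intro mult_mono ennreal_leI mult_right_mono divide_right_mono) (auto simp: C_def)
      finally show ?thesis by (intro bexI[of _ "annulus y r"]) auto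
    qed
  qed
  with C show ?thesis by blast
qed

text \<open>
  The supremum of the dyadic averages is replaced by an \<open>l\<^sup>p\<close> sum, so that its \<open>p\<close>-th power can be integrated term by
  term; the terms decay geometrically because \<open>\<kappa> > 0\<close>.
\<close>
lemma dyadic_majorant:
  assumes p: "p > 0" and \<kappa>: "\<kappa> > 0" and F[measurable]: "F \<in> borel_measurable borel" and D: "D \<ge> 0" and r: "r > 0"
    and I: "\<And>s. s > 0 \<Longrightarrow> (\<integral>\<^sup>+y. ennreal_rpow (annulus_avg k F s y) p \<partial>dunkl_measure k) \<le> ennreal (D * s powr ((2 * k + 2) * p - \<kappa>))"
  shows "\<exists>Hp \<in> borel_measurable borel.
     (\<forall>y j. annulus_avg k F (2 ^ Suc j * r) y \<le> ennreal ((2 ^ Suc j * r) powr (2 * k + 2)) * ennreal_rpow (Hp y) (1 / p)) \<and>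
     (\<integral>\<^sup>+y. Hp y \<partial>dunkl_measure k) \<le> ennreal (D * r powr (- \<kappa>) * (\<Sum>j. (2 powr (- \<kappa>)) ^ Suc j))"
proof -
  define d where "d = 2 * k + 2"
  define s where "s j = 2 ^ Suc j * r" for j
  have s: "s j > 0" for j using r by (simp add: s_def)
  define u where "u j y = ennreal_rpow (ennreal (s j powr (- d)) * annulus_avg k F (s j) y) p" for j y
  have [measurable]: "annulus_avg k F (s j) \<in> borel_measurable borel" for j
    by (rule annulus_avg_measurable[OF k F])
  have um[measurable]: "u j \<in> borel_measurable borel" for j unfolding u_def by measurable
  define Hp where "Hp y = (\<Sum>j. u j y)" for y
  have [measurable]: "Hp \<in> borel_measurable borel" unfolding Hp_def by measurable
  have "annulus_avg k F (s j) y \<le> ennreal (s j powr d) * ennreal_rpow (Hp y) (1 / p)" for y j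
  proof -
    have "u j y \<le> Hp y"
      unfolding Hp_def using sum_le_suminf[of "\<lambda>j. u j y" "{j}"] by simp
    hence "ennreal_rpow (u j y) (1 / p) \<le> ennreal_rpow (Hp y) (1 / p)"
      using p by (intro ennreal_rpow_mono) auto
    hence "ennreal (s j powr (- d)) * annulus_avg k F (s j) y \<le> ennreal_rpow (Hp y) (1 / p)"
      unfolding u_def ennreal_rpow_rpow[OF p] using p by simp
    hence "ennreal (s j powr d) * (ennreal (s j powr (- d)) * annulus_avg k F (s j) y) \<le> ennreal (s j powr d) * ennreal_rpow (Hp y) (1 / p)"
      by (rule mult_left_mono) simp
    moreover have "ennreal (s j powr d) * ennreal (s j powr (- d)) = 1"
      using s[of j] by (simp flip: ennreal_mult powr_add)
    ultimately show ?thesis by (simp add: mult.assoc[symmetric])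
  qed
  moreover have "(\<integral>\<^sup>+y. Hp y \<partial>dunkl_measure k) \<le> ennreal (D * r powr (- \<kappa>) * (\<Sum>j. (2 powr (- \<kappa>)) ^ Suc j))"
  proof -
    have "(\<integral>\<^sup>+y. Hp y \<partial>dunkl_measure k) = (\<Sum>j. \<integral>\<^sup>+y. u j y \<partial>dunkl_measure k)"
      unfolding Hp_def by (rule nn_integral_suminf) measurable
    also have "\<dots> \<le> (\<Sum>j. ennreal (D * r powr (- \<kappa>) * (2 powr (- \<kappa>)) ^ Suc j))"
    proof (rule suminf_le)
      fix j
      have c: "s j powr (- d) > 0" using s[of j] by simp
      have "(\<integral>\<^sup>+y. u j y \<partial>dunkl_measure k) = ennreal ((s j powr (- d)) powr p) * (\<integral>\<^sup>+y. ennreal_rpow (annulus_avg k F (s j) y) p \<partial>dunkl_measure k)"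
        unfolding u_def ennreal_rpow_mult[OF c] by (rule nn_integral_cmult) measurable
      also have "\<dots> \<le> ennreal ((s j powr (- d)) powr p) * ennreal (D * s j powr (d * p - \<kappa>))"
        using I[OF s[of j]] by (intro mult_left_mono) (auto simp: d_def)
      also have "\<dots> = ennreal (D * ((s j powr (- d)) powr p * s j powr (d * p - \<kappa>)))"
        using D by (simp add: mult_ac flip: ennreal_mult)
      also have "(s j powr (- d)) powr p * s j powr (d * p - \<kappa>) = s j powr (- \<kappa>)"
        by (simp add: powr_powr flip: powr_add)
      also have "s j powr (- \<kappa>) = r powr (- \<kappa>) * (2 powr (- \<kappa>)) ^ Suc j"
      proof -
        have "s j powr (- \<kappa>) = (2 ^ Suc j) powr (- \<kappa>) * r powr (- \<kappa>)" unfolding s_def by (rule powr_mult)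
        also have "(2 ^ Suc j :: real) powr (- \<kappa>) = (2 powr (- \<kappa>)) ^ Suc j"
        proof -
          have "(2 ^ Suc j :: real) powr (- \<kappa>) = (2 powr real (Suc j)) powr (- \<kappa>)"
            by (subst powr_realpow) auto
          also have "\<dots> = (2 powr (- \<kappa>)) powr real (Suc j)"
            unfolding powr_powr by (simp only: mult.commute)
          also have "\<dots> = (2 powr (- \<kappa>)) ^ Suc j" by (rule powr_realpow) simp
          finally show ?thesis .
        qed
        finally show ?thesis by simp
      qed
      finally show "(\<integral>\<^sup>+y. u j y \<partial>dunkl_measure k) \<le> ennreal (D * r powr (- \<kappa>) * (2 powr (- \<kappa>)) ^ Suc j)"
        by (simp add: mult.assoc)
    qed auto
    also have "\<dots> = ennreal (\<Sum>j. D * r powr (- \<kappa>) * (2 powr (- \<kappa>)) ^ Suc j)"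
    proof (rule suminf_ennreal2)
      have "2 powr (- \<kappa>) < (1::real)" using \<kappa> by (simp add: powr_less_one)
      hence "summable (\<lambda>j. (2 powr (- \<kappa>)) ^ j)" by (intro summable_geometric) simp
      hence "summable (\<lambda>j. (2 powr (- \<kappa>)) ^ Suc j)" by (simp only: summable_Suc_iff)
      thus "summable (\<lambda>j. D * r powr (- \<kappa>) * (2 powr (- \<kappa>)) ^ Suc j)" by (rule summable_mult)
    qed (use D in auto)
    also have "(\<Sum>j. D * r powr (- \<kappa>) * (2 powr (- \<kappa>)) ^ Suc j) = D * r powr (- \<kappa>) * (\<Sum>j. (2 powr (- \<kappa>)) ^ Suc j)"
    proof (rule suminf_mult)
      have "2 powr (- \<kappa>) < (1::real)" using \<kappa> by (simp add: powr_less_one)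
      hence "summable (\<lambda>j. (2 powr (- \<kappa>)) ^ j)" by (intro summable_geometric) simp
      thus "summable (\<lambda>j. (2 powr (- \<kappa>)) ^ Suc j)" by (simp only: summable_Suc_iff)
    qed
    finally show ?thesis .
  qed
  ultimately show ?thesis
    unfolding s_def d_def by (intro bexI[of _ Hp]) auto
qed

lemma ball_integral_translate_eq:
  assumes "r > 0"
  shows "ball_integral_translate k r (\<lambda>x. cmod (f x)) y = smoothed_integral k (\<lambda>x. ennreal (cmod (f x))) r y"
  unfolding ball_integral_translate_def smoothed_integral_def
proof (rule nn_integral_cong_AE)
  show "AE x in dunkl_measure k. ennreal (cmod (f x) * translated_ball k r y x) = ennreal (cmod (f x)) * ennreal (ball_translate k r y x)"
    using translated_ball_AE[OF k assms, of y]
    by eventually_elim (simp add: ennreal_mult ball_translate_01[OF k])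
qed

end

section \<open>The fractional maximal operator\<close>

theorem corollary1p4:
  fixes k \<alpha> p \<beta> \<alpha>s pbar qbar :: real
  assumes "k > - 1 / 2"
    and "1 < \<alpha>" and "\<alpha> < p"
    and "0 < \<beta>" and "\<beta> < (2 * k + 2) / \<alpha>"
    and "1 / \<alpha>s = 1 / \<alpha> - \<beta> / (2 * k + 2)"
    and "1 / pbar = 1 / p * (1 - \<alpha> * \<beta> / (2 * k + 2))"
    and "1 / qbar = 1 - \<alpha> * \<beta> / (2 * k + 2)"
  shows "\<exists>C::real. C \<ge> 0 \<and>
    (\<forall>f \<in> amalgam_space k 1 p \<alpha>.
       weak_amalgam_norm k qbar pbar \<alpha>s (fractional_maximal k \<beta> f)
         \<le> ennreal C * amalgam_norm k 1 p \<alpha> f)"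
proof -
  have k: "k > - 1 / 2" by fact
  define d where "d = 2 * k + 2"
  define a where "a = \<alpha> * \<beta> / d"
  define e where "e = 1 / \<alpha> - 1 - 1 / p"
  define \<kappa> where "\<kappa> = d * p * (1 / \<alpha> - 1 / p)"
  have d: "d > 1" using k by (simp add: d_def)
  have al: "\<alpha> > 0" and p: "p > 0" using assms by auto
  have "\<alpha> * \<beta> < d" using assms(5) al by (simp add: d_def field_simps)
  hence a: "0 < a" "a < 1"
    using assms(4) al d by (simp_all add: a_def)
  have b1: "\<beta> = d * a / \<alpha>" using al d by (simp add: a_def)
  have q1: "1 / qbar = 1 - a" using assms(8) by (simp add: a_def d_def)
  have p1: "1 / pbar = (1 - a) / p" using assms(7) by (simp add: a_def d_def)
  have q: "qbar > 0" using q1 a by (smt (verit) divide_less_0_1_iff divide_eq_0_iff)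
  have qq: "qbar * (1 - a) = 1" unfolding q1[symmetric] using q by simp
  have pb: "pbar > 0" using p1 a p by (smt (verit) divide_pos_pos divide_less_0_1_iff divide_eq_0_iff)
  have pq: "1 / qbar * pbar = p"
    unfolding q1 using p1 pb p by (simp add: field_simps)
  have s1: "1 / \<alpha>s - 1 / qbar - 1 / pbar = (1 - a) * e"
    unfolding q1 p1 assms(6) d_def[symmetric] b1 e_def using d al p by (simp add: field_simps)
  have kap: "\<kappa> > 0" unfolding \<kappa>_def using assms(2,3) al p d by (intro mult_pos_pos) (auto simp: field_simps)
  have kd: "d * p - \<kappa> = - d * e * p" unfolding \<kappa>_def e_def using p by (simp add: field_simps)
  obtain b where b: "b > 0" "\<And>r. r > 0 \<Longrightarrow> measure (dunkl_measure k) (centred_ball r) = b * r powr d"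
    using measure_centred_ball[OF k] unfolding d_def by blast
  obtain C1 where C1: "C1 > 0" "\<And>F r y. F \<in> borel_measurable borel \<Longrightarrow> r > 0 \<Longrightarrow> smoothed_integral k F r y \<le> ennreal C1 * annulus_avg k F r y"
    using smoothed_integral_le_avg[OF k] by blast
  obtain C2 where C2: "C2 > 0" "\<And>F r. F \<in> borel_measurable borel \<Longrightarrow> r > 0 \<Longrightarrow>
     (\<integral>\<^sup>+y. ennreal_rpow (annulus_avg k F r y) p \<partial>dunkl_measure k) \<le>
       ennreal C2 * (\<integral>\<^sup>+y. ennreal_rpow (smoothed_integral k F (2 * r) y) p \<partial>dunkl_measure k)"
    using avg_Lp_le[OF k p] by blast
  obtain C3 where C3: "C3 > 0" "\<And>F r y. F \<in> borel_measurable borel \<Longrightarrow> r > 0 \<Longrightarrow>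
     ennreal (r powr d) * ennreal_rpow (annulus_avg k F r y) p \<le>
       ennreal C3 * (\<integral>\<^sup>+z. ennreal_rpow (annulus_avg k F (2 * r) z) p \<partial>dunkl_measure k)"
    using annulus_avg_pointwise[OF k p] unfolding d_def by blast
  obtain C4 where C4: "C4 > 0" "\<And>r y x. r > 0 \<Longrightarrow> ball_translate k r y x \<le> C4 * ball_ratio k y r"
    using ball_translate_le[OF k] by blast
  obtain C5 where C5: "C5 > 0" and cover: "\<forall>F \<in> borel_measurable borel. \<forall>r>0. \<forall>y. \<forall>lev>0. \<forall>H.
     (\<forall>j. annulus_avg k F (2 ^ Suc j * r) y \<le> ennreal ((2 ^ Suc j * r) powr d) * H) \<longrightarrow>
     (\<exists>B\<in>sets borel. {x \<in> annulus y r. \<exists>s>0. ennreal (lev * s powr d) < annulus_avg k F s x} \<subseteq> B \<and>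
        emeasure (dunkl_measure k) B \<le> ennreal (C5 / lev * annulus_vol k y r) * H)"
    using annular_cover[OF k] unfolding d_def by (elim exE conjE)
  note cover = cover[rule_format]
  \<comment> \<open>\<open>D\<close> bounds the \<open>L\<^sup>p\<close> norms of the averages, and \<open>K\<close> the pointwise Morrey bound below; neither depends on \<open>f\<close>.\<close>
  define D where "D = C2 * b powr (- e * p) * 2 powr (- d * e * p)"
  define K where "K = C1 * (C3 * D * 2 powr (- d * e * p)) powr (1 / p)"
  define S where "S = (\<Sum>j. (2 powr (- \<kappa>)) ^ Suc j :: real)"
  define C6 where "C6 = C5 * C1 * C4"
  define Q0 where "Q0 = b powr (\<beta> / d - 1) * K powr a"
  define C where "C = b powr ((1 - a) * e) * (C6 powr (1 - a) * Q0 * (D * S) powr ((1 - a) / p))"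
  have D: "D > 0" using C2(1) b(1) by (simp add: D_def)
  have K: "K > 0" using C1(1) C3(1) D by (simp add: K_def)
  have C6: "C6 > 0" using C5 C1(1) C4(1) by (simp add: C6_def)
  have Q0: "Q0 > 0" using b K by (simp add: Q0_def)
  have S: "S \<ge> 0"
  proof -
    have "2 powr (- \<kappa>) < (1::real)" using kap by (simp add: powr_less_one)
    hence "summable (\<lambda>j. (2 powr (- \<kappa>)) ^ j :: real)" by (intro summable_geometric) simp
    hence "summable (\<lambda>j. (2 powr (- \<kappa>)) ^ Suc j :: real)" by (simp only: summable_Suc_iff)
    thus ?thesis unfolding S_def by (rule suminf_nonneg) simp
  qed
  have C: "C \<ge> 0" using Q0 by (simp add: C_def)
  moreover have "weak_amalgam_norm k qbar pbar \<alpha>s (fractional_maximal k \<beta> f) \<le> ennreal C * amalgam_norm k 1 p \<alpha> f"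
    if f: "f \<in> amalgam_space k 1 p \<alpha>" for f
  proof -
    have [measurable]: "f \<in> borel_measurable borel"
      using f measurable_cong_sets[OF sets_dunkl_measure[of k] refl] by (auto simp: amalgam_space_def)
    define F where "F x = ennreal (cmod (f x))" for x
    have F[measurable]: "F \<in> borel_measurable borel" unfolding F_def by measurable
    define N where "N = enn2real (amalgam_norm k 1 p \<alpha> f)"
    have N: "amalgam_norm k 1 p \<alpha> f = ennreal N" "N \<ge> 0"
      using f by (auto simp: amalgam_space_def N_def)
    let ?A = "\<lambda>r y. smoothed_integral k F r y"
    let ?G = "\<lambda>r y. annulus_avg k F r y"
    have AN: "(\<integral>\<^sup>+y. ennreal_rpow (?A r y) p \<partial>dunkl_measure k) \<le> ennreal (b powr (- e * p) * N powr p * r powr (- d * e * p))" if r: "r > 0" for r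
    proof -
      define c where "c = (b * r powr d) powr e"
      have c: "c > 0" using b r by (simp add: c_def)
      let ?X = "\<integral>\<^sup>+y. ennreal_rpow (?A r y) p \<partial>dunkl_measure k"
      have "ennreal (measure (dunkl_measure k) (centred_ball r) powr (1 / \<alpha> - 1 / 1 - 1 / p)) * local_amalgam_norm k r 1 p f \<le> ennreal N"
        unfolding N(1)[symmetric] amalgam_norm_def by (rule SUP_upper) (use r in simp)
      moreover have "local_amalgam_norm k r 1 p f = ennreal_rpow ?X (1 / p)"
        unfolding local_amalgam_norm_def Lp_norm_def using ball_integral_translate_eq[OF k r, of f]
        by (simp add: F_def[abs_def])
      ultimately have "ennreal c * ennreal_rpow ?X (1 / p) \<le> ennreal N"
        using b(2)[OF r] by (simp add: c_def e_def)
      hence "ennreal (1 / c) * (ennreal c * ennreal_rpow ?X (1 / p)) \<le> ennreal (1 / c) * ennreal N"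
        by (rule mult_left_mono) simp
      hence "ennreal_rpow ?X (1 / p) \<le> ennreal (N / c)"
        using c N by (simp add: mult.assoc[symmetric] ennreal_mult[symmetric])
      hence "ennreal_rpow (ennreal_rpow ?X (1 / p)) p \<le> ennreal_rpow (ennreal (N / c)) p"
        by (rule ennreal_rpow_mono[OF p])
      hence "?X \<le> ennreal ((N / c) powr p)"
        using p N c by (simp add: ennreal_rpow_rpow)
      also have "(N / c) powr p = b powr (- e * p) * N powr p * r powr (- d * e * p)"
      proof -
        have "N / c = N * (b powr (- e) * r powr (d * - e))"
          unfolding c_def powr_mult powr_powr by (simp add: powr_minus divide_inverse)
        hence "(N / c) powr p = N powr p * (b powr (- e * p) * r powr (d * - e * p))"
          by (simp only: powr_mult powr_powr)
        also have "d * - e * p = - d * e * p" by simp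
        finally show ?thesis by (simp only: mult_ac)
      qed
      finally show ?thesis .
    qed
    have GN: "(\<integral>\<^sup>+y. ennreal_rpow (?G r y) p \<partial>dunkl_measure k) \<le> ennreal (D * N powr p * r powr (d * p - \<kappa>))" if r: "r > 0" for r
    proof -
      have "(\<integral>\<^sup>+y. ennreal_rpow (?G r y) p \<partial>dunkl_measure k) \<le> ennreal C2 * ennreal (b powr (- e * p) * N powr p * (2 * r) powr (- d * e * p))"
        using C2(2)[OF F r] AN[of "2 * r"] r by (meson mult_left_mono order_trans zero_le mult_pos_pos zero_less_numeral)
      also have "\<dots> = ennreal (D * N powr p * r powr (d * p - \<kappa>))"
        unfolding kd D_def powr_mult[of 2 r] using C2(1) by (simp add: mult_ac flip: ennreal_mult)
      finally show ?thesis .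
    qed
    \<comment> \<open>A Morrey bound: the amalgam norm with \<open>p\<close> finite controls the one with \<open>p = \<infinity>\<close>.\<close>
    have AP: "?A r y \<le> ennreal (K * N * r powr (d * (1 - 1 / \<alpha>)))" if r: "r > 0" for r y
    proof -
      define L where "L = C3 * D * 2 powr (- d * e * p)"
      have L: "L > 0" using C3 D by (simp add: L_def)
      have "ennreal (r powr d) * ennreal_rpow (?G r y) p \<le> ennreal C3 * ennreal (D * N powr p * (2 * r) powr (d * p - \<kappa>))"
        using C3(2)[OF F r, of y] GN[of "2 * r"] r by (meson mult_left_mono order_trans zero_le mult_pos_pos zero_less_numeral)
      also have "\<dots> = ennreal (L * N powr p * r powr (- d * e * p))"
        unfolding kd L_def powr_mult[of 2 r] using C3(1) D by (simp add: mult_ac flip: ennreal_mult)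
      finally have "ennreal (r powr (- d)) * (ennreal (r powr d) * ennreal_rpow (?G r y) p) \<le> ennreal (r powr (- d)) * ennreal (L * N powr p * r powr (- d * e * p))"
        by (rule mult_left_mono) simp
      moreover have "ennreal (r powr (- d)) * ennreal (r powr d) = 1" using r by (simp flip: ennreal_mult powr_add)
      ultimately have "ennreal_rpow (?G r y) p \<le> ennreal (L * N powr p * (r powr (- d) * r powr (- d * e * p)))"
        using L by (simp add: mult.assoc[symmetric]) (simp add: mult_ac flip: ennreal_mult)
      also have "r powr (- d) * r powr (- d * e * p) = (r powr (d * (1 - 1 / \<alpha>))) powr p"
        unfolding powr_powr powr_add[symmetric]
        by (rule arg_cong[of _ _ "\<lambda>x. r powr x"]) (use p in \<open>simp add: e_def field_simps\<close>)
      also have "L * N powr p * (r powr (d * (1 - 1 / \<alpha>))) powr p = (L powr (1 / p) * N * r powr (d * (1 - 1 / \<alpha>))) powr p"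
        using L p by (simp add: powr_mult powr_powr)
      finally have Gp: "ennreal_rpow (?G r y) p \<le> ennreal ((L powr (1 / p) * N * r powr (d * (1 - 1 / \<alpha>))) powr p)" .
      have "?G r y \<le> ennreal (L powr (1 / p) * N * r powr (d * (1 - 1 / \<alpha>)))"
        by (rule ennreal_rpow_le_iff[OF p _ Gp]) (use N in simp)
      hence "ennreal C1 * ?G r y \<le> ennreal C1 * ennreal (L powr (1 / p) * N * r powr (d * (1 - 1 / \<alpha>)))"
        by (rule mult_left_mono) simp
      also have "\<dots> = ennreal (K * N * r powr (d * (1 - 1 / \<alpha>)))"
        using C1(1) N by (simp add: K_def L_def mult.assoc flip: ennreal_mult)
      finally show ?thesis using C1(2)[OF F r, of y] by (rule order_trans[rotated])
    qed
    \<comment> \<open>The factor in the interpolation inequality \<open>M\<^sub>\<beta> f \<le> Q (M f)^(1-a)\<close>, up to the constants in \<open>M\<close>.\<close>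
    define Q where "Q = Q0 * N powr a"
    have Q: "Q \<ge> 0" using Q0 by (simp add: Q_def)
    have main: "weak_Lp_norm k qbar (\<lambda>x. fractional_maximal k \<beta> f x * ennreal (translated_ball k r y x powr (1 / qbar)))
        \<le> ennreal_rpow (ennreal (C6 * r powr d * Q powr qbar) * H) (1 / qbar)"
      if r: "r > 0" and H: "\<And>j. ?G (2 ^ Suc j * r) y \<le> ennreal ((2 ^ Suc j * r) powr d) * H" for r y H
    proof (rule weak_Lp_norm_le[OF q])
      fix t :: real assume t: "t > 0"
      let ?W = "\<lambda>x. fractional_maximal k \<beta> f x * ennreal (translated_ball k r y x powr (1 / qbar))"
      let ?\<rho> = "ball_ratio k y r"
      have \<rho>: "?\<rho> > 0" using r by (simp add: ball_ratio_def)
      obtain Z where Z: "Z \<in> null_sets (dunkl_measure k)" "{x. translated_ball k r y x \<noteq> ball_translate k r y x} \<subseteq> Z"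
        using translated_ball_AE[OF k r, of y] by (auto simp: eventually_ae_filter)
      \<comment> \<open>A value of \<open>M\<^sub>\<beta> f\<close> above \<open>t\<close> forces an annular average above the level \<open>(t/Q)^qbar\<close> divided by the height of the translate.\<close>
      have key: "Q > 0 \<and> x \<in> annulus y r \<and> (\<exists>s>0. ennreal ((t / Q) powr qbar / (C1 * C4 * ?\<rho>) * s powr d) < ?G s x)"
        if x: "x \<notin> Z" and W: "ennreal t < ?W x" for x
      proof -
        have tb: "translated_ball k r y x = ball_translate k r y x" using Z(2) x by auto
        have nz: "ball_translate k r y x \<noteq> 0"
        proof
          assume "ball_translate k r y x = 0"
          hence "?W x = 0" using tb by simp
          with W have "ennreal t < 0" by (simp only:)
          thus False by simp
        qed
        have ann: "x \<in> annulus y r" using ball_translate_support[OF k r nz] by (simp add: annulus_def)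
        define \<tau> where "\<tau> = (C4 * ?\<rho>) powr (1 - a)"
        have tau: "translated_ball k r y x powr (1 / qbar) \<le> \<tau>"
          unfolding \<tau>_def q1 tb using a C4(2)[OF r, of y x] ball_translate_01(1)[OF k, of r y x] by (intro powr_mono2) auto
        have "ennreal t < fractional_maximal k \<beta> f x * ennreal \<tau>"
          using W tau by (meson ennreal_leI less_le_trans mult_left_mono zero_le)
        also have "fractional_maximal k \<beta> f x * ennreal \<tau> =
            (SUP s\<in>{0<..}. ennreal \<tau> * (ennreal (measure (dunkl_measure k) (centred_ball s) powr (\<beta> / (2 * k + 2) - 1)) * ball_integral_translate k s (\<lambda>z. cmod (f z)) x))"
          unfolding fractional_maximal_def by (simp add: SUP_mult_left_ennreal mult.commute[of _ "ennreal \<tau>"])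
        finally obtain s where s: "s > 0" and
          "ennreal t < ennreal \<tau> * (ennreal (measure (dunkl_measure k) (centred_ball s) powr (\<beta> / (2 * k + 2) - 1)) * ball_integral_translate k s (\<lambda>z. cmod (f z)) x)"
          unfolding less_SUP_iff by auto
        hence st: "ennreal t < ennreal \<tau> * (ennreal ((b * s powr d) powr (\<beta> / d - 1)) * ?A s x)"
          unfolding b(2)[OF s] ball_integral_translate_eq[OF k s] by (simp add: F_def[abs_def] d_def)
        obtain A where A: "?A s x = ennreal A" "A \<ge> 0"
          using AP[OF s, of x] by (cases "?A s x") (auto simp: top_unique)
        have AK: "A \<le> K * N * s powr (d * (1 - 1 / \<alpha>))"
          using AP[OF s, of x] A K N by (simp add: ennreal_le_iff)
        have "ennreal t < ennreal (\<tau> * ((b * s powr d) powr (\<beta> / d - 1) * A))"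
          using st A unfolding A(1) by (simp add: \<tau>_def ennreal_mult')
        hence tA: "t < \<tau> * ((b * s powr d) powr (\<beta> / d - 1) * A)"
          using t by (simp add: ennreal_less_iff)
        \<comment> \<open>Interpolation: the power \<open>A^a\<close> is estimated by the Morrey bound, and the exponents of \<open>s\<close> combine to \<open>-d (1-a)\<close>.\<close>
        have "A = A powr (1 - a) * A powr a" using A(2) by (cases "A = 0") (auto simp flip: powr_add)
        also have "A powr a \<le> (K * N * s powr (d * (1 - 1 / \<alpha>))) powr a"
          using A AK a by (intro powr_mono2) auto
        finally have "A \<le> A powr (1 - a) * (K powr a * N powr a * s powr (d * (1 - 1 / \<alpha>) * a))"
          by (simp add: powr_mult powr_powr mult_left_mono)
        hence "\<tau> * ((b * s powr d) powr (\<beta> / d - 1) * A) \<le>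
           \<tau> * ((b * s powr d) powr (\<beta> / d - 1) * (A powr (1 - a) * (K powr a * N powr a * s powr (d * (1 - 1 / \<alpha>) * a))))"
          by (intro mult_left_mono) (auto simp: \<tau>_def)
        also have "\<dots> = Q * (\<tau> * A powr (1 - a) * (s powr (d * (\<beta> / d - 1)) * s powr (d * (1 - 1 / \<alpha>) * a)))"
          by (simp add: Q_def Q0_def powr_mult powr_powr mult_ac)
        also have "s powr (d * (\<beta> / d - 1)) * s powr (d * (1 - 1 / \<alpha>) * a) = (s powr (- d)) powr (1 - a)"
          unfolding powr_powr powr_add[symmetric]
          by (rule arg_cong[of _ _ "\<lambda>x. s powr x"]) (use d al in \<open>simp add: b1 field_simps\<close>)
        also have "\<tau> * A powr (1 - a) * (s powr (- d)) powr (1 - a) = (C4 * ?\<rho> * A * s powr (- d)) powr (1 - a)"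
          unfolding \<tau>_def by (simp only: powr_mult)
        finally have tQ: "t < Q * (C4 * ?\<rho> * A * s powr (- d)) powr (1 - a)" using tA by linarith
        have Qp: "Q > 0"
        proof (rule ccontr)
          assume "\<not> Q > 0"
          hence "Q = 0" using Q by simp
          thus False using tQ t by simp
        qed
        have "t / Q < (C4 * ?\<rho> * A * s powr (- d)) powr (1 - a)" using tQ Qp by (simp add: field_simps)
        hence "(t / Q) powr qbar < ((C4 * ?\<rho> * A * s powr (- d)) powr (1 - a)) powr qbar"
          using t Qp q by (intro powr_less_mono2) auto
        also have "\<dots> = C4 * ?\<rho> * A * s powr (- d)"
          using qq C4(1) \<rho> A by (simp add: powr_powr mult.commute)
        finally have "(t / Q) powr qbar * s powr d < C4 * ?\<rho> * A * s powr (- d) * s powr d"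
          using s by (intro mult_strict_right_mono) auto
        also have "\<dots> = C4 * ?\<rho> * A" using s by (simp add: mult.assoc flip: powr_add)
        finally have "(t / Q) powr qbar / (C1 * C4 * ?\<rho>) * s powr d < A / C1"
          using C1(1) C4(1) \<rho> by (simp add: field_simps)
        hence "ennreal ((t / Q) powr qbar / (C1 * C4 * ?\<rho>) * s powr d) < ennreal (A / C1)"
          using C1(1) C4(1) \<rho> by (subst ennreal_less_iff) auto
        also have "ennreal (A / C1) \<le> ?G s x"
        proof -
          have "ennreal (1 / C1) * ennreal A \<le> ennreal (1 / C1) * (ennreal C1 * ?G s x)"
            using C1(2)[OF F s, of x] unfolding A(1) by (rule mult_left_mono) simp
          thus ?thesis using C1(1) A by (simp add: mult.assoc[symmetric] ennreal_mult[symmetric])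
        qed
        finally show ?thesis using Qp ann s by blast
      qed
      show "\<exists>B\<in>sets borel. {x. ennreal t < ?W x} \<subseteq> B \<and> emeasure (dunkl_measure k) B \<le> ennreal (t powr (- qbar)) * (ennreal (C6 * r powr d * Q powr qbar) * H)"
      proof (cases "Q > 0")
        case False
        thus ?thesis using key Z(1) by (intro bexI[of _ Z]) (auto simp: null_sets_def)
      next
        case True
        define lev where "lev = (t / Q) powr qbar / (C1 * C4 * ?\<rho>)"
        have lev: "lev > 0" using t True C1(1) C4(1) \<rho> by (simp add: lev_def)
        obtain B where B: "B \<in> sets borel" "{x \<in> annulus y r. \<exists>s>0. ennreal (lev * s powr d) < annulus_avg k F s x} \<subseteq> B"
          "emeasure (dunkl_measure k) B \<le> ennreal (C5 / lev * annulus_vol k y r) * H"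
          using cover[OF F r lev H] by blast
        have "C5 / lev * annulus_vol k y r = C6 * (?\<rho> * annulus_vol k y r) * (Q / t) powr qbar"
          using t True by (simp add: lev_def C6_def powr_divide field_simps)
        also have "?\<rho> * annulus_vol k y r = r powr d" unfolding d_def by (rule ball_ratio_vol[OF r])
        also have "C6 * r powr d * (Q / t) powr qbar = t powr (- qbar) * (C6 * r powr d * Q powr qbar)"
          by (simp add: powr_divide powr_minus_divide)
        finally have eq: "C5 / lev * annulus_vol k y r = t powr (- qbar) * (C6 * r powr d * Q powr qbar)" .
        have "emeasure (dunkl_measure k) (B \<union> Z) = emeasure (dunkl_measure k) B"
          using B(1) Z(1) by (intro emeasure_Un_null_set) auto
        also have "\<dots> \<le> ennreal (t powr (- qbar)) * (ennreal (C6 * r powr d * Q powr qbar) * H)"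
          using B(3) C6 unfolding eq by (simp add: ennreal_mult mult.assoc)
        finally have m: "emeasure (dunkl_measure k) (B \<union> Z) \<le> ennreal (t powr (- qbar)) * (ennreal (C6 * r powr d * Q powr qbar) * H)" .
        have "{x. ennreal t < ?W x} \<subseteq> B \<union> Z"
          using key B(2) unfolding lev_def by blast
        moreover have "B \<union> Z \<in> sets borel" using B(1) Z(1) by (auto simp: null_sets_def)
        ultimately show ?thesis using m by blast
      qed
    qed
    show ?thesis
      unfolding weak_amalgam_norm_def
    proof (rule SUP_least)
      fix r :: real assume "r \<in> {0<..}"
      hence r: "r > 0" by simp
      obtain Hp where Hp[measurable]: "Hp \<in> borel_measurable borel"
        and Hj: "\<And>y j. ?G (2 ^ Suc j * r) y \<le> ennreal ((2 ^ Suc j * r) powr d) * ennreal_rpow (Hp y) (1 / p)"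
        and Hi: "(\<integral>\<^sup>+y. Hp y \<partial>dunkl_measure k) \<le> ennreal (D * N powr p * r powr (- \<kappa>) * S)"
        using dyadic_majorant[OF k p kap F, of "D * N powr p" r] GN D r unfolding d_def S_def by auto
      let ?w = "\<lambda>y. weak_Lp_norm k qbar (\<lambda>x. fractional_maximal k \<beta> f x * ennreal (translated_ball k r y x powr (1 / qbar)))"
      let ?c = "C6 * r powr d * Q powr qbar"
      \<comment> \<open>As \<open>pbar = p qbar\<close>, the \<open>pbar\<close>-th power of the weak norm is the \<open>p\<close>-th power of the majorant.\<close>
      have w: "ennreal_rpow (?w y) pbar \<le> ennreal (?c powr p) * Hp y" for y
      proof -
        have "ennreal_rpow (?w y) pbar \<le> ennreal_rpow (ennreal_rpow (ennreal ?c * ennreal_rpow (Hp y) (1 / p)) (1 / qbar)) pbar"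
          by (rule ennreal_rpow_mono[OF pb main[OF r Hj]])
        also have "\<dots> = ennreal_rpow (ennreal ?c * ennreal_rpow (Hp y) (1 / p)) p"
          using q pq by (subst ennreal_rpow_rpow) auto
        also have "\<dots> = ennreal (?c powr p) * Hp y"
        proof (cases "Q = 0")
          case False
          hence "?c > 0" using Q C6 r by simp
          thus ?thesis using p by (simp add: ennreal_rpow_mult ennreal_rpow_rpow)
        qed simp
        finally show ?thesis .
      qed
      have "(\<integral>\<^sup>+y. ennreal_rpow (?w y) pbar \<partial>dunkl_measure k) \<le> (\<integral>\<^sup>+y. ennreal (?c powr p) * Hp y \<partial>dunkl_measure k)"
        by (rule nn_integral_mono) (rule w)
      also have "\<dots> = ennreal (?c powr p) * (\<integral>\<^sup>+y. Hp y \<partial>dunkl_measure k)" by (rule nn_integral_cmult) measurable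
      also have "\<dots> \<le> ennreal (?c powr p) * ennreal (D * N powr p * r powr (- \<kappa>) * S)" by (rule mult_left_mono[OF Hi]) simp
      also have "\<dots> = ennreal (?c powr p * (D * N powr p * r powr (- \<kappa>) * S))" using D S by (simp flip: ennreal_mult)
      finally have "Lp_norm k pbar ?w \<le> ennreal_rpow (ennreal (?c powr p * (D * N powr p * r powr (- \<kappa>) * S))) (1 / pbar)"
        unfolding Lp_norm_def using pb by (intro ennreal_rpow_mono) auto
      also have "\<dots> = ennreal ((?c powr p * (D * N powr p * r powr (- \<kappa>) * S)) powr ((1 - a) / p))"
        unfolding p1 using D S by (intro ennreal_rpow_ennreal mult_nonneg_nonneg) auto
      also have "(?c powr p * (D * N powr p * r powr (- \<kappa>) * S)) powr ((1 - a) / p) =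
          C6 powr (1 - a) * Q * (D * S) powr ((1 - a) / p) * N powr (1 - a) * (r powr (d * (1 - a)) * r powr (- \<kappa> * ((1 - a) / p)))"
        using p qq Q by (simp add: powr_mult powr_powr mult_ac)
      also have "Q = Q0 * N powr a" by (simp add: Q_def)
      also have "C6 powr (1 - a) * (Q0 * N powr a) * (D * S) powr ((1 - a) / p) * N powr (1 - a) * (r powr (d * (1 - a)) * r powr (- \<kappa> * ((1 - a) / p))) =
         C6 powr (1 - a) * Q0 * (D * S) powr ((1 - a) / p) * (N powr a * N powr (1 - a)) * (r powr (d * (1 - a)) * r powr (- \<kappa> * ((1 - a) / p)))"
        by (simp add: mult_ac)
      also have "N powr a * N powr (1 - a) = N" using N by (simp flip: powr_add)
      \<comment> \<open>This power of \<open>r\<close> cancels the factor \<open>\<mu>(B\<^sub>r)^((1-a) e)\<close> of the norm.\<close>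
      also have "r powr (d * (1 - a)) * r powr (- \<kappa> * ((1 - a) / p)) = r powr (- d * ((1 - a) * e))"
        unfolding powr_add[symmetric] \<kappa>_def e_def
        by (rule arg_cong[of _ _ "\<lambda>x. r powr x"]) (use p al in \<open>simp add: field_simps\<close>)
      finally have L: "Lp_norm k pbar ?w \<le> ennreal (C6 powr (1 - a) * Q0 * (D * S) powr ((1 - a) / p) * N * r powr (- d * ((1 - a) * e)))" .
      have "ennreal (measure (dunkl_measure k) (centred_ball r) powr (1 / \<alpha>s - 1 / qbar - 1 / pbar)) * Lp_norm k pbar ?w \<le>
         ennreal ((b * r powr d) powr ((1 - a) * e)) * ennreal (C6 powr (1 - a) * Q0 * (D * S) powr ((1 - a) / p) * N * r powr (- d * ((1 - a) * e)))"
        unfolding s1 b(2)[OF r] by (rule mult_left_mono[OF L]) simp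
      also have "\<dots> = ennreal ((b * r powr d) powr ((1 - a) * e) * (C6 powr (1 - a) * Q0 * (D * S) powr ((1 - a) / p) * N * r powr (- d * ((1 - a) * e))))"
        by (rule ennreal_mult[symmetric]) (use Q0 N in auto)
      also have "(b * r powr d) powr ((1 - a) * e) * (C6 powr (1 - a) * Q0 * (D * S) powr ((1 - a) / p) * N * r powr (- d * ((1 - a) * e))) = C * N"
      proof -
        have "r powr (d * ((1 - a) * e)) * r powr (- d * ((1 - a) * e)) = 1" using r by (simp flip: powr_add)
        moreover have "(b * r powr d) powr ((1 - a) * e) * (C6 powr (1 - a) * Q0 * (D * S) powr ((1 - a) / p) * N * r powr (- d * ((1 - a) * e)))
           = C * N * (r powr (d * ((1 - a) * e)) * r powr (- d * ((1 - a) * e)))"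
          unfolding C_def powr_mult[of b] powr_powr by (simp only: mult_ac)
        ultimately show ?thesis by simp
      qed
      also have "ennreal (C * N) = ennreal C * amalgam_norm k 1 p \<alpha> f" unfolding N(1) using C N by (simp add: ennreal_mult)
      finally show "ennreal (measure (dunkl_measure k) (centred_ball r) powr (1 / \<alpha>s - 1 / qbar - 1 / pbar)) * Lp_norm k pbar ?w \<le> ennreal C * amalgam_norm k 1 p \<alpha> f" .
    qed
  qed
  ultimately show ?thesis by blast
qed

end
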